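(* Let $G = A \ast B$ be the free product of two non-trivial freely indecomposable groups $A$ and $B$, and assume that $G$ is not the infinite dihedral group. Then there exists a stably unbounded Aut-invariant norm on $G$.
   Context: A group is freely indecomposable if it is non-trivial and not isomorphic to any free product $G_1 \ast G_2$ with $G_1, G_2$ non-trivial. The infinite dihedral group is $\mathbb{Z}/2 \ast \mathbb{Z}/2$. A norm on a group $G$ is a function $\nu \colon G \to \mathbb{R}$ such that for all $g,h \in G$: $\nu(g) \geq 0$; $\nu(g) = 0$ if and only if $g = 1$; $\nu(gh) \leq \nu(g) + \nu(h)$. It is Aut-invariant if $\nu(\varphi(g)) = \nu(g)$ for all $g \in G$ and $\varphi \in \mathrm{Aut}(G)$. It is stably unbounded if there exists $g \in G$ with $\lim_{n \to \infty} \nu(g^n) = \infty$. *)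

theory Defs
  imports Complex_Main "HOL-Algebra.Elementary_Groups" "HOL-Algebra.Bij"
begin

section \<open>Free products of two groups\<close>

text \<open>
  The elements of $A * B$ are the reduced words: lists of non-trivial elements of the two factors
  in which neighbouring letters come from different factors. A product is computed by pushing
  the letters of the left word one after the other onto the right word.
\<close>

fun letter :: "('a, 'm) monoid_scheme \<Rightarrow> ('b, 'n) monoid_scheme \<Rightarrow> 'a + 'b \<Rightarrow> bool" where
  "letter A B (Inl a) \<longleftrightarrow> a \<in> carrier A \<and> a \<noteq> \<one>\<^bsub>A\<^esub>"
| "letter A B (Inr b) \<longleftrightarrow> b \<in> carrier B \<and> b \<noteq> \<one>\<^bsub>B\<^esub>"

definition reduced_word ::
    "('a, 'm) monoid_scheme \<Rightarrow> ('b, 'n) monoid_scheme \<Rightarrow> ('a + 'b) list \<Rightarrow> bool" where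
  "reduced_word A B w \<longleftrightarrow> list_all (letter A B) w \<and> successively (\<lambda>x y. isl x \<noteq> isl y) w"

fun push_letter ::
    "('a, 'm) monoid_scheme \<Rightarrow> ('b, 'n) monoid_scheme
      \<Rightarrow> 'a + 'b \<Rightarrow> ('a + 'b) list \<Rightarrow> ('a + 'b) list" where
  "push_letter A B (Inl a) (Inl a' # w) =
     (if a \<otimes>\<^bsub>A\<^esub> a' = \<one>\<^bsub>A\<^esub> then w else Inl (a \<otimes>\<^bsub>A\<^esub> a') # w)"
| "push_letter A B (Inr b) (Inr b' # w) =
     (if b \<otimes>\<^bsub>B\<^esub> b' = \<one>\<^bsub>B\<^esub> then w else Inr (b \<otimes>\<^bsub>B\<^esub> b') # w)"
| "push_letter A B x w = x # w"

definition free_product ::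
    "('a, 'm) monoid_scheme \<Rightarrow> ('b, 'n) monoid_scheme \<Rightarrow> ('a + 'b) list monoid" where
  "free_product A B =
     \<lparr>carrier = {w. reduced_word A B w},
      monoid.mult = foldr (push_letter A B),
      one = []\<rparr>"

lemma reduced_word_Nil [simp]: "reduced_word A B []"
  by (simp add: reduced_word_def)

lemma reduced_word_Cons:
  "reduced_word A B (x # w) \<longleftrightarrow>
     letter A B x \<and> reduced_word A B w \<and> (w = [] \<or> isl x \<noteq> isl (hd w))"
  by (auto simp: reduced_word_def successively_Cons)

lemma push_letter_alternating:
  "w = [] \<or> isl x \<noteq> isl (hd w) \<Longrightarrow> push_letter A B x w = x # w"
  by (cases "(A, B, x, w)" rule: push_letter.cases) auto

context
  fixes A :: "('a, 'm) monoid_scheme" and B :: "('b, 'n) monoid_scheme"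
  assumes grpA: "group A" and grpB: "group B"
begin

lemma reduced_word_push_letter:
  assumes "letter A B x" "reduced_word A B w"
  shows "reduced_word A B (push_letter A B x w)"
proof -
  interpret A: group A by (rule grpA)
  interpret B: group B by (rule grpB)
  show ?thesis using assms
    by (cases "(A, B, x, w)" rule: push_letter.cases) (auto simp: reduced_word_Cons)
qed

lemma reduced_word_foldr_push_letter:
  assumes "reduced_word A B u" "reduced_word A B w"
  shows "reduced_word A B (foldr (push_letter A B) u w)"
  using assms by (induction u) (auto simp: reduced_word_Cons intro: reduced_word_push_letter)

lemma push_letter_Inl_Inl:
  assumes "letter A B (Inl a)" "letter A B (Inl a')" "reduced_word A B w"
  shows "push_letter A B (Inl a) (push_letter A B (Inl a') w) =
    (if a \<otimes>\<^bsub>A\<^esub> a' = \<one>\<^bsub>A\<^esub> then w else push_letter A B (Inl (a \<otimes>\<^bsub>A\<^esub> a')) w)"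
proof -
  interpret A: group A by (rule grpA)
  show ?thesis
  proof (cases "w = [] \<or> \<not> isl (hd w)")
    case True
    then show ?thesis by (auto simp: push_letter_alternating)
  next
    case False
    then obtain c v where w: "w = Inl c # v"
      by (cases w) (auto simp: isl_def)
    have cl: "a \<in> carrier A" "a' \<in> carrier A" "c \<in> carrier A" "a \<noteq> \<one>\<^bsub>A\<^esub>" "c \<noteq> \<one>\<^bsub>A\<^esub>"
      and v: "v = [] \<or> \<not> isl (hd v)"
      using assms by (auto simp: w reduced_word_Cons)
    have 1: "a \<otimes>\<^bsub>A\<^esub> a' \<otimes>\<^bsub>A\<^esub> c = a" if "a' \<otimes>\<^bsub>A\<^esub> c = \<one>\<^bsub>A\<^esub>"
      using cl that by (simp add: A.m_assoc)
    have 2: "a \<otimes>\<^bsub>A\<^esub> (a' \<otimes>\<^bsub>A\<^esub> c) = c" if "a \<otimes>\<^bsub>A\<^esub> a' = \<one>\<^bsub>A\<^esub>"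
      using cl that by (simp add: A.m_assoc[symmetric])
    have 3: "a = c" if "a \<otimes>\<^bsub>A\<^esub> a' = \<one>\<^bsub>A\<^esub>" "a' \<otimes>\<^bsub>A\<^esub> c = \<one>\<^bsub>A\<^esub>"
      using cl that by (metis A.inv_equality A.inv_unique)
    show ?thesis
      using 1 2 3 cl v by (auto simp: w push_letter_alternating A.m_assoc)
  qed
qed

lemma push_letter_Inr_Inr:
  assumes "letter A B (Inr b)" "letter A B (Inr b')" "reduced_word A B w"
  shows "push_letter A B (Inr b) (push_letter A B (Inr b') w) =
    (if b \<otimes>\<^bsub>B\<^esub> b' = \<one>\<^bsub>B\<^esub> then w else push_letter A B (Inr (b \<otimes>\<^bsub>B\<^esub> b')) w)"
proof -
  interpret B: group B by (rule grpB)
  show ?thesis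
  proof (cases "w = [] \<or> isl (hd w)")
    case True
    then show ?thesis by (auto simp: push_letter_alternating)
  next
    case False
    then obtain c v where w: "w = Inr c # v"
      by (metis list.collapse sum.collapse(2))
    have cl: "b \<in> carrier B" "b' \<in> carrier B" "c \<in> carrier B" "b \<noteq> \<one>\<^bsub>B\<^esub>" "c \<noteq> \<one>\<^bsub>B\<^esub>"
      and v: "v = [] \<or> isl (hd v)"
      using assms by (auto simp: w reduced_word_Cons)
    have 1: "b \<otimes>\<^bsub>B\<^esub> b' \<otimes>\<^bsub>B\<^esub> c = b" if "b' \<otimes>\<^bsub>B\<^esub> c = \<one>\<^bsub>B\<^esub>"
      using cl that by (simp add: B.m_assoc)
    have 2: "b \<otimes>\<^bsub>B\<^esub> (b' \<otimes>\<^bsub>B\<^esub> c) = c" if "b \<otimes>\<^bsub>B\<^esub> b' = \<one>\<^bsub>B\<^esub>"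
      using cl that by (simp add: B.m_assoc[symmetric])
    have 3: "b = c" if "b \<otimes>\<^bsub>B\<^esub> b' = \<one>\<^bsub>B\<^esub>" "b' \<otimes>\<^bsub>B\<^esub> c = \<one>\<^bsub>B\<^esub>"
      using cl that by (metis B.inv_equality B.inv_unique)
    show ?thesis
      using 1 2 3 cl v by (auto simp: w push_letter_alternating B.m_assoc)
  qed
qed

lemma foldr_push_letter_push_letter:
  assumes "letter A B x" "reduced_word A B u" "reduced_word A B w"
  shows "foldr (push_letter A B) (push_letter A B x u) w =
    push_letter A B x (foldr (push_letter A B) u w)"
proof -
  consider a a' v where "x = Inl a" "u = Inl a' # v" | b b' v where "x = Inr b" "u = Inr b' # v"
    | "push_letter A B x u = x # u"
    by (cases "(A, B, x, u)" rule: push_letter.cases) auto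
  then show ?thesis
  proof cases
    case 1
    then show ?thesis using assms
      by (simp add: push_letter_Inl_Inl reduced_word_Cons reduced_word_foldr_push_letter)
  next
    case 2
    then show ?thesis using assms
      by (simp add: push_letter_Inr_Inr reduced_word_Cons reduced_word_foldr_push_letter)
  qed auto
qed

lemma foldr_push_letter_assoc:
  assumes "reduced_word A B u" "reduced_word A B v" "reduced_word A B w"
  shows "foldr (push_letter A B) (foldr (push_letter A B) u v) w =
    foldr (push_letter A B) u (foldr (push_letter A B) v w)"
  using assms
  by (induction u)
    (auto simp: reduced_word_Cons foldr_push_letter_push_letter reduced_word_foldr_push_letter)

lemma foldr_push_letter_Nil:
  "reduced_word A B u \<Longrightarrow> foldr (push_letter A B) u [] = u"
  by (induction u) (auto simp: reduced_word_Cons push_letter_alternating)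

lemma letter_inverse:
  assumes "letter A B x"
  obtains y where "letter A B y" "push_letter A B y [x] = []"
proof -
  interpret A: group A by (rule grpA)
  interpret B: group B by (rule grpB)
  show ?thesis
  proof (cases x)
    case (Inl a)
    then show ?thesis using assms by (intro that[of "Inl (inv\<^bsub>A\<^esub> a)"]) auto
  next
    case (Inr b)
    then show ?thesis using assms by (intro that[of "Inr (inv\<^bsub>B\<^esub> b)"]) auto
  qed
qed

lemma reduced_word_left_inverse:
  assumes "reduced_word A B u"
  shows "\<exists>v. reduced_word A B v \<and> foldr (push_letter A B) v u = []"
  using assms
proof (induction u)
  case Nil
  then show ?case by (intro exI[of _ "[]"]) auto
next
  case (Cons x u)
  then obtain v where v: "reduced_word A B v" "foldr (push_letter A B) v u = []"
    by (auto simp: reduced_word_Cons)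
  obtain y where y: "letter A B y" "push_letter A B y [x] = []"
    using Cons.prems letter_inverse by (auto simp: reduced_word_Cons)
  have xu: "letter A B x" "reduced_word A B u" "x # u = push_letter A B x u"
    using Cons.prems by (auto simp: reduced_word_Cons push_letter_alternating)
  have rx: "reduced_word A B [x]" "reduced_word A B [y]"
    using xu y by (simp_all add: reduced_word_Cons)
  have "push_letter A B y (x # u) = foldr (push_letter A B) (push_letter A B y [x]) u"
    using foldr_push_letter_push_letter[OF y(1) rx(1) xu(2)] xu by simp
  then have yxu: "push_letter A B y (x # u) = u"
    using y by simp
  have "foldr (push_letter A B) (foldr (push_letter A B) v [y]) (x # u) = []"
    using foldr_push_letter_assoc[OF v(1) rx(2) Cons.prems] yxu v by simp
  then show ?case
    using reduced_word_foldr_push_letter[OF v(1) rx(2)] by blast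
qed

theorem group_free_product: "group (free_product A B)"
proof (rule groupI)
  fix u assume "u \<in> carrier (free_product A B)"
  then show "\<exists>v\<in>carrier (free_product A B). v \<otimes>\<^bsub>free_product A B\<^esub> u = \<one>\<^bsub>free_product A B\<^esub>"
    using reduced_word_left_inverse by (auto simp: free_product_def)
qed (auto simp: free_product_def foldr_push_letter_assoc reduced_word_foldr_push_letter)

end

lemma free_product_iso:
  assumes grp: "group A" "group B" "group A'" "group B'"
    and iso: "A \<cong> A'" "B \<cong> B'"
  shows "free_product A B \<cong> free_product A' B'"
proof -
  obtain i j where i: "i \<in> iso A A'" and j: "j \<in> iso B B'"
    using iso by (auto simp: is_iso_def)
  interpret i: group_hom A A' i
    using i grp by (simp add: group_hom_def group_hom_axioms_def iso_def)
  interpret j: group_hom B B' j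
    using j grp by (simp add: group_hom_def group_hom_axioms_def iso_def)
  have inj: "inj_on i (carrier A)" "inj_on j (carrier B)"
    and im: "i ` carrier A = carrier A'" "j ` carrier B = carrier B'"
    using i j by (auto simp: iso_iff)
  have i1: "i a = \<one>\<^bsub>A'\<^esub> \<longleftrightarrow> a = \<one>\<^bsub>A\<^esub>" if "a \<in> carrier A" for a
    using inj(1) that by (metis i.hom_one i.G.one_closed inj_onD)
  have j1: "j b = \<one>\<^bsub>B'\<^esub> \<longleftrightarrow> b = \<one>\<^bsub>B\<^esub>" if "b \<in> carrier B" for b
    using inj(2) that by (metis j.hom_one j.G.one_closed inj_onD)
  define f where "f = map_sum i j"
  have f_simps [simp]: "f (Inl a) = Inl (i a)" "f (Inr b) = Inr (j b)" for a b
    by (simp_all add: f_def)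
  have isl_f [simp]: "isl (f x) = isl x" for x
    by (cases x) auto
  have letter_f: "letter A' B' (f x)" if "letter A B x" for x
    using that by (cases x) (auto simp: i1 j1)
  have reduced_f: "reduced_word A' B' (map f w)" if "reduced_word A B w" for w
    using that by (induction w) (auto simp: reduced_word_Cons letter_f hd_map)
  have push_f: "map f (push_letter A B x w) = push_letter A' B' (f x) (map f w)"
    if "letter A B x" "reduced_word A B w" for x w
  proof -
    consider a a' v where "x = Inl a" "w = Inl a' # v" | b b' v where "x = Inr b" "w = Inr b' # v"
      | "w = [] \<or> isl x \<noteq> isl (hd w)"
      by (cases "(A, B, x, w)" rule: push_letter.cases) auto
    then show ?thesis
    proof cases
      case 1
      then show ?thesis using that i1[of "a \<otimes>\<^bsub>A\<^esub> a'"] by (auto simp: reduced_word_Cons)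
    next
      case 2
      then show ?thesis using that j1[of "b \<otimes>\<^bsub>B\<^esub> b'"] by (auto simp: reduced_word_Cons)
    next
      case 3
      then show ?thesis by (simp add: push_letter_alternating hd_map disj_imp)
    qed
  qed
  have foldr_f: "map f (foldr (push_letter A B) u w) = foldr (push_letter A' B') (map f u) (map f w)"
    if "reduced_word A B u" "reduced_word A B w" for u w
    using that
    by (induction u) (auto simp: reduced_word_Cons push_f reduced_word_foldr_push_letter grp)
  have inj_f: "inj_on f {x. letter A B x}"
  proof (rule inj_onI)
    fix x y assume "x \<in> {x. letter A B x}" "y \<in> {x. letter A B x}" "f x = f y"
    then show "x = y"
      using inj by (cases x; cases y) (auto dest: inj_onD)
  qed
  have "inj_on (map f) {w. reduced_word A B w}"
  proof (rule inj_on_mapI[OF inj_on_subset[OF inj_f]])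
    show "\<Union> (set ` {w. reduced_word A B w}) \<subseteq> {x. letter A B x}"
      by (auto simp: reduced_word_def list_all_iff)
  qed
  moreover have "\<exists>u. reduced_word A B u \<and> map f u = w" if "reduced_word A' B' w" for w
    using that
  proof (induction w)
    case Nil
    then show ?case by auto
  next
    case (Cons y w)
    then obtain u where u: "reduced_word A B u" "map f u = w"
      by (auto simp: reduced_word_Cons)
    obtain x where x: "letter A B x" "f x = y"
    proof (cases y)
      case (Inl a)
      then have "a \<in> i ` carrier A"
        using Cons.prems im by (simp add: reduced_word_Cons)
      then obtain c where "c \<in> carrier A" "i c = a"
        by blast
      then show ?thesis using that[of "Inl c"] i1[of c] Inl Cons.prems by (auto simp: reduced_word_Cons)
    next
      case (Inr b)
      then have "b \<in> j ` carrier B"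
        using Cons.prems im by (simp add: reduced_word_Cons)
      then obtain c where "c \<in> carrier B" "j c = b"
        by blast
      then show ?thesis using that[of "Inr c"] j1[of c] Inr Cons.prems by (auto simp: reduced_word_Cons)
    qed
    have "reduced_word A B (x # u)"
      using Cons.prems x u by (cases u) (auto simp: reduced_word_Cons)
    then show ?case
      using x u by (intro exI[of _ "x # u"]) auto
  qed
  ultimately have "map f \<in> iso (free_product A B) (free_product A' B')"
    by (auto simp: iso_iff hom_def free_product_def reduced_f foldr_f image_iff)
  then show ?thesis by (rule is_isoI)
qed

lemma free_product_factors_embed:
  assumes "group A" "group B"
  shows "(\<lambda>a. if a = \<one>\<^bsub>A\<^esub> then [] else [Inl a]) \<in> mon A (free_product A B)"
    and "(\<lambda>b. if b = \<one>\<^bsub>B\<^esub> then [] else [Inr b]) \<in> mon B (free_product A B)"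
proof -
  interpret A: group A by (rule assms)
  interpret B: group B by (rule assms)
  show "(\<lambda>a. if a = \<one>\<^bsub>A\<^esub> then [] else [Inl a]) \<in> mon A (free_product A B)"
    by (auto simp: mon_def hom_def free_product_def reduced_word_Cons inj_on_def split: if_splits)
  show "(\<lambda>b. if b = \<one>\<^bsub>B\<^esub> then [] else [Inr b]) \<in> mon B (free_product A B)"
    by (auto simp: mon_def hom_def free_product_def reduced_word_Cons inj_on_def split: if_splits)
qed

section \<open>Freely indecomposable groups\<close>

text \<open>
  The factors range over groups whose carrier lives in the type of \<open>G\<close>. This is no restriction:
  factors of a free product decomposition of \<open>G\<close> embed into \<open>G\<close>; see
  \<open>not_freely_indecomposable\<close> below, where the factors live in arbitrary types.
\<close>

definition freely_indecomposable :: "('a, 'm) monoid_scheme \<Rightarrow> bool" where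
  "freely_indecomposable G \<longleftrightarrow>
     group G \<and> \<not> trivial_group G \<and>
     \<not> (\<exists>(G1 :: 'a monoid) (G2 :: 'a monoid).
          group G1 \<and> group G2 \<and> \<not> trivial_group G1 \<and> \<not> trivial_group G2 \<and>
          G \<cong> free_product G1 G2)"

lemma isomorphic_copy_of_mon:
  fixes G :: "('a, 'm) monoid_scheme"
  assumes "group H" "group G" "h \<in> mon H G"
  obtains K :: "'a monoid" where "group K" "H \<cong> K"
proof -
  interpret h: group_hom H G h
    using assms by (simp add: group_hom_def group_hom_axioms_def mon_def)
  define K where "K = \<lparr>carrier = h ` carrier H, monoid.mult = (\<otimes>\<^bsub>G\<^esub>), one = \<one>\<^bsub>G\<^esub>\<rparr>"
  have K: "group K"
  proof (rule groupI)
    fix x y assume "x \<in> carrier K" "y \<in> carrier K"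
    then obtain a b where "a \<in> carrier H" "b \<in> carrier H" "x = h a" "y = h b"
      by (auto simp: K_def)
    then show "x \<otimes>\<^bsub>K\<^esub> y \<in> carrier K"
      by (auto simp: K_def intro!: image_eqI[of _ _ "a \<otimes>\<^bsub>H\<^esub> b"])
  next
    show "\<one>\<^bsub>K\<^esub> \<in> carrier K"
      by (auto simp: K_def intro!: image_eqI[of _ _ "\<one>\<^bsub>H\<^esub>"])
  next
    fix x assume "x \<in> carrier K"
    then obtain a where "a \<in> carrier H" "x = h a"
      by (auto simp: K_def)
    then show "\<exists>y\<in>carrier K. y \<otimes>\<^bsub>K\<^esub> x = \<one>\<^bsub>K\<^esub>"
      by (auto simp: K_def intro!: bexI[of _ "inv\<^bsub>H\<^esub> a"])
  qed (auto simp: K_def h.H.m_assoc)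
  have "h \<in> iso H K"
    using assms(3) by (auto simp: iso_iff mon_def hom_def K_def)
  then show ?thesis using K that by (auto simp: is_iso_def)
qed

lemma trivial_group_iso_iff:
  assumes "group H" "group K" "H \<cong> K"
  shows "trivial_group H \<longleftrightarrow> trivial_group K"
proof -
  obtain f where f: "f \<in> iso H K" using assms by (auto simp: is_iso_def)
  have f1: "f \<one>\<^bsub>H\<^esub> = \<one>\<^bsub>K\<^esub>"
    using f assms by (auto simp: iso_def intro: hom_one)
  have inj: "inj_on f (carrier H)" and im: "f ` carrier H = carrier K"
    using f by (auto simp: iso_iff)
  have "\<one>\<^bsub>H\<^esub> \<in> carrier H"
    using assms by (simp add: group.is_monoid monoid.one_closed)
  then have "carrier H = {\<one>\<^bsub>H\<^esub>} \<longleftrightarrow> f ` carrier H = f ` {\<one>\<^bsub>H\<^esub>}"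
    by (metis inj inj_on_image_eq_iff empty_subsetI insert_subset order_refl)
  then show ?thesis
    using assms by (simp add: im f1 trivial_group_def)
qed

lemma not_freely_indecomposable:
  fixes G :: "('g, 'm) monoid_scheme"
    and G1 :: "('a, 'n) monoid_scheme" and G2 :: "('b, 'k) monoid_scheme"
  assumes "group G" "group G1" "group G2" "\<not> trivial_group G1" "\<not> trivial_group G2"
    and "G \<cong> free_product G1 G2"
  shows "\<not> freely_indecomposable G"
proof -
  have "group (free_product G1 G2)"
    using assms by (simp add: group_free_product)
  obtain \<psi> where \<psi>: "\<psi> \<in> mon (free_product G1 G2) G"
    using group.iso_sym[OF assms(1,6)] by (auto simp: is_iso_def iso_def mon_def bij_betw_def)
  obtain K1 :: "'g monoid" where K1: "group K1" "G1 \<cong> K1"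
    using isomorphic_copy_of_mon[OF assms(2,1) mon_compose[OF free_product_factors_embed(1) \<psi>]] assms
    by blast
  obtain K2 :: "'g monoid" where K2: "group K2" "G2 \<cong> K2"
    using isomorphic_copy_of_mon[OF assms(3,1) mon_compose[OF free_product_factors_embed(2) \<psi>]] assms
    by blast
  have "G \<cong> free_product K1 K2"
    using assms(6) free_product_iso[OF assms(2,3) K1(1) K2(1) K1(2) K2(2)] by (rule iso_trans)
  moreover have "\<not> trivial_group K1" "\<not> trivial_group K2"
    using trivial_group_iso_iff assms K1 K2 by metis+
  ultimately show ?thesis
    using K1 K2 unfolding freely_indecomposable_def by blast
qed

section \<open>The infinite dihedral group\<close>

definition infinite_dihedral_group :: "(int + int) list monoid" where
  "infinite_dihedral_group = free_product (integer_mod_group 2) (integer_mod_group 2)"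

section \<open>Norms on groups\<close>

text \<open>
  A norm is a total HOL function; only its values on the carrier are constrained.
\<close>

definition group_norm :: "('a, 'm) monoid_scheme \<Rightarrow> ('a \<Rightarrow> real) \<Rightarrow> bool" where
  "group_norm G \<nu> \<longleftrightarrow>
     (\<forall>g\<in>carrier G. \<nu> g \<ge> 0) \<and>
     (\<forall>g\<in>carrier G. \<nu> g = 0 \<longleftrightarrow> g = \<one>\<^bsub>G\<^esub>) \<and>
     (\<forall>g\<in>carrier G. \<forall>h\<in>carrier G. \<nu> (g \<otimes>\<^bsub>G\<^esub> h) \<le> \<nu> g + \<nu> h)"

definition Aut_invariant :: "('a, 'm) monoid_scheme \<Rightarrow> ('a \<Rightarrow> real) \<Rightarrow> bool" where
  "Aut_invariant G \<nu> \<longleftrightarrow> (\<forall>\<phi>\<in>auto G. \<forall>g\<in>carrier G. \<nu> (\<phi> g) = \<nu> g)"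

definition stably_unbounded :: "('a, 'm) monoid_scheme \<Rightarrow> ('a \<Rightarrow> real) \<Rightarrow> bool" where
  "stably_unbounded G \<nu> \<longleftrightarrow>
     (\<exists>g\<in>carrier G. filterlim (\<lambda>n::nat. \<nu> (g [^]\<^bsub>G\<^esub> n)) at_top sequentially)"

end

theory Submission
  imports Defs
begin

text \<open>
  The norm is \<open>\<nu> g = D + 1 + sup {\<bar>q (\<phi> g)\<bar> | \<phi> \<in> Aut G}\<close> for \<open>g \<noteq> 1\<close>, where \<open>q\<close> is a
  quasimorphism of defect \<open>D\<close> with \<open>q (g\<^sup>n) \<ge> n - 1\<close> for some \<open>g\<close>. It remains to make the
  supremum finite, for which it suffices to bound \<open>q\<close> on the automorphic images of generators.

  \<open>q\<close> reads off a sequence of symbols from the normal form (the letters from \<open>A\<close> or, if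
  \<open>A\<close> is infinite cyclic, the signs of the unit letters) and counts a chiral pattern in it: the
  windows of shape \<open>a \<noteq> b \<noteq> c = d \<noteq> e\<close> minus those of the reversed shape. Hence \<open>q\<close> vanishes on the
  factors and is bounded on their conjugates.

  If neither factor is infinite cyclic, then by the Kurosh subgroup theorem, in the form that a
  freely indecomposable subgroup of \<open>A * B\<close> which is not infinite cyclic is conjugate into a factor,
  the automorphic images of \<open>A\<close> and \<open>B\<close> are conjugate into the factors. If only
  \<open>A = \<langle>z\<rangle>\<close> is infinite cyclic, then an automorphism maps \<open>B\<close> into a conjugate of a factor, and up to
  conjugation and symmetry \<open>z\<close> to an element of \<open>B A B\<close>. If both are, then for a basis
  \<open>u, v\<close> of the free group the involution inverting the standard basis acts on \<open>u\<close> and \<open>v\<close> as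
  inversion followed by a conjugation, by Nielsen reduction. As \<open>q\<close> is invariant under this
  involution and odd under inversion, it is bounded on \<open>u\<close> and \<open>v\<close>.
\<close>

section \<open>Counting a chiral pattern\<close>

text \<open>Only equalities between symbols enter the pattern, so it cannot see the renaming of
  symbols caused by inverting letters; a shape minus its mirror image changes sign when read
  backwards. Together these make \<open>q\<close> odd under group inversion. Hence a block
  cancelling against its inverse costs nothing in a product, and conjugation changes
  \<open>q\<close> by an amount that does not depend on the conjugator. In terms of runs of equal
  symbols, the count is the number of runs of length one followed by a run of length exactly two,
  minus the number in the opposite order. The word x y x x y y y has cyclic run lengths 1, 1, 2, 3:
  the order 1, 2 occurs once and 2, 1 never. The additional 1 makes the number of runs even, so that
  with two symbols no runs merge at the seams of a power. The infinite dihedral group has to be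
  excluded: each of its elements is conjugate to its inverse, which bounds every odd quasimorphism.
  The obstacle with infinite cyclic factors is that transvections such as z to b z do not permute
  the conjugates of the factors.\<close>

definition pattern :: "'c \<Rightarrow> 'c \<Rightarrow> 'c \<Rightarrow> 'c \<Rightarrow> 'c \<Rightarrow> int" where
  "pattern a b c d e =
     of_bool (a \<noteq> b \<and> b \<noteq> c \<and> c = d \<and> d \<noteq> e) - of_bool (a \<noteq> b \<and> b = c \<and> c \<noteq> d \<and> d \<noteq> e)"

definition window :: "'c list \<Rightarrow> nat \<Rightarrow> int" where
  "window xs i = pattern (xs ! i) (xs ! (i+1)) (xs ! (i+2)) (xs ! (i+3)) (xs ! (i+4))"

lemma pattern_rev: "pattern e d c b a = - pattern a b c d e"
  by (auto simp: pattern_def)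

definition chirality :: "'c list \<Rightarrow> int" where
  "chirality xs = (\<Sum>i<length xs - 4. window xs i)"

lemma chirality_short: "length xs \<le> 4 \<Longrightarrow> chirality xs = 0"
  by (simp add: chirality_def)

lemma chirality_Cons:
  "length xs \<ge> 4 \<Longrightarrow> chirality (x # xs) = window (x # xs) 0 + chirality xs"
proof -
  assume "length xs \<ge> 4"
  then have "length (x # xs) - 4 = Suc (length xs - 4)"
    by simp
  moreover have "window (x # xs) (Suc i) = window xs i" for i
    by (simp only: window_def add_Suc nth_Cons_Suc)
  ultimately show ?thesis
    by (simp only: chirality_def sum.lessThan_Suc_shift)
qed

lemma chirality_map:
  assumes "inj_on f (set xs)"
  shows "chirality (map f xs) = chirality xs"
proof -
  have "window (map f xs) i = window xs i" if "i < length xs - 4" for i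
  proof -
    have "f (xs ! j) = f (xs ! k) \<longleftrightarrow> xs ! j = xs ! k" if "j < length xs" "k < length xs" for j k
      using assms that by (auto dest: inj_onD)
    then show ?thesis
      using that by (simp add: window_def pattern_def)
  qed
  then show ?thesis
    by (simp add: chirality_def)
qed

lemma chirality_rev: "chirality (rev xs) = - chirality xs"
proof -
  let ?n = "length xs - 4"
  have *: "window (rev xs) i = - window xs (?n - Suc i)" if "i < ?n" for i
  proof -
    have "rev xs ! (i + j) = xs ! (?n - Suc i + (4 - j))" if "j \<le> 4" for j
      using \<open>i < ?n\<close> that by (simp add: rev_nth)
    from this[of 0] this[of 1] this[of 2] this[of 3] this[of 4]
    have "rev xs ! i = xs ! (?n - Suc i + 4)" "rev xs ! (i+1) = xs ! (?n - Suc i + 3)"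
      "rev xs ! (i+2) = xs ! (?n - Suc i + 2)" "rev xs ! (i+3) = xs ! (?n - Suc i + 1)"
      "rev xs ! (i+4) = xs ! (?n - Suc i)"
      by simp_all
    then show ?thesis
      by (simp only: window_def pattern_rev[symmetric])
  qed
  have "chirality (rev xs) = (\<Sum>i<?n. - window xs (?n - Suc i))"
    by (simp add: chirality_def *)
  also have "\<dots> = (\<Sum>i<?n. - window xs i)"
    by (rule sum.nat_diff_reindex)
  finally show ?thesis
    by (simp add: chirality_def sum_negf)
qed

lemma chirality_replicate: "chirality (replicate n x) = 0"
  by (simp add: chirality_def window_def pattern_def)

lemma abs_window_le: "\<bar>window xs i\<bar> \<le> 1"
  by (simp add: window_def pattern_def)

text \<open>A window has five entries, so at most four windows straddle the seam, each contributing
  at most one.\<close>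

lemma chirality_append: "\<bar>chirality (xs @ ys) - chirality xs - chirality ys\<bar> \<le> 4"
proof -
  \<comment> \<open>The bound grows only until four entries precede \<open>ys\<close>; after that a
    new leading entry opens a window inside the left word.\<close>
  have "\<bar>chirality (xs @ ys) - chirality xs - chirality ys\<bar> \<le> int (min 4 (length xs))"
  proof (induction xs)
    case Nil
    then show ?case by (simp add: chirality_short)
  next
    case (Cons x xs)
    consider "length xs \<ge> 4" | "length xs < 4" "length (xs @ ys) \<ge> 4" | "length (xs @ ys) < 4"
      by linarith
    then show ?case
    proof cases
      case 1
      then have "((x # xs) @ ys) ! i = (x # xs) ! i" if "i \<le> 4" for i
        using that by (subst nth_append) simp
      from this[of 0] this[of 1] this[of 2] this[of 3] this[of 4]
      have "window (x # xs @ ys) 0 = window (x # xs) 0"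
        by (simp add: window_def)
      then show ?thesis
        using 1 Cons.IH by (simp add: chirality_Cons)
    next
      case 2
      then show ?thesis
        using Cons.IH abs_window_le[of "x # xs @ ys" 0] by (simp add: chirality_Cons chirality_short)
    qed (use Cons.IH in \<open>simp add: chirality_short\<close>)
  qed
  then show ?thesis
    by (simp add: min_def split: if_splits)
qed

lemma chirality_chiral_power:
  assumes "x \<noteq> y"
  shows "chirality (concat (replicate n [x, y, x, x, y, y, y])) \<ge> int n - 1"
proof -
  let ?w = "[x, y, x, x, y, y, y]"
  \<comment> \<open>The seven windows starting in the first copy end before
    \<open>r\<close>.\<close>
  have "chirality (?w @ ?w @ r) = 1 + chirality (?w @ r)" for r
    using assms by (simp add: chirality_Cons window_def pattern_def)
  then have *: "chirality (concat (replicate (Suc (Suc m)) ?w)) =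
      1 + chirality (concat (replicate (Suc m) ?w))" for m
    by simp
  have "chirality (concat (replicate (Suc m) ?w)) \<ge> int m" for m
  proof (induction m)
    case 0
    then show ?case
      using assms by (simp add: chirality_Cons chirality_short window_def pattern_def)
  next
    case (Suc m)
    then show ?case using *[of m] by simp
  qed
  from this[of "n - 1"] show ?thesis
    by (cases n) (simp_all add: chirality_short)
qed

section \<open>Norms from quasimorphisms\<close>

definition admits_norm :: "('a, 'm) monoid_scheme \<Rightarrow> bool" where
  "admits_norm G \<longleftrightarrow> (\<exists>\<nu>. group_norm G \<nu> \<and> Aut_invariant G \<nu> \<and> stably_unbounded G \<nu>)"

context group begin

lemma auto_comp:
  assumes "\<phi> \<in> auto G" "\<psi> \<in> auto G"
  shows "compose (carrier G) \<phi> \<psi> \<in> auto G"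
  using subgroup.m_closed[OF subgroup_auto assms] assms
  by (auto simp: BijGroup_def auto_def)

text \<open>Precomposition with \<open>\<theta>\<close> maps \<open>auto G\<close> onto itself,
  which makes the supremum invariant. Elements of \<open>auto G\<close> are extensional functions,
  hence the restriction to the carrier.\<close>

lemma auto_factor:
  assumes "\<phi> \<in> auto G" "\<theta> \<in> auto G"
  obtains \<psi> where "\<psi> \<in> auto G" "\<And>g. g \<in> carrier G \<Longrightarrow> \<psi> (\<theta> g) = \<phi> g"
proof -
  let ?i = "restrict (inv_into (carrier G) \<theta>) (carrier G)"
  have \<theta>: "\<theta> \<in> Bij (carrier G)" "\<theta> \<in> hom G G"
    using assms by (auto simp: auto_def)
  have "?i \<in> auto G"
    using \<theta> by (simp add: auto_def restrict_inv_into_hom restrict_inv_into_Bij)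
  then have "compose (carrier G) \<phi> ?i \<in> auto G"
    using assms auto_comp by blast
  moreover have "compose (carrier G) \<phi> ?i (\<theta> g) = \<phi> g" if "g \<in> carrier G" for g
    using \<theta> that by (auto simp: compose_def Bij_def bij_betw_def hom_def inv_into_f_f)
  ultimately show ?thesis
    using that by blast
qed

lemma auto_group_hom: "\<phi> \<in> auto G \<Longrightarrow> group_hom G G \<phi>"
  by (simp add: auto_def group_hom_def group_hom_axioms_def is_group)

lemma auto_bij: "\<phi> \<in> auto G \<Longrightarrow> bij_betw \<phi> (carrier G) (carrier G)"
  by (simp add: auto_def Bij_def)

lemma admits_norm_if_bounded_orbits:
  fixes q :: "'a \<Rightarrow> real"
  assumes q_mult: "\<And>g h. \<lbrakk>g \<in> carrier G; h \<in> carrier G\<rbrakk> \<Longrightarrow> \<bar>q (g \<otimes> h) - q g - q h\<bar> \<le> D"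
    and q_inv: "\<And>g. g \<in> carrier G \<Longrightarrow> q (inv g) = - q g"
    and gen: "generate G S = carrier G" and S: "S \<subseteq> carrier G"
    and bounded: "\<And>g. g \<in> S \<Longrightarrow> \<exists>C. \<forall>\<phi>\<in>auto G. \<bar>q (\<phi> g)\<bar> \<le> C"
    and unb: "\<exists>g\<in>carrier G. \<forall>n. q (g [^] (n::nat)) \<ge> real n - 1"
  shows "admits_norm G"
proof -
  have D: "D \<ge> 0"
    using q_mult[of \<one> \<one>] by simp
  have bd: "\<exists>C. \<forall>\<phi>\<in>auto G. \<bar>q (\<phi> g)\<bar> \<le> C" if "g \<in> generate G S" for g
    using that
  proof induction
    case one
    have "q (\<phi> \<one>) = q \<one>" if "\<phi> \<in> auto G" for \<phi>
      using group_hom.hom_one[OF auto_group_hom[OF that]] by simp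
    then show ?case by auto
  next
    case (incl h)
    then show ?case by (rule bounded)
  next
    case (inv h)
    then obtain C where "\<forall>\<phi>\<in>auto G. \<bar>q (\<phi> h)\<bar> \<le> C"
      using bounded by blast
    moreover have "q (\<phi> (inv h)) = - q (\<phi> h)" if "\<phi> \<in> auto G" for \<phi>
      using group_hom.hom_inv[OF auto_group_hom[OF that]] group_hom.hom_closed[OF auto_group_hom[OF that]]
        q_inv inv S by auto
    ultimately show ?case by auto
  next
    case (eng g h)
    then obtain C1 C2 where C: "\<forall>\<phi>\<in>auto G. \<bar>q (\<phi> g)\<bar> \<le> C1" "\<forall>\<phi>\<in>auto G. \<bar>q (\<phi> h)\<bar> \<le> C2"
      by blast
    have gh: "g \<in> carrier G" "h \<in> carrier G"
      using eng generate_in_carrier S by blast+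
    have "\<bar>q (\<phi> (g \<otimes> h))\<bar> \<le> C1 + C2 + D" if \<phi>: "\<phi> \<in> auto G" for \<phi>
    proof -
      interpret \<phi>: group_hom G G \<phi> by (rule auto_group_hom[OF \<phi>])
      show ?thesis
        using C \<phi> q_mult[of "\<phi> g" "\<phi> h"] gh by (auto simp: \<phi>.hom_mult dest!: bspec[OF _ \<phi>])
    qed
    then show ?case by blast
  qed
  define s where "s g = (SUP \<phi>\<in>auto G. \<bar>q (\<phi> g)\<bar>)" for g
  have bdd: "bdd_above ((\<lambda>\<phi>. \<bar>q (\<phi> g)\<bar>) ` auto G)" if "g \<in> carrier G" for g
    using bd[of g] that gen by (auto simp: bdd_above_def)
  have ne: "auto G \<noteq> {}"
    using id_in_auto by blast
  have s_upper: "\<bar>q (\<phi> g)\<bar> \<le> s g" if "\<phi> \<in> auto G" "g \<in> carrier G" for \<phi> g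
    unfolding s_def using that bdd by (intro cSUP_upper) auto
  have q_le_s: "\<bar>q g\<bar> \<le> s g" if "g \<in> carrier G" for g
    using s_upper[OF id_in_auto that] that by simp
  have s_mult: "s (g \<otimes> h) \<le> s g + s h + D" if gh: "g \<in> carrier G" "h \<in> carrier G" for g h
    unfolding s_def[of "g \<otimes> h"]
  proof (rule cSUP_least[OF ne])
    fix \<phi> assume \<phi>: "\<phi> \<in> auto G"
    interpret \<phi>: group_hom G G \<phi> by (rule auto_group_hom[OF \<phi>])
    show "\<bar>q (\<phi> (g \<otimes> h))\<bar> \<le> s g + s h + D"
      using s_upper[OF \<phi>, of g] s_upper[OF \<phi>, of h] gh q_mult[of "\<phi> g" "\<phi> h"] by (auto simp: \<phi>.hom_mult)
  qed
  have s_auto: "s (\<theta> g) = s g" if \<theta>: "\<theta> \<in> auto G" and g: "g \<in> carrier G" for \<theta> g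
  proof -
    have "(\<lambda>\<phi>. \<bar>q (\<phi> (\<theta> g))\<bar>) ` auto G = (\<lambda>\<phi>. \<bar>q (\<phi> g)\<bar>) ` auto G"
    proof (intro equalityI subsetI)
      fix r assume "r \<in> (\<lambda>\<phi>. \<bar>q (\<phi> (\<theta> g))\<bar>) ` auto G"
      then obtain \<phi> where "\<phi> \<in> auto G" "r = \<bar>q (\<phi> (\<theta> g))\<bar>" by blast
      then show "r \<in> (\<lambda>\<phi>. \<bar>q (\<phi> g)\<bar>) ` auto G"
        using auto_comp[OF _ \<theta>, of \<phi>] g by (intro image_eqI[of _ _ "compose (carrier G) \<phi> \<theta>"]) (auto simp: compose_def)
    next
      fix r assume "r \<in> (\<lambda>\<phi>. \<bar>q (\<phi> g)\<bar>) ` auto G"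
      then obtain \<phi> where "\<phi> \<in> auto G" "r = \<bar>q (\<phi> g)\<bar>" by blast
      then show "r \<in> (\<lambda>\<phi>. \<bar>q (\<phi> (\<theta> g))\<bar>) ` auto G"
        using g by (metis (no_types, lifting) auto_factor[OF _ \<theta>] image_eqI)
    qed
    then show ?thesis by (simp add: s_def)
  qed
  have s_nonneg: "s g \<ge> 0" if "g \<in> carrier G" for g
    using q_le_s[OF that] by linarith
  \<comment> \<open>\<open>D\<close> pays for the defect in the triangle inequality; the 1 makes the
    norm positive off the identity.\<close>
  define \<nu> where "\<nu> g = (if g = \<one> then 0 else s g + D + 1)" for g
  have "group_norm G \<nu>"
    unfolding group_norm_def
  proof (intro conjI ballI)
    fix g h assume gh: "g \<in> carrier G" "h \<in> carrier G"
    then show "\<nu> (g \<otimes> h) \<le> \<nu> g + \<nu> h"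
      using s_mult[OF gh] s_nonneg[of g] s_nonneg[of h] D by (auto simp: \<nu>_def)
  qed (use D in \<open>auto simp: \<nu>_def dest!: s_nonneg\<close>)
  moreover have "Aut_invariant G \<nu>"
    unfolding Aut_invariant_def
  proof (intro ballI)
    fix \<phi> g assume \<phi>: "\<phi> \<in> auto G" and g: "g \<in> carrier G"
    interpret \<phi>: group_hom G G \<phi> by (rule auto_group_hom[OF \<phi>])
    have "\<phi> g = \<one> \<longleftrightarrow> g = \<one>"
      using auto_bij[OF \<phi>] g by (metis \<phi>.hom_one bij_betw_def inj_onD one_closed)
    then show "\<nu> (\<phi> g) = \<nu> g"
      using s_auto[OF \<phi> g] by (simp add: \<nu>_def)
  qed
  moreover have "stably_unbounded G \<nu>"
  proof -
    obtain g where g: "g \<in> carrier G" "\<And>n. q (g [^] (n::nat)) \<ge> real n - 1"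
      using unb by blast
    have q1: "q \<one> = 0"
      using q_inv[of \<one>] by simp
    have le: "\<nu> (g [^] n) \<ge> real n - 1" for n :: nat
      using q_le_s[OF nat_pow_closed[OF g(1)], of n] q1 D g(2)[of n] by (auto simp: \<nu>_def)
    have "filterlim (\<lambda>n. real n - 1) at_top sequentially"
      using filterlim_tendsto_add_at_top[OF tendsto_const filterlim_real_sequentially, of "-1"] by simp
    then have "filterlim (\<lambda>n::nat. \<nu> (g [^] n)) at_top sequentially"
      by (rule filterlim_at_top_mono) (simp add: le)
    then show ?thesis
      using g unfolding stably_unbounded_def by blast
  qed
  ultimately show ?thesis
    unfolding admits_norm_def by blast
qed

end

text \<open>Used to exchange the two factors and to replace an infinite cyclic factor by
  \<open>integer_group\<close>.\<close>

lemma admits_norm_iso: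
  assumes G: "group G" "group H" and "G \<cong> H" and "admits_norm H"
  shows "admits_norm G"
proof -
  obtain f where f: "f \<in> iso G H"
    using assms by (auto simp: is_iso_def)
  obtain \<nu> where \<nu>: "group_norm H \<nu>" "Aut_invariant H \<nu>" "stably_unbounded H \<nu>"
    using assms by (auto simp: admits_norm_def)
  interpret G: group G by fact
  interpret H: group H by fact
  interpret f: group_hom G H f
    using f by (simp add: group_hom_def group_hom_axioms_def iso_def G.is_group H.is_group)
  have bij: "bij_betw f (carrier G) (carrier H)"
    using f by (simp add: iso_def)
  have f1: "f g = \<one>\<^bsub>H\<^esub> \<longleftrightarrow> g = \<one>\<^bsub>G\<^esub>" if "g \<in> carrier G" for g
    using bij that by (metis f.hom_one bij_betw_def inj_onD G.one_closed)
  let ?i = "inv_into (carrier G) f"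
  have i: "?i \<in> iso H G"
    using G.iso_set_sym[OF f] .
  have i_mem: "?i y \<in> carrier G" "f (?i y) = y" if "y \<in> carrier H" for y
    using bij that by (auto simp: bij_betw_def inv_into_into f_inv_into_f)
  have i_f: "?i (f x) = x" if "x \<in> carrier G" for x
    using bij that by (simp add: bij_betw_def)
  have "group_norm G (\<nu> \<circ> f)"
    using \<nu>(1) by (auto simp: group_norm_def f1)
  moreover have "Aut_invariant G (\<nu> \<circ> f)"
    unfolding Aut_invariant_def
  proof (intro ballI)
    fix \<phi> g assume \<phi>: "\<phi> \<in> auto G" and g: "g \<in> carrier G"
    define \<theta> where "\<theta> = restrict (\<lambda>y. f (\<phi> (?i y))) (carrier H)"
    have \<phi>': "\<phi> \<in> iso G G"
      using \<phi> by (auto simp: auto_def Bij_def iso_def)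
    have "f \<circ> (\<phi> \<circ> ?i) \<in> iso H H"
      using iso_set_trans[OF iso_set_trans[OF i \<phi>'] f] by (simp add: comp_assoc)
    then have "\<theta> \<in> iso H H"
      by (simp add: \<theta>_def iso_def hom_def bij_betw_restrict_eq comp_def Pi_iff cong: bij_betw_cong)
    then have "\<theta> \<in> auto H"
      by (simp add: auto_def Bij_def iso_def) (simp add: \<theta>_def)
    then have "\<nu> (\<theta> (f g)) = \<nu> (f g)"
      using \<nu>(2) g by (simp add: Aut_invariant_def)
    then show "(\<nu> \<circ> f) (\<phi> g) = (\<nu> \<circ> f) g"
      using g by (simp add: \<theta>_def i_f)
  qed
  moreover have "stably_unbounded G (\<nu> \<circ> f)"
  proof -
    obtain h where h: "h \<in> carrier H" "filterlim (\<lambda>n::nat. \<nu> (h [^]\<^bsub>H\<^esub> n)) at_top sequentially"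
      using \<nu>(3) by (auto simp: stably_unbounded_def)
    have "f (?i h [^]\<^bsub>G\<^esub> n) = h [^]\<^bsub>H\<^esub> n" for n :: nat
      using i_mem[OF h(1)] by (simp add: f.hom_nat_pow)
    then show ?thesis
      unfolding stably_unbounded_def using h i_mem[OF h(1)] by (intro bexI[of _ "?i h"]) simp_all
  qed
  ultimately show ?thesis
    unfolding admits_norm_def by blast
qed

section \<open>Words in a free product\<close>

fun letter_inv :: "('a, 'm) monoid_scheme \<Rightarrow> ('b, 'n) monoid_scheme \<Rightarrow> 'a + 'b \<Rightarrow> 'a + 'b" where
  "letter_inv A B (Inl a) = Inl (inv\<^bsub>A\<^esub> a)"
| "letter_inv A B (Inr b) = Inr (inv\<^bsub>B\<^esub> b)"

lemma isl_letter_inv [simp]: "isl (letter_inv A B x) = isl x"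
  by (cases x) auto

locale group_pair = A: group A + B: group B
  for A :: "('a, 'm) monoid_scheme" and B :: "('b, 'n) monoid_scheme"
begin

abbreviation FP ("F") where "FP \<equiv> free_product A B"

sublocale FP: group F
  by (rule group_free_product[OF A.is_group B.is_group])

lemma carrier_FP [simp]: "w \<in> carrier F \<longleftrightarrow> reduced_word A B w"
  by (simp add: free_product_def)

lemma one_FP [simp]: "\<one>\<^bsub>F\<^esub> = []"
  by (simp add: free_product_def)

lemma mult_Cons: "(x # u) \<otimes>\<^bsub>F\<^esub> w = push_letter A B x (u \<otimes>\<^bsub>F\<^esub> w)"
  by (simp add: free_product_def)

lemma mult_Nil [simp]: "[] \<otimes>\<^bsub>F\<^esub> w = w"
  by (simp add: free_product_def)

lemma mult_Nil_right [simp]: "reduced_word A B u \<Longrightarrow> u \<otimes>\<^bsub>F\<^esub> [] = u"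
  using FP.r_one[of u] by simp

lemma reduced_mult [simp]: "reduced_word A B u \<Longrightarrow> reduced_word A B w \<Longrightarrow> reduced_word A B (u \<otimes>\<^bsub>F\<^esub> w)"
  using FP.m_closed by simp

lemma reduced_inv [simp]: "reduced_word A B u \<Longrightarrow> reduced_word A B (inv\<^bsub>F\<^esub> u)"
  using FP.inv_closed by simp

lemma reduced_append:
  "reduced_word A B (u @ w) \<longleftrightarrow>
     reduced_word A B u \<and> reduced_word A B w \<and> (u = [] \<or> w = [] \<or> isl (last u) \<noteq> isl (hd w))"
  by (auto simp: reduced_word_def successively_append_iff)

lemma mult_append: "reduced_word A B (u @ w) \<Longrightarrow> u \<otimes>\<^bsub>F\<^esub> w = u @ w"
proof (induction u)
  case (Cons x u)
  then show ?case
    by (auto simp: mult_Cons reduced_word_Cons intro!: push_letter_alternating)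
qed simp

lemma reduced_last:
  assumes "reduced_word A B u" "reduced_word A B w" "isl (last u) \<noteq> isl (hd w)"
  shows "reduced_word A B (u @ w)" "u \<otimes>\<^bsub>F\<^esub> w = u @ w"
  using assms by (simp_all add: reduced_append mult_append)

lemma letter_letter_inv: "letter A B x \<Longrightarrow> letter A B (letter_inv A B x)"
  by (cases x) auto

lemma push_letter_inv: "letter A B x \<Longrightarrow> push_letter A B (letter_inv A B x) (x # w) = w"
  by (cases x) auto

lemma inv_word:
  assumes "reduced_word A B w"
  shows "inv\<^bsub>F\<^esub> w = rev (map (letter_inv A B) w)"
proof (rule FP.inv_equality)
  show "rev (map (letter_inv A B) w) \<otimes>\<^bsub>F\<^esub> w = \<one>\<^bsub>F\<^esub>"
    using assms
  proof (induction w)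
    case (Cons x w)
    then show ?case
      by (simp add: free_product_def reduced_word_Cons push_letter_inv)
  qed simp
  have "successively (\<lambda>x y. isl x \<noteq> isl y) (rev (map (letter_inv A B) w))"
    using assms by (auto simp: reduced_word_def successively_map elim: successively_mono)
  then show "rev (map (letter_inv A B) w) \<in> carrier F"
    using assms by (auto simp: reduced_word_def list_all_iff letter_letter_inv)
qed (use assms in simp)

lemma inv_Nil [simp]: "inv\<^bsub>F\<^esub> [] = []"
  using FP.inv_one by simp

lemma inv_Nil_iff [simp]: "reduced_word A B w \<Longrightarrow> inv\<^bsub>F\<^esub> w = [] \<longleftrightarrow> w = []"
  by (simp add: inv_word)

lemma isl_hd_inv: "reduced_word A B w \<Longrightarrow> w \<noteq> [] \<Longrightarrow> isl (hd (inv\<^bsub>F\<^esub> w)) = isl (last w)"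
  by (simp add: inv_word hd_rev last_map)

lemma isl_last_inv: "reduced_word A B w \<Longrightarrow> w \<noteq> [] \<Longrightarrow> isl (last (inv\<^bsub>F\<^esub> w)) = isl (hd w)"
  by (simp add: inv_word last_rev hd_map)

text \<open>A letter is prepended, cancels the head or merges with it. The clause about
  \<open>[y]\<close> records how \<open>z\<close> arises, so that the merging can be repeated in
  front of another tail.\<close>

lemma push_letter_cases:
  assumes "letter A B x" "reduced_word A B w"
  obtains "push_letter A B x w = x # w" "w = [] \<or> isl x \<noteq> isl (hd w)"
  | v where "w = letter_inv A B x # v" "push_letter A B x w = v"
  | y z v where "w = y # v" "isl x = isl y" "isl z = isl y" "letter A B z"
      "push_letter A B x w = z # v" "push_letter A B x [y] = [z]"
proof (cases "(A, B, x, w)" rule: push_letter.cases)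
  case (1 A' B' a a' v)
  then have a: "a \<in> carrier A" "a' \<in> carrier A" "x = Inl a" "w = Inl a' # v"
    using assms by (auto simp: reduced_word_Cons)
  show ?thesis
  proof (cases "a \<otimes>\<^bsub>A\<^esub> a' = \<one>\<^bsub>A\<^esub>")
    case True
    then have "a' = inv\<^bsub>A\<^esub> a"
      using A.inv_equality[of a a'] a by force
    then show ?thesis
      using a True by (intro that(2)[of v]) simp_all
  next
    case False
    then show ?thesis
      using a by (intro that(3)[of "Inl a'" v "Inl (a \<otimes>\<^bsub>A\<^esub> a')"]) simp_all
  qed
next
  case (2 A' B' a a' v)
  then have a: "a \<in> carrier B" "a' \<in> carrier B" "x = Inr a" "w = Inr a' # v"
    using assms by (auto simp: reduced_word_Cons)
  show ?thesis
  proof (cases "a \<otimes>\<^bsub>B\<^esub> a' = \<one>\<^bsub>B\<^esub>")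
    case True
    then have "a' = inv\<^bsub>B\<^esub> a"
      using B.inv_equality[of a a'] a by force
    then show ?thesis
      using a True by (intro that(2)[of v]) simp_all
  next
    case False
    then show ?thesis
      using a by (intro that(3)[of "Inr a'" v "Inr (a \<otimes>\<^bsub>B\<^esub> a')"]) simp_all
  qed
qed (use that(1) in auto)

text \<open>A prefix of a product corresponds to a point on the geodesic from \<open>1\<close> to \<open>u w\<close> in the
  tree of the free product, which lies on one of the geodesics from \<open>1\<close> to \<open>u\<close> and from \<open>u\<close> to \<open>u w\<close>.\<close>

lemma prefix_mult_cases:
  assumes "reduced_word A B u" "reduced_word A B w" "u \<otimes>\<^bsub>F\<^esub> w = r @ r'"
  obtains t where "u = r @ t" | v v' where "w = v @ v'" "r = u \<otimes>\<^bsub>F\<^esub> v"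
proof -
  have "(\<exists>t. u = r @ t) \<or> (\<exists>v v'. w = v @ v' \<and> r = u \<otimes>\<^bsub>F\<^esub> v)"
    using assms
  proof (induction u arbitrary: r r')
    case (Cons x u)
    let ?z = "u \<otimes>\<^bsub>F\<^esub> w"
    have red: "letter A B x" "reduced_word A B u" "reduced_word A B ?z" and z: "push_letter A B x ?z = r @ r'"
      using Cons.prems by (auto simp: reduced_word_Cons mult_Cons)
    \<comment> \<open>A non-empty prefix of the pushed word comes from pushing \<open>x\<close> onto
      some prefix of \<open>?z\<close>, to which the induction hypothesis applies.\<close>
    have "r = [] \<or> (\<exists>r0 r0'. ?z = r0 @ r0' \<and> r = push_letter A B x r0)"
      using red(1,3)
    proof (cases rule: push_letter_cases)
      case 1
      show ?thesis
      proof (cases r)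
        case (Cons x' r0)
        then have *: "x' = x" "?z = r0 @ r'"
          using 1(1) z by simp_all
        have "r0 = [] \<or> isl x \<noteq> isl (hd r0)"
          using 1(2) * by (cases r0) simp_all
        then have "r = push_letter A B x r0"
          using Cons *(1) by (simp add: push_letter_alternating)
        then show ?thesis using *(2) by blast
      qed simp
    next
      \<comment> \<open>The cancelled letter is put back in front of \<open>r\<close>.\<close>
      case (2 v)
      have "letter_inv A B (letter_inv A B x) = x"
        using red(1) by (cases x) auto
      then have "push_letter A B x (letter_inv A B x # r) = r"
        using push_letter_inv[OF letter_letter_inv[OF red(1)], of r] by simp
      moreover have "?z = (letter_inv A B x # r) @ r'"
        using 2 z by simp
      ultimately show ?thesis by metis
    next
      case (3 y c v)
      show ?thesis
      proof (cases r)
        case (Cons c' r0)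
        with 3 z have "c' = c" "v = r0 @ r'" by auto
        moreover have "push_letter A B x (y # r0) = c # r0"
          using 3 by (cases x; cases y) (auto split: if_splits)
        ultimately show ?thesis using 3(1) Cons by (metis append_Cons)
      qed simp
    qed
    then consider "r = []" | r0 r0' where "?z = r0 @ r0'" "r = push_letter A B x r0"
      by blast
    then show ?case
    proof cases
      case (2 r0 r0')
      from Cons.IH[OF red(2) Cons.prems(2) 2(1)] show ?thesis
      proof (elim disjE exE conjE)
        fix t assume t: "u = r0 @ t"
        then have "push_letter A B x r0 = x # r0"
          using Cons.prems(1) by (cases r0) (simp_all add: push_letter_alternating reduced_word_Cons)
        then show ?thesis using t 2 by simp
      next
        fix v v' assume "w = v @ v'" "r0 = u \<otimes>\<^bsub>F\<^esub> v"
        then show ?thesis using 2 by (auto simp: mult_Cons)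
      qed
    qed simp
  qed (metis append_Nil mult_Nil)
  then show ?thesis using that by blast
qed

end

section \<open>Freely indecomposable subgroups\<close>

text \<open>Ping-pong with the identity as base point: it lies outside \<open>X\<close> and
  \<open>Y\<close>, while the value of a non-empty reduced word lies in one of them, according to
  its first letter. So evaluation of words has trivial kernel.\<close>

lemma (in group) free_product_iso_if_ping_pong:
  assumes K: "subgroup K G" and L: "subgroup L G"
    and X: "\<And>k x. k \<in> K \<Longrightarrow> k \<noteq> \<one> \<Longrightarrow> x \<in> insert \<one> Y \<Longrightarrow> k \<otimes> x \<in> X"
    and Y: "\<And>l x. l \<in> L \<Longrightarrow> l \<noteq> \<one> \<Longrightarrow> x \<in> insert \<one> X \<Longrightarrow> l \<otimes> x \<in> Y"
    and one: "\<one> \<notin> X" "\<one> \<notin> Y"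
  shows "G\<lparr>carrier := generate G (K \<union> L)\<rparr> \<cong> free_product (G\<lparr>carrier := K\<rparr>) (G\<lparr>carrier := L\<rparr>)"
proof -
  let ?K = "G\<lparr>carrier := K\<rparr>" and ?L = "G\<lparr>carrier := L\<rparr>" and ?H = "G\<lparr>carrier := generate G (K \<union> L)\<rparr>"
  interpret K: subgroup K G by fact
  interpret L: subgroup L G by fact
  interpret group_pair ?K ?L
    by (simp add: group_pair_def K.subgroup_is_group L.subgroup_is_group is_group)
  define val :: "'a + 'a \<Rightarrow> 'a" where "val = case_sum id id"
  define ev where "ev w = foldr (\<lambda>x g. val x \<otimes> g) w \<one>" for w
  have val_mem: "val x \<in> carrier G" "val x \<in> K \<union> L" "val x \<noteq> \<one>" if "letter ?K ?L x" for x
    using that by (cases x; auto simp: val_def)+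
  have ev_simps [simp]: "ev [] = \<one>" "ev (x # w) = val x \<otimes> ev w" for x w
    by (simp_all add: ev_def)
  have ev_closed: "ev w \<in> carrier G" if "reduced_word ?K ?L w" for w
    using that by (induction w) (auto simp: reduced_word_Cons val_mem)
  have ev_push: "ev (push_letter ?K ?L x w) = val x \<otimes> ev w" if "letter ?K ?L x" "reduced_word ?K ?L w" for x w
    using that
  proof (cases rule: push_letter_cases)
    case (2 v)
    then have "reduced_word ?K ?L v" using that by (simp add: reduced_word_Cons)
    moreover have "val (letter_inv ?K ?L x) = inv (val x)"
      using that(1) by (cases x) (simp_all add: val_def m_inv_consistent[OF K] m_inv_consistent[OF L])
    ultimately show ?thesis
      using 2 val_mem(1)[OF that(1)] ev_closed[of v] by (simp add: m_assoc[symmetric])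
  next
    case (3 y z v)
    then have "letter ?K ?L y" "reduced_word ?K ?L v" using that by (auto simp: reduced_word_Cons)
    moreover have "val z = val x \<otimes> val y"
      using 3 by (cases x; cases y; auto simp: val_def split: if_splits)
    ultimately show ?thesis
      using 3 that ev_closed[of v] val_mem by (simp add: m_assoc)
  qed simp
  have ev_mult: "ev (u \<otimes>\<^bsub>FP\<^esub> w) = ev u \<otimes> ev w" if "reduced_word ?K ?L u" "reduced_word ?K ?L w" for u w
    using that by (induction u) (auto simp: mult_Cons ev_push reduced_word_Cons ev_closed m_assoc val_mem)
  interpret ev: group_hom FP G ev
    by unfold_locales (auto simp: hom_def ev_closed ev_mult)
  have ping_pong: "ev w \<in> (if isl (hd w) then X else Y)" if "reduced_word ?K ?L w" "w \<noteq> []" for w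
    using that
  proof (induction w)
    case (Cons x w)
    then have IH: "w \<noteq> [] \<Longrightarrow> ev w \<in> (if isl (hd w) then X else Y)"
      by (simp add: reduced_word_Cons)
    show ?case
    proof (cases x)
      case (Inl a)
      then have "ev w \<in> insert \<one> Y"
        using Cons.prems IH by (cases "w = []") (auto simp: reduced_word_Cons)
      then show ?thesis
        using X[of a "ev w"] Cons.prems Inl by (simp add: reduced_word_Cons val_def)
    next
      case (Inr b)
      then have "ev w \<in> insert \<one> X"
        using Cons.prems IH by (cases "w = []") (auto simp: reduced_word_Cons)
      then show ?thesis
        using Y[of b "ev w"] Cons.prems Inr by (simp add: reduced_word_Cons val_def)
    qed
  qed simp
  have "inj_on ev (carrier FP)"
  proof (subst ev.inj_on_one_iff, intro allI impI)
    fix w assume "w \<in> carrier FP" "ev w = \<one>"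
    then show "w = \<one>\<^bsub>FP\<^esub>"
      using ping_pong[of w] one by (cases "isl (hd w)") auto
  qed
  moreover have "ev ` carrier FP = generate G (K \<union> L)"
  proof
    have "ev w \<in> generate G (K \<union> L)" if "reduced_word ?K ?L w" for w
      using that
    proof (induction w)
      case (Cons x w)
      then have "letter ?K ?L x" "ev w \<in> generate G (K \<union> L)"
        by (simp_all add: reduced_word_Cons)
      then show ?case
        using generate.eng[OF generate.incl[OF val_mem(2)], of x "ev w" G] by simp
    qed (simp add: generate.one)
    then show "ev ` carrier FP \<subseteq> generate G (K \<union> L)"
      by auto
    have "k \<in> ev ` carrier FP" if "k \<in> K" for k
      by (rule image_eqI[of _ _ "if k = \<one> then [] else [Inl k]"])
        (use that in \<open>auto simp: val_def reduced_word_Cons\<close>)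
    moreover have "l \<in> ev ` carrier FP" if "l \<in> L" for l
      by (rule image_eqI[of _ _ "if l = \<one> then [] else [Inr l]"])
        (use that in \<open>auto simp: val_def reduced_word_Cons\<close>)
    ultimately show "generate G (K \<union> L) \<subseteq> ev ` carrier FP"
      by (intro generate_subgroup_incl ev.img_is_subgroup) auto
  qed
  ultimately have "ev \<in> iso FP ?H"
    by (auto simp: iso_def hom_def bij_betw_def ev_mult)
  then show ?thesis
    using FP.iso_sym[of ?H] by (auto simp: is_iso_def)
qed

section \<open>Irreducible words of a subgroup\<close>

locale word_subgroup = group_pair A B
  for A :: "('a, 'm) monoid_scheme" and B :: "('b, 'n) monoid_scheme" +
  fixes H :: "('a + 'b) list set"
  assumes subgroup_H: "subgroup H F"
begin

lemma mem_reduced [simp]: "h \<in> H \<Longrightarrow> reduced_word A B h"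
  using subgroup.subset[OF subgroup_H] by auto

lemma mem_mult [simp]: "g \<in> H \<Longrightarrow> h \<in> H \<Longrightarrow> g \<otimes>\<^bsub>F\<^esub> h \<in> H"
  using subgroup.m_closed[OF subgroup_H] .

lemma mem_inv [simp]: "h \<in> H \<Longrightarrow> inv\<^bsub>F\<^esub> h \<in> H"
  using subgroup.m_inv_closed[OF subgroup_H] .

lemma mem_Nil [simp]: "[] \<in> H"
  using subgroup.one_closed[OF subgroup_H] by simp

lemma mem_right_factor:
  assumes "p \<in> H" "p @ r \<in> H"
  shows "r \<in> H"
proof -
  have "reduced_word A B r" "p @ r = p \<otimes>\<^bsub>F\<^esub> r"
    using mem_reduced[OF assms(2)] by (auto simp: reduced_append mult_append)
  then have "inv\<^bsub>F\<^esub> p \<otimes>\<^bsub>F\<^esub> (p @ r) = r"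
    using assms by (simp add: FP.inv_solve_left')
  then show ?thesis
    using assms by (metis mem_inv mem_mult)
qed

text \<open>Elements of the free product are the edges of its Bass-Serre tree, and the prefixes of
  \<open>p\<close> are the edges on the path from the base edge to \<open>p\<close>. Irreducibility
  says that this path meets the \<open>H\<close>-orbit of the base edge only at its two
  ends.\<close>

definition irreducible_word :: "('a + 'b) list \<Rightarrow> bool" where
  "irreducible_word p \<longleftrightarrow> p \<in> H \<and> p \<noteq> [] \<and> (\<forall>q r. p = q @ r \<longrightarrow> q \<in> H \<longrightarrow> q = [] \<or> r = [])"

lemma irreducible_wordD:
  "irreducible_word p \<Longrightarrow> p \<in> H" "irreducible_word p \<Longrightarrow> p \<noteq> []"
  "irreducible_word p \<Longrightarrow> reduced_word A B p"
  "irreducible_word p \<Longrightarrow> p = q @ r \<Longrightarrow> q \<in> H \<Longrightarrow> q = [] \<or> r = []"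
  by (auto simp: irreducible_word_def)

lemma irreducible_factor:
  assumes "h \<in> H" "h \<noteq> []"
  obtains p r where "irreducible_word p" "r \<in> H" "h = p @ r"
proof -
  define n where "n = (LEAST n. n > 0 \<and> take n h \<in> H)"
  have n: "n > 0 \<and> take n h \<in> H"
    unfolding n_def by (rule LeastI[of _ "length h"]) (use assms in auto)
  have "irreducible_word (take n h)"
    unfolding irreducible_word_def
  proof (intro conjI allI impI)
    fix q r assume qr: "take n h = q @ r" "q \<in> H"
    then have q: "q = take (length q) h"
      by (metis append_eq_conv_conj append_take_drop_id append_assoc)
    show "q = [] \<or> r = []"
    proof (rule disjCI)
      assume "r \<noteq> []"
      then have "length q < n"
        using qr by (metis length_append length_greater_0_conv length_take less_add_same_cancel1 min_less_iff_conj)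
      moreover have "take (length q) h \<in> H"
        using q qr(2) by metis
      ultimately show "q = []"
        using not_less_Least[of "length q" "\<lambda>n. n > 0 \<and> take n h \<in> H"] by (auto simp: n_def)
    qed
  qed (use n assms in auto)
  moreover have "drop n h \<in> H"
    using n assms mem_right_factor[of "take n h" "drop n h"] by simp
  ultimately show ?thesis
    using that[of "take n h" "drop n h"] by simp
qed

lemma irreducible_prefix_unique:
  assumes "irreducible_word p" "irreducible_word q" "p @ x = q @ y"
  shows "p = q"
  using assms unfolding irreducible_word_def append_eq_append_conv2 by auto

lemma inv_append:
  "reduced_word A B (u @ w) \<Longrightarrow> inv\<^bsub>F\<^esub> (u @ w) = inv\<^bsub>F\<^esub> w @ inv\<^bsub>F\<^esub> u"
  by (simp add: inv_word reduced_append)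

lemma irreducible_inv:
  assumes "irreducible_word p"
  shows "irreducible_word (inv\<^bsub>F\<^esub> p)"
  unfolding irreducible_word_def
proof (intro conjI allI impI)
  note p = irreducible_wordD[OF assms]
  show "inv\<^bsub>F\<^esub> p \<in> H" "inv\<^bsub>F\<^esub> p \<noteq> []"
    using p by simp_all
  fix q r assume qr: "inv\<^bsub>F\<^esub> p = q @ r" "q \<in> H"
  then have "reduced_word A B (q @ r)"
    using p by (metis reduced_inv)
  then have r: "reduced_word A B r" and p_eq: "p = inv\<^bsub>F\<^esub> r @ inv\<^bsub>F\<^esub> q"
    using inv_append qr p FP.inv_inv[of p] by (auto simp: reduced_append)
  have "r \<in> H"
    using mem_right_factor[of q r] qr p by (metis mem_inv)
  then show "q = [] \<or> r = []"
    using p(4)[OF p_eq] qr r by auto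
qed

text \<open>The inverse of \<open>p\<close> and the word \<open>q\<close> leave the base edge on the
  same side, so both edges and the base edge border one component of the tree cut along the orbit.
  Translating by \<open>p\<close>, the edges \<open>1\<close>, \<open>p\<close> and
  \<open>p q\<close> border one component, which makes \<open>p q\<close> visible from the base edge
  and fixes the sides on which it starts and ends.\<close>

lemma irreducible_mult:
  assumes "irreducible_word p" "irreducible_word q"
    and same: "isl (last p) = isl (hd q)" and ne: "p \<otimes>\<^bsub>F\<^esub> q \<noteq> []"
  shows "irreducible_word (p \<otimes>\<^bsub>F\<^esub> q)" "isl (hd (p \<otimes>\<^bsub>F\<^esub> q)) = isl (hd p)"
    "isl (last (p \<otimes>\<^bsub>F\<^esub> q)) = isl (last q)"
proof -
  note p = irreducible_wordD[OF assms(1)] and q = irreducible_wordD[OF assms(2)]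
  let ?g = "p \<otimes>\<^bsub>F\<^esub> q"
  show "irreducible_word ?g"
    unfolding irreducible_word_def
  proof (intro conjI allI impI)
    fix r r' assume r: "?g = r @ r'" "r \<in> H"
    \<comment> \<open>If \<open>p\<close> itself were a prefix, nothing would cancel or merge,
      although the two meeting letters come from the same factor.\<close>
    have absurd: False if "r = p"
    proof -
      have red: "reduced_word A B (p @ r')"
        using r that p(1) q(1) by (metis mem_reduced mem_mult)
      then have "p \<otimes>\<^bsub>F\<^esub> q = p \<otimes>\<^bsub>F\<^esub> r'" "reduced_word A B r'"
        using r that by (auto simp: mult_append reduced_append)
      then have "q = r'"
        using p q by simp
      then show False
        using red same p q by (simp add: reduced_append)
    qed
    show "r = [] \<or> r' = []"
      using p(3) q(3) r(1)
    proof (cases rule: prefix_mult_cases)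
      case (1 t)
      then show ?thesis using p(4)[OF 1 r(2)] absurd by auto
    next
      case (2 v v')
      have v: "reduced_word A B v"
        using q(3) 2 by (simp add: reduced_append)
      have "v = inv\<^bsub>F\<^esub> p \<otimes>\<^bsub>F\<^esub> r"
        using 2 p v by (simp add: FP.inv_solve_left)
      then have "v \<in> H"
        using r(2) p by simp
      then have "v = [] \<or> v' = []"
        using q(4)[OF 2(1)] by simp
      then show ?thesis
        using 2 absurd p r by auto
    qed
  qed (use p q ne in simp_all)
  have g: "reduced_word A B ?g" "?g \<in> H"
    using p q by simp_all
  show "isl (hd ?g) = isl (hd p)"
  proof (rule ccontr)
    assume "isl (hd ?g) \<noteq> isl (hd p)"
    \<comment> \<open>If the first letters came from different factors, \<open>q\<close> would be
      the concatenation of two non-trivial elements of \<open>H\<close>.\<close>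
    then have "inv\<^bsub>F\<^esub> p \<otimes>\<^bsub>F\<^esub> ?g = inv\<^bsub>F\<^esub> p @ ?g"
      using p q g by (intro reduced_last(2)) (auto simp: isl_last_inv)
    then have "q = inv\<^bsub>F\<^esub> p @ ?g"
      using p q by (simp add: FP.m_assoc[symmetric])
    then show False
      using q(4)[of "inv\<^bsub>F\<^esub> p" ?g] p ne by simp
  qed
  show "isl (last ?g) = isl (last q)"
  proof (rule ccontr)
    assume "isl (last ?g) \<noteq> isl (last q)"
    then have "?g \<otimes>\<^bsub>F\<^esub> inv\<^bsub>F\<^esub> q = ?g @ inv\<^bsub>F\<^esub> q"
      using p q g by (intro reduced_last(2)) (auto simp: isl_hd_inv)
    then have "p = ?g @ inv\<^bsub>F\<^esub> q"
      using p q by (simp add: FP.m_assoc)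
    then show False
      using p(4)[of ?g "inv\<^bsub>F\<^esub> q"] g q ne by simp
  qed
qed

end

section \<open>Splitting a subgroup along the orbit of the base edge\<close>

context word_subgroup begin

text \<open>The stabiliser in \<open>H\<close> of the component of the cut tree on side
  \<open>s\<close> of the base edge: an element fixes it exactly if its edge borders this component
  and faces it with the same side as the base edge does.\<close>

definition side :: "bool \<Rightarrow> ('a + 'b) list set" where
  "side s = {[]} \<union> {p. irreducible_word p \<and> isl (hd p) = s \<and> isl (last p) = s}"

lemma side_reduced: "p \<in> side s \<Longrightarrow> reduced_word A B p"
  by (auto simp: side_def irreducible_wordD)

lemma subgroup_side: "subgroup (side s) F"
proof (rule FP.subgroupI)
  fix p q assume "p \<in> side s" "q \<in> side s"
  then show "p \<otimes>\<^bsub>F\<^esub> q \<in> side s"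
    using irreducible_mult[of p q] by (auto simp: side_def irreducible_wordD)
  show "inv\<^bsub>F\<^esub> p \<in> side s"
    using \<open>p \<in> side s\<close> irreducible_inv[of p] FP.inv_one
    by (auto simp: side_def irreducible_wordD isl_hd_inv isl_last_inv)
qed (auto simp: side_def irreducible_wordD)

lemma generate_eq_H:
  assumes "S \<subseteq> H" "\<And>p. irreducible_word p \<Longrightarrow> p \<in> generate F S"
  shows "generate F S = H"
proof
  show "generate F S \<subseteq> H"
    using FP.generate_subgroup_incl[OF assms(1) subgroup_H] .
  have "h \<in> generate F S" if "h \<in> H" for h
    using that
  proof (induction "length h" arbitrary: h rule: less_induct)
    case less
    show ?case
    proof (cases "h = []")
      case True
      then show ?thesis using generate.one[of F S] by simp
    next
      case False
      then obtain p r where pr: "irreducible_word p" "r \<in> H" "h = p @ r"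
        using irreducible_factor less.prems by blast
      then have "r \<in> generate F S"
        using less.hyps[of r] irreducible_wordD(2)[of p] by auto
      moreover have "h = p \<otimes>\<^bsub>F\<^esub> r"
        using pr less.prems by (metis mem_reduced mult_append)
      ultimately show ?thesis
        using assms(2)[OF pr(1)] by (simp add: generate.eng)
    qed
  qed
  then show "H \<subseteq> generate F S" by blast
qed

lemma irreducible_mult_word:
  assumes "irreducible_word p" "irreducible_word q" "isl (last p) = isl (hd q)" "p \<otimes>\<^bsub>F\<^esub> q \<noteq> []" "q @ r \<in> H"
  shows "p \<otimes>\<^bsub>F\<^esub> (q @ r) = (p \<otimes>\<^bsub>F\<^esub> q) @ r" "(p \<otimes>\<^bsub>F\<^esub> q) @ r \<in> H"
proof -
  have red: "reduced_word A B p" "reduced_word A B q" "reduced_word A B (q @ r)"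
    using assms irreducible_wordD(3) by auto
  then have r: "reduced_word A B r" "q @ r = q \<otimes>\<^bsub>F\<^esub> r"
    by (auto simp: reduced_append mult_append)
  have "reduced_word A B ((p \<otimes>\<^bsub>F\<^esub> q) @ r)"
    using red irreducible_mult(3)[OF assms(1-4)] irreducible_wordD(2)[OF assms(2)]
    by (auto simp: reduced_append)
  then have "(p \<otimes>\<^bsub>F\<^esub> q) \<otimes>\<^bsub>F\<^esub> r = (p \<otimes>\<^bsub>F\<^esub> q) @ r"
    by (rule mult_append)
  then show *: "p \<otimes>\<^bsub>F\<^esub> (q @ r) = (p \<otimes>\<^bsub>F\<^esub> q) @ r"
    using red r FP.m_assoc[of p q r] by simp
  show "(p \<otimes>\<^bsub>F\<^esub> q) @ r \<in> H"
    using mem_mult[OF irreducible_wordD(1)[OF assms(1)] assms(5)] * by simp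
qed

lemma concat_word:
  assumes "p \<in> H" "x \<in> H" "p \<noteq> []" "x = [] \<or> isl (last p) \<noteq> isl (hd x)"
  shows "p \<otimes>\<^bsub>F\<^esub> x = p @ x"
  using assms by (intro mult_append) (auto simp: reduced_append)

text \<open>Cutting the tree of the free product along the \<open>H\<close>-orbit of the base edge splits \<open>H\<close>; the
  irreducible words of \<open>H\<close> are the edges of this orbit visible from the base edge. The base
  edge lies in the minimal subtree as soon as it lies on the axis of \<open>f\<close>.\<close>

lemma decomposes_without_mixed:
  assumes mixed: "\<And>p. irreducible_word p \<Longrightarrow> isl (hd p) = isl (last p)"
  shows "F\<lparr>carrier := H\<rparr> \<cong> free_product (F\<lparr>carrier := side True\<rparr>) (F\<lparr>carrier := side False\<rparr>)"
proof -
  have gen: "generate F (side True \<union> side False) = H"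
  proof (rule generate_eq_H)
    fix p assume "irreducible_word p"
    with mixed[OF this] show "p \<in> generate F (side True \<union> side False)"
      by (cases "isl (hd p)") (auto simp: side_def intro!: generate.incl)
  qed (auto simp: side_def irreducible_wordD)
  have ping: "p \<otimes>\<^bsub>F\<^esub> x \<in> {x \<in> H. x \<noteq> [] \<and> isl (hd x) = s}"
    if "p \<in> side s" "p \<noteq> []" "x = [] \<or> x \<in> H \<and> x \<noteq> [] \<and> isl (hd x) \<noteq> s" for p x s
  proof -
    have p: "p \<in> H" "isl (hd p) = s" "isl (last p) = s"
      using that by (auto simp: side_def irreducible_wordD)
    have x: "x \<in> H" using that(3) by auto
    have "p \<otimes>\<^bsub>F\<^esub> x = p @ x"
      using concat_word[OF p(1) x] p that by auto
    then show ?thesis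
      using p that mem_mult[OF p(1) x] by simp
  qed
  have "F\<lparr>carrier := generate F (side True \<union> side False)\<rparr> \<cong>
      free_product (F\<lparr>carrier := side True\<rparr>) (F\<lparr>carrier := side False\<rparr>)"
  proof (rule FP.free_product_iso_if_ping_pong[OF subgroup_side subgroup_side])
    show "k \<otimes>\<^bsub>F\<^esub> x \<in> {x \<in> H. x \<noteq> [] \<and> isl (hd x) = True}"
      if "k \<in> side True" "k \<noteq> \<one>\<^bsub>F\<^esub>" "x \<in> insert \<one>\<^bsub>F\<^esub> {x \<in> H. x \<noteq> [] \<and> isl (hd x) = False}" for k x
      using that by (intro ping) auto
    show "k \<otimes>\<^bsub>F\<^esub> x \<in> {x \<in> H. x \<noteq> [] \<and> isl (hd x) = False}"
      if "k \<in> side False" "k \<noteq> \<one>\<^bsub>F\<^esub>" "x \<in> insert \<one>\<^bsub>F\<^esub> {x \<in> H. x \<noteq> [] \<and> isl (hd x) = True}" for k x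
      using that by (intro ping) auto
  qed auto
  then show ?thesis
    by (simp add: gen)
qed

text \<open>The mixed word \<open>t\<close> carries the component on the \<open>B\<close> side of
  the base edge to the one on the \<open>A\<close> side. So there is a single orbit of components,
  the quotient of the cut tree is a loop, and \<open>H\<close> is an HNN extension over the trivial
  group with stable letter \<open>t\<close>.\<close>

lemma decomposes_with_mixed:
  assumes t: "irreducible_word t" "isl (hd t)" "\<not> isl (last t)"
  defines "T \<equiv> range (\<lambda>n::int. t [^]\<^bsub>F\<^esub> n)"
  shows "subgroup T F" "F\<lparr>carrier := T\<rparr> \<cong> integer_group" "generate F (side True \<union> T) = H"
    "F\<lparr>carrier := H\<rparr> \<cong> free_product (F\<lparr>carrier := side True\<rparr>) (F\<lparr>carrier := T\<rparr>)"
proof -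
  note tD = irreducible_wordD[OF t(1)]
  define t' where "t' = inv\<^bsub>F\<^esub> t"
  have t': "irreducible_word t'" "\<not> isl (hd t')" "isl (last t')"
    using t irreducible_inv tD by (auto simp: t'_def isl_hd_inv isl_last_inv)
  note t'D = irreducible_wordD[OF t'(1)]
  have tt': "t \<otimes>\<^bsub>F\<^esub> t' = []" "t' \<otimes>\<^bsub>F\<^esub> t = []"
    using tD by (simp_all add: t'_def)
  have cancel: "t' \<otimes>\<^bsub>F\<^esub> p = [] \<longleftrightarrow> p = t" "p \<otimes>\<^bsub>F\<^esub> t' = [] \<longleftrightarrow> p = t"
    "p \<otimes>\<^bsub>F\<^esub> t = [] \<longleftrightarrow> p = t'" "t \<otimes>\<^bsub>F\<^esub> p = [] \<longleftrightarrow> p = t'"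
    if "reduced_word A B p" for p
    using that tD(3) t'D(3) tt' FP.Units_l_cancel[of t' p t] FP.right_cancel[of t' p t] FP.right_cancel[of t p t']
      FP.Units_l_cancel[of t p t']
    by simp_all
  have "T = generate F {t}"
    unfolding T_def using FP.generate_pow[of t] tD(3) by auto
  then have T: "subgroup T F"
    using FP.generate_is_subgroup[of "{t}"] tD(3) by simp
  show "subgroup T F" by (fact T)
  \<comment> \<open>The non-trivial elements of \<open>H\<close> are sorted by the first orbit edge
    on their path: \<open>t\<close> for \<open>U\<close>, an edge on the \<open>B\<close> side for
    \<open>W\<close>, another edge on the \<open>A\<close> side for \<open>V\<close>. Positive
    powers of \<open>t\<close> lead into \<open>U\<close>, negative ones into
    \<open>W\<close>.\<close>
  define U where "U = {h \<in> H. \<exists>r. h = t @ r}"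
  define W where "W = {h \<in> H. h \<noteq> [] \<and> \<not> isl (hd h)}"
  define V where "V = {h \<in> H. h \<noteq> [] \<and> isl (hd h) \<and> (\<forall>r. h \<noteq> t @ r)}"
  have U_hd: "isl (hd x)" "x \<noteq> []" "x \<in> H" if "x \<in> U" for x
    using that t tD by (auto simp: U_def)
  have tU: "t \<otimes>\<^bsub>F\<^esub> x \<in> U" if "x \<in> insert [] (V \<union> U)" for x
  proof -
    have x: "x \<in> H" "x = [] \<or> isl (hd x)"
      using that U_hd by (auto simp: V_def)
    then show ?thesis
      using concat_word[OF tD(1) x(1) tD(2)] t mem_mult[OF tD(1) x(1)] by (auto simp: U_def)
  qed
  have tW: "t' \<otimes>\<^bsub>F\<^esub> x \<in> W" if "x \<in> insert [] (V \<union> W)" for x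
  proof (cases "x \<in> V")
    case True
    \<comment> \<open>\<open>t'\<close> and the first irreducible factor \<open>p\<close> of
      \<open>x\<close> meet on the same side, so their product is one irreducible word; it is
      non-trivial because \<open>p\<close> differs from \<open>t\<close>.\<close>
    then obtain p r where pr: "irreducible_word p" "r \<in> H" "x = p @ r"
      using irreducible_factor[of x] unfolding V_def by blast
    have p: "isl (hd p)" "p \<noteq> t" "x \<in> H"
      using True pr irreducible_wordD(2)[OF pr(1)] by (auto simp: V_def)
    have ne: "t' \<otimes>\<^bsub>F\<^esub> p \<noteq> []"
      using p cancel pr irreducible_wordD(3) by blast
    have "isl (last t') = isl (hd p)"
      using t' p by simp
    note * = irreducible_mult(2)[OF t'(1) pr(1) this ne] irreducible_mult_word[OF t'(1) pr(1) this ne]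
    show ?thesis
      using * pr p ne t' by (auto simp: W_def)
  next
    case False
    then have x: "x \<in> H" "x = [] \<or> \<not> isl (hd x)"
      using that by (auto simp: W_def)
    then show ?thesis
      using concat_word[OF t'D(1) x(1) t'D(2)] t' t'D mem_mult[OF t'D(1) x(1)] by (auto simp: W_def)
  qed
  have T_pos: "t [^]\<^bsub>F\<^esub> Suc n \<otimes>\<^bsub>F\<^esub> x \<in> U" if "x \<in> insert [] V" for n x
  proof (induction n)
    case (Suc n)
    have "reduced_word A B x" using that by (auto simp: V_def)
    then have "t [^]\<^bsub>F\<^esub> Suc (Suc n) \<otimes>\<^bsub>F\<^esub> x = t \<otimes>\<^bsub>F\<^esub> (t [^]\<^bsub>F\<^esub> Suc n \<otimes>\<^bsub>F\<^esub> x)"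
      using FP.nat_pow_Suc2[of t "Suc n"] FP.nat_pow_closed[of t "Suc n"] tD
      by (simp add: FP.m_assoc del: FP.nat_pow_Suc)
    then show ?case using tU Suc by simp
  qed (use that tU[of x] tD(3) in auto)
  have T_neg: "t' [^]\<^bsub>F\<^esub> Suc n \<otimes>\<^bsub>F\<^esub> x \<in> W" if "x \<in> insert [] V" for n x
  proof (induction n)
    case (Suc n)
    have "reduced_word A B x" using that by (auto simp: V_def)
    then have "t' [^]\<^bsub>F\<^esub> Suc (Suc n) \<otimes>\<^bsub>F\<^esub> x = t' \<otimes>\<^bsub>F\<^esub> (t' [^]\<^bsub>F\<^esub> Suc n \<otimes>\<^bsub>F\<^esub> x)"
      using FP.nat_pow_Suc2[of t' "Suc n"] FP.nat_pow_closed[of t' "Suc n"] t'D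
      by (simp add: FP.m_assoc del: FP.nat_pow_Suc)
    then show ?case using tW Suc by simp
  qed (use that tW[of x] t'D(3) in auto)
  have T_ping: "t [^]\<^bsub>F\<^esub> n \<otimes>\<^bsub>F\<^esub> x \<in> U \<union> W" if "n \<noteq> 0" "x \<in> insert [] V" for n :: int and x
  proof (cases "n > 0")
    case True
    then have "n = int (Suc (nat n - 1))"
      by simp
    then obtain m where "n = int (Suc m)"
      by blast
    then show ?thesis
      using T_pos[OF that(2), of m] by (simp add: int_pow_int del: FP.nat_pow_Suc of_nat_Suc)
  next
    case False
    then have "n = - int (Suc (nat (- n) - 1))"
      using that(1) by simp
    then obtain m where "n = - int (Suc m)"
      by blast
    then have "t [^]\<^bsub>F\<^esub> n = t' [^]\<^bsub>F\<^esub> Suc m"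
      using FP.int_pow_neg_int[of t "Suc m"] FP.nat_pow_inv[of t "Suc m"] tD(3)
      by (simp only: t'_def carrier_FP)
    then show ?thesis
      using T_neg[OF that(2), of m] by simp
  qed
  have T_ne: "t [^]\<^bsub>F\<^esub> n \<noteq> []" if "n \<noteq> 0" for n :: int
    using T_ping[OF that, of "[]"] U_hd(2) FP.int_pow_closed[of t n] tD by (auto simp: W_def)
  have K_ping: "k \<otimes>\<^bsub>F\<^esub> x \<in> V" if "k \<in> side True" "k \<noteq> []" "x \<in> insert [] (U \<union> W)" for k x
  proof -
    have k: "irreducible_word k" "isl (hd k)" "isl (last k)"
      using that by (auto simp: side_def)
    note kD = irreducible_wordD[OF k(1)]
    have kt: "k \<noteq> t" using k t by auto
    show ?thesis
    proof (cases "x \<in> U")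
      case True
      then obtain r where r: "x = t @ r" "t @ r \<in> H"
        by (auto simp: U_def)
      have ne: "k \<otimes>\<^bsub>F\<^esub> t \<noteq> []"
        using cancel(3)[OF kD(3)] k t' by auto
      have "isl (last k) = isl (hd t)"
        using k t by simp
      note * = irreducible_mult[OF k(1) t(1) this ne] irreducible_mult_word[OF k(1) t(1) this ne r(2)]
      \<comment> \<open>Both \<open>k t\<close> and \<open>t\<close> are irreducible, so neither is
        a proper prefix of the other, and they are equal only for trivial \<open>k\<close>.\<close>
      have "(k \<otimes>\<^bsub>F\<^esub> t) @ r \<noteq> t @ r'" for r'
      proof
        assume "(k \<otimes>\<^bsub>F\<^esub> t) @ r = t @ r'"
        then have "k \<otimes>\<^bsub>F\<^esub> t = t"
          using irreducible_prefix_unique * t by blast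
        then show False
          using kD tD FP.l_cancel_one[of t k] by simp
      qed
      then show ?thesis
        using * r ne k by (auto simp: V_def)
    next
      case False
      then have x: "x \<in> H" "x = [] \<or> \<not> isl (hd x)"
        using that by (auto simp: W_def)
      have "k \<otimes>\<^bsub>F\<^esub> x = k @ x"
        using concat_word[OF kD(1) x(1) kD(2)] x k by auto
      moreover have "k @ x \<noteq> t @ r" for r
        using irreducible_prefix_unique[OF k(1) t(1)] kt by blast
      ultimately show ?thesis
        using mem_mult[OF kD(1) x(1)] kD k by (auto simp: V_def)
    qed
  qed
  show gen: "generate F (side True \<union> T) = H"
  proof (rule generate_eq_H)
    show "side True \<union> T \<subseteq> H"
      using tD FP.subgroup_int_pow_closed[OF subgroup_H] by (auto simp: side_def irreducible_wordD T_def)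
    have gr: "side True \<union> T \<subseteq> carrier F"
      using subgroup.subset[OF T] side_reduced by auto
    have "t = t [^]\<^bsub>F\<^esub> (1::int)"
      using tD by simp
    then have gt: "t \<in> generate F (side True \<union> T)"
      unfolding T_def by (intro generate.incl) blast
    then have gt': "t' \<in> generate F (side True \<union> T)"
      unfolding t'_def using FP.generate_m_inv_closed[OF gr] by blast
    \<comment> \<open>Mixed words of the same type differ by an element of the stabiliser
      \<open>side True\<close>.\<close>
    have TF: "p \<in> generate F (side True \<union> T)" if p: "irreducible_word p" "isl (hd p)" "\<not> isl (last p)" for p
    proof (cases "p = t")
      case False
      note pD = irreducible_wordD[OF p(1)]
      have "p \<otimes>\<^bsub>F\<^esub> t' \<noteq> []"
        using cancel(2) pD False by blast
      then have "p \<otimes>\<^bsub>F\<^esub> t' \<in> side True"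
        using irreducible_mult[OF p(1) t'(1)] p t' by (simp add: side_def)
      then have "(p \<otimes>\<^bsub>F\<^esub> t') \<otimes>\<^bsub>F\<^esub> t \<in> generate F (side True \<union> T)"
        using gt by (blast intro: generate.eng generate.incl)
      moreover have "(p \<otimes>\<^bsub>F\<^esub> t') \<otimes>\<^bsub>F\<^esub> t = p"
        using pD tD t'D tt' by (simp add: FP.m_assoc)
      ultimately show ?thesis by simp
    qed (use gt in simp)
    fix p assume p: "irreducible_word p"
    note pD = irreducible_wordD[OF p]
    consider "isl (hd p)" "isl (last p)" | "isl (hd p)" "\<not> isl (last p)"
      | "\<not> isl (hd p)" "isl (last p)" | "\<not> isl (hd p)" "\<not> isl (last p)"
      by blast
    then show "p \<in> generate F (side True \<union> T)"
    proof cases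
      case 1
      then show ?thesis using p by (auto simp: side_def intro!: generate.incl)
    next
      case 2
      then show ?thesis using TF p by blast
    next
      case 3
      then have "inv\<^bsub>F\<^esub> p \<in> generate F (side True \<union> T)"
        using p pD irreducible_inv by (intro TF) (auto simp: isl_hd_inv isl_last_inv)
      then show ?thesis
        using FP.generate_m_inv_closed[OF gr] FP.inv_inv[of p] pD by fastforce
    next
      \<comment> \<open>Multiplication by \<open>t\<close> turns a word on the other side into a
        mixed one.\<close>
      case 4
      then have "t \<otimes>\<^bsub>F\<^esub> p \<noteq> []"
        using cancel(4)[of p] pD t' by auto
      then have "t \<otimes>\<^bsub>F\<^esub> p \<in> generate F (side True \<union> T)"
        using irreducible_mult[OF t(1) p] 4 t by (intro TF) auto
      then have "t' \<otimes>\<^bsub>F\<^esub> (t \<otimes>\<^bsub>F\<^esub> p) \<in> generate F (side True \<union> T)"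
        using gt' by (blast intro: generate.eng)
      moreover have "t' \<otimes>\<^bsub>F\<^esub> (t \<otimes>\<^bsub>F\<^esub> p) = p"
        using pD tD t'D tt' by (simp add: FP.m_assoc[symmetric])
      ultimately show ?thesis by simp
    qed
  qed
  have "F\<lparr>carrier := generate F (side True \<union> T)\<rparr> \<cong> free_product (F\<lparr>carrier := side True\<rparr>) (F\<lparr>carrier := T\<rparr>)"
  proof (rule FP.free_product_iso_if_ping_pong[OF subgroup_side T])
    show "k \<otimes>\<^bsub>F\<^esub> x \<in> V" if "k \<in> side True" "k \<noteq> \<one>\<^bsub>F\<^esub>" "x \<in> insert \<one>\<^bsub>F\<^esub> (U \<union> W)" for k x
      using that K_ping by simp
    show "l \<otimes>\<^bsub>F\<^esub> x \<in> U \<union> W" if "l \<in> T" "l \<noteq> \<one>\<^bsub>F\<^esub>" "x \<in> insert \<one>\<^bsub>F\<^esub> V" for l x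
    proof -
      obtain n :: int where n: "l = t [^]\<^bsub>F\<^esub> n"
        using \<open>l \<in> T\<close> by (auto simp: T_def)
      then have "n \<noteq> 0" using that(2) by auto
      then show ?thesis using T_ping n that(3) by simp
    qed
  qed (use U_hd in \<open>auto simp: V_def W_def\<close>)
  then show "F\<lparr>carrier := H\<rparr> \<cong> free_product (F\<lparr>carrier := side True\<rparr>) (F\<lparr>carrier := T\<rparr>)"
    by (simp add: gen)
  have "(\<lambda>n::int. t [^]\<^bsub>F\<^esub> n) \<in> iso integer_group (F\<lparr>carrier := T\<rparr>)"
  proof -
    have "inj (\<lambda>n::int. t [^]\<^bsub>F\<^esub> n)"
    proof (rule injI)
      fix m n :: int assume "t [^]\<^bsub>F\<^esub> m = t [^]\<^bsub>F\<^esub> n"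
      then have "t [^]\<^bsub>F\<^esub> (m - n) = []"
        using tD(3) FP.int_pow_diff[of t m n] FP.r_inv[OF FP.int_pow_closed[of t n]] by simp
      then show "m = n" using T_ne[of "m - n"] by auto
    qed
    then show ?thesis
      using tD by (auto simp: iso_def hom_def bij_betw_def T_def FP.int_pow_mult)
  qed
  then show "F\<lparr>carrier := T\<rparr> \<cong> integer_group"
    using group.iso_sym[OF group_integer_group] by (auto simp: is_iso_def)
qed

text \<open>Since \<open>f\<close> is cyclically reduced, its axis runs through the base edge and
  leaves it on both sides. Without mixed words the first irreducible factors of \<open>f\<close> and
  of its inverse witness that both stabilisers are non-trivial. With a mixed word the splitting is
  trivial only if \<open>H\<close> is generated by \<open>t\<close>.\<close>

theorem not_freely_indecomposable_subgroup:
  assumes f: "f \<in> H" "f \<noteq> []" "isl (hd f)" "\<not> isl (last f)"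
  shows "F\<lparr>carrier := H\<rparr> \<cong> integer_group \<or> \<not> freely_indecomposable (F\<lparr>carrier := H\<rparr>)"
proof -
  have grp: "group (F\<lparr>carrier := S\<rparr>)" if "subgroup S F" for S
    using FP.subgroup_imp_group[OF that] .
  have triv: "\<not> trivial_group (F\<lparr>carrier := S\<rparr>)" if "x \<in> S" "x \<noteq> []" for S x
    using that by (auto simp: trivial_group_def)
  show ?thesis
  proof (cases "\<exists>p. irreducible_word p \<and> isl (hd p) \<noteq> isl (last p)")
    case True
    then obtain p where p: "irreducible_word p" "isl (hd p) \<noteq> isl (last p)" by blast
    obtain t where t: "irreducible_word t" "isl (hd t)" "\<not> isl (last t)"
    proof (cases "isl (hd p)")
      case False
      then show ?thesis
        using that[of "inv\<^bsub>F\<^esub> p"] p irreducible_inv irreducible_wordD[OF p(1)]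
        by (auto simp: isl_hd_inv isl_last_inv)
    qed (use p that in auto)
    define T where "T = range (\<lambda>n::int. t [^]\<^bsub>F\<^esub> n)"
    note t_dec = decomposes_with_mixed[OF t, folded T_def]
    show ?thesis
    proof (cases "side True = {[]}")
      case True
      have "T \<subseteq> H"
        using generate.incl[of _ "side True \<union> T" F] t_dec(3) by auto
      moreover have "generate F (side True \<union> T) \<subseteq> T"
        using True subgroup.one_closed[OF t_dec(1)] by (intro FP.generate_subgroup_incl t_dec(1)) auto
      ultimately have "H = T"
        using t_dec(3) by auto
      then show ?thesis using t_dec(2) by simp
    next
      case False
      then obtain x where x: "x \<in> side True" "x \<noteq> []"
        by (auto simp: side_def)
      have "t [^]\<^bsub>F\<^esub> (1::int) \<in> T" "t [^]\<^bsub>F\<^esub> (1::int) \<noteq> []"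
        using irreducible_wordD[OF t(1)] by (auto simp only: T_def) auto
      with x t_dec(1,4) subgroup_side show ?thesis
        using triv grp not_freely_indecomposable[OF grp[OF subgroup_H] grp[OF subgroup_side] grp[OF t_dec(1)]] by blast
    qed
  next
    case False
    obtain p r where pr: "irreducible_word p" "r \<in> H" "f = p @ r"
      using irreducible_factor f by blast
    obtain q r' where qr: "irreducible_word q" "r' \<in> H" "inv\<^bsub>F\<^esub> f = q @ r'"
      using irreducible_factor[of "inv\<^bsub>F\<^esub> f"] f by auto
    have "isl (hd p)" "\<not> isl (hd q)"
      using pr qr f irreducible_wordD(2) isl_hd_inv[of f] by auto
    then have "p \<in> side True" "q \<in> side False"
      using False pr qr by (auto simp: side_def)
    then show ?thesis
      using False decomposes_without_mixed triv irreducible_wordD(2)[OF pr(1)] irreducible_wordD(2)[OF qr(1)]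
        not_freely_indecomposable[OF grp[OF subgroup_H] grp[OF subgroup_side] grp[OF subgroup_side]] by blast
  qed
qed

end

lemma freely_indecomposable_iso:
  assumes "freely_indecomposable X" "group K" "X \<cong> K"
  shows "freely_indecomposable K"
proof -
  have X: "group X" "\<not> trivial_group X"
    using assms by (auto simp: freely_indecomposable_def)
  have "\<not> K \<cong> free_product G1 G2"
    if "group G1" "group G2" "\<not> trivial_group G1" "\<not> trivial_group G2" for G1 G2 :: "'c monoid"
    using not_freely_indecomposable[OF X(1) that] iso_trans[OF assms(3)] assms(1) by blast
  then show ?thesis
    using assms X trivial_group_iso_iff[OF X(1) assms(2,3)] by (auto simp: freely_indecomposable_def)
qed

section \<open>Conjugating an indecomposable subgroup into a factor\<close>

context group_pair begin

definition factor :: "bool \<Rightarrow> ('a + 'b) list set" where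
  "factor s = {[]} \<union> {[x] |x. letter A B x \<and> isl x = s}"

lemma factor_reduced: "w \<in> factor s \<Longrightarrow> reduced_word A B w"
  by (auto simp: factor_def reduced_word_Cons)

lemma mult_singletons:
  assumes "letter A B x" "letter A B y" "isl x = isl y"
  obtains "[x] \<otimes>\<^bsub>F\<^esub> [y] = []" "y = letter_inv A B x"
  | z where "[x] \<otimes>\<^bsub>F\<^esub> [y] = [z]" "letter A B z" "isl z = isl y"
proof -
  have y: "reduced_word A B [y]" using assms by (simp add: reduced_word_Cons)
  show ?thesis
    using assms(1) y
  proof (cases rule: push_letter_cases)
    case (2 v)
    then show ?thesis using that(1) by (simp add: mult_Cons)
  next
    case (3 y' z v)
    then show ?thesis using that(2)[of z] by (simp add: mult_Cons)
  qed (use assms in simp)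
qed

lemma factor_mult: "u \<in> factor s \<Longrightarrow> w \<in> factor s \<Longrightarrow> u \<otimes>\<^bsub>F\<^esub> w \<in> factor s"
proof -
  assume *: "u \<in> factor s" "w \<in> factor s"
  show ?thesis
  proof (cases "u = [] \<or> w = []")
    case True
    then show ?thesis using * factor_reduced[OF *(1)] by auto
  next
    case False
    then obtain x y where "u = [x]" "w = [y]" "letter A B x" "letter A B y" "isl x = isl y" "isl y = s"
      using * by (auto simp: factor_def)
    then show ?thesis
      by (auto simp: factor_def elim!: mult_singletons[of x y])
  qed
qed

lemma factor_inv: "u \<in> factor s \<Longrightarrow> inv\<^bsub>F\<^esub> u \<in> factor s"
  by (auto simp: factor_def inv_word reduced_word_Cons letter_letter_inv)

text \<open>The minimal displacement \<open>e\<close> of a non-trivial element of the image is realised inside a factor;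
  then everything else lies in the same factor, since otherwise some element of the image would
  become cyclically reduced of length at least two.\<close>

lemma indecomposable_conj_into_factor:
  assumes X: "freely_indecomposable X" "\<not> X \<cong> integer_group"
    and f: "f \<in> hom X F" "inj_on f (carrier X)"
  obtains k s where "reduced_word A B k"
    "\<And>x. x \<in> carrier X \<Longrightarrow> inv\<^bsub>F\<^esub> k \<otimes>\<^bsub>F\<^esub> f x \<otimes>\<^bsub>F\<^esub> k \<in> factor s"
proof -
  interpret X: group X
    using X by (simp add: freely_indecomposable_def)
  interpret f: group_hom X F f
    using f by unfold_locales
  have f_red [simp]: "reduced_word A B (f x)" if "x \<in> carrier X" for x
    using f.hom_closed[OF that] by simp
  \<comment> \<open>The subgroup theorem for the image of an arbitrary embedding \<open>g\<close>:
    no element of it begins and ends in different factors. The inverse covers the opposite order of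
    the two factors.\<close>
  have no_hyp: "isl (hd (g x)) = isl (last (g x))"
    if g: "g \<in> hom X F" "inj_on g (carrier X)" and x: "x \<in> carrier X" "g x \<noteq> []" for g x
  proof -
    interpret g: group_hom X F g
      using g by unfold_locales
    have subg: "subgroup (g ` carrier X) F"
      by (rule g.img_is_subgroup)
    interpret word_subgroup A B "g ` carrier X"
      by (intro word_subgroup.intro word_subgroup_axioms.intro subg) (rule group_pair_axioms)
    let ?K = "F\<lparr>carrier := g ` carrier X\<rparr>"
    have "g \<in> iso X ?K"
      using g by (auto simp: iso_def hom_def bij_betw_def)
    then have iso: "X \<cong> ?K"
      by (auto simp: is_iso_def)
    have "\<not> ?K \<cong> integer_group"
      using iso X(2) iso_trans by blast
    moreover have "freely_indecomposable ?K"
      using freely_indecomposable_iso[OF X(1) FP.subgroup_imp_group[OF subg] iso] .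
    ultimately have *: "\<And>h. h \<in> g ` carrier X \<Longrightarrow> h \<noteq> [] \<Longrightarrow> isl (hd h) \<Longrightarrow> isl (last h)"
      using not_freely_indecomposable_subgroup by blast
    have gx: "g x \<in> g ` carrier X" "inv\<^bsub>F\<^esub> (g x) \<in> g ` carrier X" "reduced_word A B (g x)"
      using x by auto
    show ?thesis
      using *[OF gx(1) x(2)] *[OF gx(2)] gx x(2) by (auto simp: isl_hd_inv isl_last_inv)
  qed
  define E where "E k x = inv\<^bsub>F\<^esub> k \<otimes>\<^bsub>F\<^esub> f x \<otimes>\<^bsub>F\<^esub> k" for k x
  have E_red [simp]: "reduced_word A B (E k x)" if "reduced_word A B k" "x \<in> carrier X" for k x
    using that by (simp add: E_def)
  have E_mult: "E k (x \<otimes>\<^bsub>X\<^esub> y) = E k x \<otimes>\<^bsub>F\<^esub> E k y"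
    if "reduced_word A B k" "x \<in> carrier X" "y \<in> carrier X" for k x y
  proof -
    have "k \<otimes>\<^bsub>F\<^esub> (inv\<^bsub>F\<^esub> k \<otimes>\<^bsub>F\<^esub> (f y \<otimes>\<^bsub>F\<^esub> k)) = f y \<otimes>\<^bsub>F\<^esub> k"
      using that FP.m_assoc[of k "inv\<^bsub>F\<^esub> k" "f y \<otimes>\<^bsub>F\<^esub> k"] by simp
    then show ?thesis
      using that by (simp add: E_def FP.m_assoc f.hom_mult)
  qed
  have E_conj: "E (k \<otimes>\<^bsub>F\<^esub> l) x = inv\<^bsub>F\<^esub> l \<otimes>\<^bsub>F\<^esub> E k x \<otimes>\<^bsub>F\<^esub> l"
    if "reduced_word A B k" "reduced_word A B l" "x \<in> carrier X" for k l x
    using that by (simp add: E_def FP.m_assoc FP.inv_mult_group)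
  have E_hom: "E k \<in> hom X F" if "reduced_word A B k" for k
    using that E_mult by (auto simp: hom_def)
  have E_inj: "inj_on (E k) (carrier X)" if "reduced_word A B k" for k
    using that f(2) by (auto simp: inj_on_def E_def FP.m_assoc)
  have same: "isl (hd (E k x)) = isl (last (E k x))" if "reduced_word A B k" "x \<in> carrier X" "E k x \<noteq> []" for k x
    using no_hyp[OF E_hom E_inj] that by blast
  \<comment> \<open>Conjugation by the first letter removes it and moves it to the end, where it
    cancels or merges with the last letter.\<close>
  have shift: "\<exists>z'. E (k \<otimes>\<^bsub>F\<^esub> [y]) x = w @ z' \<and> (z' = [] \<or> (\<exists>c. z' = [c] \<and> isl c = isl y))"
    if "reduced_word A B k" "x \<in> carrier X" "E k x = y # w @ [z]" "isl z = isl y" for k x y z w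
  proof -
    have red: "reduced_word A B (y # w @ [z])"
      using that by (metis E_red)
    then have l: "letter A B y" "letter A B z" "reduced_word A B w" "w = [] \<or> isl (last w) \<noteq> isl z"
      "reduced_word A B [y]" "reduced_word A B [z]" "reduced_word A B (w @ [z])"
      by (auto simp: reduced_word_Cons reduced_append)
    have yw: "y # w @ [z] = [y] \<otimes>\<^bsub>F\<^esub> (w @ [z])"
      using mult_append[of "[y]" "w @ [z]"] red by simp
    have wz: "w @ [z] = w \<otimes>\<^bsub>F\<^esub> [z]"
      using l by (simp add: mult_append)
    have "E (k \<otimes>\<^bsub>F\<^esub> [y]) x = inv\<^bsub>F\<^esub> [y] \<otimes>\<^bsub>F\<^esub> ([y] \<otimes>\<^bsub>F\<^esub> (w @ [z])) \<otimes>\<^bsub>F\<^esub> [y]"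
      using E_conj[of k "[y]" x] that(1-3) yw l by simp
    also have "\<dots> = (w @ [z]) \<otimes>\<^bsub>F\<^esub> [y]"
      using l FP.m_assoc[of "inv\<^bsub>F\<^esub> [y]" "[y]" "w @ [z]"] by simp
    also have "\<dots> = w \<otimes>\<^bsub>F\<^esub> ([z] \<otimes>\<^bsub>F\<^esub> [y])"
      unfolding wz using l FP.m_assoc[of w "[z]" "[y]"] by simp
    finally have E: "E (k \<otimes>\<^bsub>F\<^esub> [y]) x = w \<otimes>\<^bsub>F\<^esub> ([z] \<otimes>\<^bsub>F\<^esub> [y])" .
    show ?thesis
      using l(2,1) that(4)
    proof (cases rule: mult_singletons)
      case 1
      then show ?thesis using E l by simp
    next
      case (2 c)
      then have "w \<otimes>\<^bsub>F\<^esub> [c] = w @ [c]"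
        using l that(4) by (intro mult_append) (auto simp: reduced_append reduced_word_Cons)
      then show ?thesis using E 2 by auto
    qed
  qed
  have split: "\<exists>y w z. u = y # w @ [z]" if "u \<noteq> []" "tl u \<noteq> []" for u :: "('a + 'b) list"
    using that by (metis append_butlast_last_id list.collapse)
  obtain x1 where x1: "x1 \<in> carrier X" "f x1 \<noteq> []"
  proof -
    have "\<exists>x\<in>carrier X. x \<noteq> \<one>\<^bsub>X\<^esub>"
      using X by (auto simp: freely_indecomposable_def trivial_group_def)
    then show ?thesis
      using that f(2) f.hom_one by (metis X.one_closed inj_onD one_FP)
  qed
  let ?P = "\<lambda>(k, x). reduced_word A B k \<and> x \<in> carrier X \<and> E k x \<noteq> []"
  have "?P ([], x1)"
    using x1 by (simp add: E_def)
  then obtain kx where kx: "?P kx" "\<And>kx'. ?P kx' \<Longrightarrow> length (case kx of (k, x) \<Rightarrow> E k x) \<le> length (case kx' of (k, x) \<Rightarrow> E k x)"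
    using ex_has_least_nat[of ?P "([], x1)" "\<lambda>kx. length (case kx of (k, x) \<Rightarrow> E k x)"] by blast
  obtain k x where kx_eq: "kx = (k, x)" by fastforce
  have k: "reduced_word A B k" and x: "x \<in> carrier X" "E k x \<noteq> []"
    and least: "\<And>k' x'. \<lbrakk>reduced_word A B k'; x' \<in> carrier X; E k' x' \<noteq> []\<rbrakk> \<Longrightarrow> length (E k x) \<le> length (E k' x')"
    using kx unfolding kx_eq by auto
  \<comment> \<open>A longer word would have both ends in one factor, and \<open>shift\<close> would
    make it shorter without making it trivial.\<close>
  have "tl (E k x) = []"
  proof (rule ccontr)
    assume "tl (E k x) \<noteq> []"
    then obtain y w z where e: "E k x = y # w @ [z]"
      using split x(2) by blast
    have yz: "isl z = isl y"
      using same[OF k x] e by simp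
    have red: "reduced_word A B (y # w @ [z])"
      using e k x by (metis E_red)
    then have "w \<noteq> []" "letter A B y"
      using yz by (auto simp: reduced_word_Cons)
    moreover obtain z' where "E (k \<otimes>\<^bsub>F\<^esub> [y]) x = w @ z'" "length z' \<le> 1"
      using shift[OF k x(1) e yz] by auto
    ultimately show False
      using least[of "k \<otimes>\<^bsub>F\<^esub> [y]" x] k x e by (simp add: reduced_word_Cons)
  qed
  then obtain e where e: "E k x = [e]"
    using x(2) by (cases "E k x") auto
  then have le: "letter A B e"
    using E_red[OF k x(1)] by (simp add: reduced_word_Cons)
  show ?thesis
  proof (rule that[OF k])
    fix x' assume x': "x' \<in> carrier X"
    show "inv\<^bsub>F\<^esub> k \<otimes>\<^bsub>F\<^esub> f x' \<otimes>\<^bsub>F\<^esub> k \<in> factor (isl e)"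
    proof (rule ccontr)
      assume "\<not> ?thesis"
      then have nf: "E k x' \<notin> factor (isl e)" by (simp add: E_def)
      then have ne: "E k x' \<noteq> []" by (auto simp: factor_def)
      have red: "reduced_word A B (E k x')" using k x' by simp
      note sm = same[OF k x' ne]
      show False
      proof (cases "isl (hd (E k x')) = isl e")
        \<comment> \<open>Prefixing \<open>e\<close> to a word with both ends in the other factor
          gives a word with ends in different factors.\<close>
        case False
        then have "[e] \<otimes>\<^bsub>F\<^esub> E k x' = e # E k x'"
          using red ne le by (simp add: mult_append[of "[e]", simplified] reduced_word_Cons)
        then have "E k (x \<otimes>\<^bsub>X\<^esub> x') = e # E k x'"
          using E_mult[OF k x(1) x'] e by simp
        then show False
          using same[OF k, of "x \<otimes>\<^bsub>X\<^esub> x'"] x(1) x' ne False sm by simp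
      next
        case True
        have "tl (E k x') \<noteq> []"
        proof
          assume "tl (E k x') = []"
          then obtain c where "E k x' = [c]" using ne by (cases "E k x'") auto
          then show False using nf red True by (auto simp: factor_def reduced_word_Cons)
        qed
        then obtain y w z where yz: "E k x' = y # w @ [z]"
          using split ne by blast
        then have zy: "isl z = isl y" and ye: "isl y = isl e"
          using sm True by simp_all
        have red': "reduced_word A B (y # w @ [z])" using yz red by simp
        then have "w \<noteq> []"
          using zy by (auto simp: reduced_word_Cons)
        with red' have w: "w \<noteq> []" "letter A B y" "isl (hd w) \<noteq> isl y" "isl (last w) \<noteq> isl z" "reduced_word A B w"
          by (simp_all add: reduced_word_Cons reduced_append)
        \<comment> \<open>Conjugating by the first letter \<open>y\<close> keeps \<open>e\<close> in
          its factor, but strips the other word down to \<open>w\<close> with both ends in the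
          opposite factor. This leads back to the previous case.\<close>
        define k' where "k' = k \<otimes>\<^bsub>F\<^esub> [y]"
        have k': "reduced_word A B k'" using k w by (simp add: k'_def reduced_word_Cons)
        obtain z' where z': "E k' x' = w @ z'" "z' = [] \<or> (\<exists>c. z' = [c] \<and> isl c = isl y)"
          using shift[OF k x' yz zy] by (auto simp: k'_def)
        have "z' = []"
          using same[OF k' x'] z' w by auto
        then have E2: "E k' x' = w" using z' by simp
        have yF: "[y] \<in> factor (isl e)" "[e] \<in> factor (isl e)"
          using w le ye by (auto simp: factor_def)
        have "E k' x = inv\<^bsub>F\<^esub> [y] \<otimes>\<^bsub>F\<^esub> [e] \<otimes>\<^bsub>F\<^esub> [y]"
          using E_conj[OF k _ x(1), of "[y]"] w e by (simp add: k'_def reduced_word_Cons)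
        then have "E k' x \<in> factor (isl e)"
          using yF factor_mult factor_inv by simp
        moreover have "E k' x \<noteq> []"
        proof
          assume "E k' x = []"
          moreover have "E k' \<one>\<^bsub>X\<^esub> = []" using k' by (simp add: E_def)
          ultimately have "x = \<one>\<^bsub>X\<^esub>"
            using E_inj[OF k'] x(1) by (metis X.one_closed inj_onD)
          then show False using x(2) k by (simp add: E_def)
        qed
        ultimately obtain c where c: "E k' x = [c]" "letter A B c" "isl c = isl e"
          by (auto simp: factor_def)
        then have "[c] \<otimes>\<^bsub>F\<^esub> w = c # w"
          using w ye by (simp add: mult_append[of "[c]", simplified] reduced_word_Cons)
        then have "E k' (x \<otimes>\<^bsub>X\<^esub> x') = c # w"
          using E_mult[OF k' x(1) x'] c E2 by simp
        then show False
          using same[OF k', of "x \<otimes>\<^bsub>X\<^esub> x'"] x(1) x' w c zy ye by simp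
      qed
    qed
  qed
qed

end

section \<open>Quasimorphisms counting patterns\<close>

context group_pair begin

text \<open>A product deletes a block \<open>y\<close> against its inverse and then merges at most
  one pair of letters. Hence the three words involved differ at a bounded number of places only,
  whatever the length of \<open>y\<close>.\<close>

lemma mult_cancellation:
  assumes "reduced_word A B u" "reduced_word A B w"
  obtains u0 y w0 where "u = u0 @ y" "w = rev (map (letter_inv A B) y) @ w0" "u \<otimes>\<^bsub>F\<^esub> w = u0 @ w0"
  | u0 x x' z y w0 where "u = u0 @ [x] @ y" "w = rev (map (letter_inv A B) y) @ [x'] @ w0"
      "u \<otimes>\<^bsub>F\<^esub> w = u0 @ [z] @ w0" "letter A B x" "letter A B x'" "letter A B z"
proof -
  have "(\<exists>u0 y w0. u = u0 @ y \<and> w = rev (map (letter_inv A B) y) @ w0 \<and> u \<otimes>\<^bsub>F\<^esub> w = u0 @ w0) \<or>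
    (\<exists>u0 x x' z y w0. u = u0 @ [x] @ y \<and> w = rev (map (letter_inv A B) y) @ [x'] @ w0 \<and>
      u \<otimes>\<^bsub>F\<^esub> w = u0 @ [z] @ w0 \<and> letter A B x \<and> letter A B x' \<and> letter A B z)"
    using assms
  proof (induction u arbitrary: w rule: rev_induct)
    case Nil
    show ?case by (rule disjI1, intro exI[of _ "[]"] exI[of _ w]) simp
  next
    case (snoc x u)
    have u: "reduced_word A B u" and x: "letter A B x" and ux: "u = [] \<or> isl (last u) \<noteq> isl x"
      using snoc.prems by (auto simp: reduced_append reduced_word_Cons)
    have *: "(u @ [x]) \<otimes>\<^bsub>F\<^esub> w = u \<otimes>\<^bsub>F\<^esub> push_letter A B x w"
      by (simp add: free_product_def)
    show ?case
      using x snoc.prems(2)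
    proof (cases rule: push_letter_cases)
      case 1
      have "reduced_word A B (u @ (x # w))"
        using u x ux snoc.prems(2) 1 by (auto simp: reduced_append reduced_word_Cons)
      then have "u \<otimes>\<^bsub>F\<^esub> (x # w) = u @ x # w"
        by (rule mult_append)
      then show ?thesis
        using 1 * by (intro disjI1 exI[of _ "u @ [x]"] exI[of _ "[]"] exI[of _ w]) simp
    next
      case (2 v)
      then have "reduced_word A B v"
        using snoc.prems(2) by (simp add: reduced_word_Cons)
      from snoc.IH[OF u this] show ?thesis
      proof (elim disjE exE conjE)
        fix u0 y w0 assume "u = u0 @ y" "v = rev (map (letter_inv A B) y) @ w0" "u \<otimes>\<^bsub>F\<^esub> v = u0 @ w0"
        then show ?thesis
          using 2 * by (intro disjI1 exI[of _ u0] exI[of _ "y @ [x]"] exI[of _ w0]) simp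
      next
        fix u0 c c' z y w0
        assume "u = u0 @ [c] @ y" "v = rev (map (letter_inv A B) y) @ [c'] @ w0" "u \<otimes>\<^bsub>F\<^esub> v = u0 @ [z] @ w0"
          "letter A B c" "letter A B c'" "letter A B z"
        then show ?thesis
          using 2 * by (intro disjI2 exI[of _ u0] exI[of _ c] exI[of _ c'] exI[of _ z] exI[of _ "y @ [x]"] exI[of _ w0]) simp
      qed
    next
      case (3 c z v)
      have "reduced_word A B (u @ (z # v))"
        using u x ux snoc.prems(2) 3 by (auto simp: reduced_append reduced_word_Cons)
      then have "u \<otimes>\<^bsub>F\<^esub> (z # v) = u @ z # v"
        by (rule mult_append)
      then show ?thesis
        using 3 * x snoc.prems(2)
        by (intro disjI2 exI[of _ u] exI[of _ x] exI[of _ c] exI[of _ z] exI[of _ "[]"] exI[of _ v])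
          (simp add: reduced_word_Cons)
    qed
  qed
  then show ?thesis using that by blast
qed

lemma cyclically_reduced_pow:
  assumes "reduced_word A B g" "g \<noteq> []" "isl (last g) \<noteq> isl (hd g)"
  shows "g [^]\<^bsub>F\<^esub> n = concat (replicate n g)"
proof -
  have "reduced_word A B (concat (replicate n g)) \<and> (n > 0 \<longrightarrow> isl (hd (concat (replicate n g))) = isl (hd g))" for n
    using assms by (induction n) (auto simp: reduced_append)
  then have red: "reduced_word A B (g @ concat (replicate n g))" for n
    using assms by (cases n) (auto simp: reduced_append)
  show ?thesis
  proof (induction n)
    case (Suc n)
    have "g [^]\<^bsub>F\<^esub> Suc n = g \<otimes>\<^bsub>F\<^esub> g [^]\<^bsub>F\<^esub> n"
      using FP.nat_pow_Suc2[of g n] assms(1) by simp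
    then show ?case
      using mult_append[OF red[of n]] Suc.IH by simp
  qed simp
qed

lemma generate_letters: "generate F {[x] |x. letter A B x} = carrier F"
proof
  show "generate F {[x] |x. letter A B x} \<subseteq> carrier F"
    by (intro FP.generate_incl) (auto simp: reduced_word_Cons)
  have "w \<in> generate F {[x] |x. letter A B x}" if "reduced_word A B w" for w
    using that
  proof (induction w)
    case Nil
    show ?case using generate.one[of F] by simp
  next
    case (Cons x w)
    then have "[x] \<otimes>\<^bsub>F\<^esub> w = x # w"
      using mult_append[of "[x]" w] by simp
    moreover have "[x] \<in> generate F {[x] |x. letter A B x}"
      using Cons.prems by (auto simp: reduced_word_Cons intro!: generate.incl)
    ultimately show ?case
      using Cons generate.eng[of "[x]" F _ w] by (auto simp: reduced_word_Cons)
  qed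
  then show "carrier F \<subseteq> generate F {[x] |x. letter A B x}" by auto
qed

end

text \<open>A letter \<open>x\<close> is spelt as \<open>m x\<close> copies of \<open>l x\<close>; inversion of letters acts on the spelling by \<open>j\<close>.\<close>

locale spelling = group_pair A B
  for A :: "('a, 'm) monoid_scheme" and B :: "('b, 'n) monoid_scheme" +
  fixes m :: "'a + 'b \<Rightarrow> nat" and l :: "'a + 'b \<Rightarrow> 'c" and j :: "'c \<Rightarrow> 'c"
  assumes m_letter_inv: "letter A B x \<Longrightarrow> m (letter_inv A B x) = m x"
    and l_letter_inv: "letter A B x \<Longrightarrow> m x \<noteq> 0 \<Longrightarrow> l (letter_inv A B x) = j (l x)"
    and inj_j: "inj_on j (l ` {x. letter A B x \<and> m x \<noteq> 0})"
begin

definition spell :: "('a + 'b) list \<Rightarrow> 'c list" where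
  "spell w = concat (map (\<lambda>x. replicate (m x) (l x)) w)"

definition qm :: "('a + 'b) list \<Rightarrow> real" where
  "qm w = of_int (chirality (spell w))"

lemma spell_simps [simp]: "spell [] = []" "spell (x # w) = replicate (m x) (l x) @ spell w"
  "spell (u @ w) = spell u @ spell w"
  by (simp_all add: spell_def)

lemma qm_Nil [simp]: "qm [] = 0"
  by (simp add: qm_def chirality_short)

lemma qm_singleton [simp]: "qm [x] = 0"
  by (simp add: qm_def chirality_replicate)

lemma qm_factor: "w \<in> factor s \<Longrightarrow> qm w = 0"
  by (auto simp: factor_def)

lemma qm_append: "\<bar>qm (u @ w) - qm u - qm w\<bar> \<le> 4"
  using chirality_append[of "spell u" "spell w"] unfolding qm_def spell_simps
  by (metis of_int_abs of_int_diff of_int_le_iff of_int_numeral)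

lemma spell_set: "reduced_word A B w \<Longrightarrow> set (spell w) \<subseteq> l ` {x. letter A B x \<and> m x \<noteq> 0}"
  by (induction w) (auto simp: reduced_word_Cons)

lemma spell_map_letter_inv: "reduced_word A B w \<Longrightarrow> spell (map (letter_inv A B) w) = map j (spell w)"
proof (induction w)
  case (Cons x w)
  then show ?case
    by (cases "m x = 0") (auto simp: reduced_word_Cons m_letter_inv l_letter_inv map_replicate)
qed simp

text \<open>Inverting all letters renames the symbols by \<open>j\<close>, which is injective on
  those that occur, and the chirality sees only which symbols agree.\<close>

lemma qm_map_letter_inv: "reduced_word A B w \<Longrightarrow> qm (map (letter_inv A B) w) = qm w"
  using chirality_map[OF inj_on_subset[OF inj_j spell_set], of w]
  by (simp add: qm_def spell_map_letter_inv)

lemma spell_rev: "spell (rev w) = rev (spell w)"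
  by (induction w) auto

lemma qm_rev: "qm (rev w) = - qm w"
  by (simp add: qm_def spell_rev chirality_rev)

lemma qm_rev_map_letter_inv: "reduced_word A B w \<Longrightarrow> qm (rev (map (letter_inv A B) w)) = - qm w"
  by (simp add: qm_rev qm_map_letter_inv)

lemma qm_inv: "reduced_word A B w \<Longrightarrow> qm (inv\<^bsub>F\<^esub> w) = - qm w"
  by (simp add: inv_word qm_rev_map_letter_inv)

text \<open>The contributions of the cancelled block and its inverse add up to zero, and single
  letters contribute nothing. When two letters merge there are six concatenations, each costing 4,
  which gives 24.\<close>

lemma qm_mult:
  assumes "reduced_word A B u" "reduced_word A B w"
  shows "\<bar>qm (u \<otimes>\<^bsub>F\<^esub> w) - qm u - qm w\<bar> \<le> 24"
  using assms
proof (cases rule: mult_cancellation)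
  case (1 u0 y w0)
  then have "reduced_word A B y"
    using assms by (simp add: reduced_append)
  then show ?thesis
    using 1 qm_append[of u0 y] qm_append[of "rev (map (letter_inv A B) y)" w0] qm_append[of u0 w0]
      qm_rev_map_letter_inv[of y] by simp
next
  case (2 u0 x x' z y w0)
  then have "reduced_word A B y"
    using assms by (simp add: reduced_append reduced_word_Cons)
  then show ?thesis
    using 2 qm_append[of u0 "[x] @ y"] qm_append[of "[x]" y]
      qm_append[of "rev (map (letter_inv A B) y)" "[x'] @ w0"] qm_append[of "[x']" w0]
      qm_append[of u0 "[z] @ w0"] qm_append[of "[z]" w0]
      qm_rev_map_letter_inv[of y] unfolding qm_singleton by simp
qed

text \<open>Two products at a cost of 24 each; the values at \<open>k\<close> and its inverse
  cancel.\<close>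

lemma qm_conj:
  assumes "reduced_word A B k" "reduced_word A B g"
  shows "\<bar>qm g\<bar> \<le> \<bar>qm (inv\<^bsub>F\<^esub> k \<otimes>\<^bsub>F\<^esub> g \<otimes>\<^bsub>F\<^esub> k)\<bar> + 48"
  using assms qm_mult[of "inv\<^bsub>F\<^esub> k \<otimes>\<^bsub>F\<^esub> g" k] qm_mult[of "inv\<^bsub>F\<^esub> k" g] qm_inv[of k] by simp

lemma qm_power:
  assumes "reduced_word A B g" "g \<noteq> []" "isl (last g) \<noteq> isl (hd g)"
    and "spell g = [c, d, c, c, d, d, d]" "c \<noteq> d"
  shows "qm (g [^]\<^bsub>F\<^esub> (n::nat)) \<ge> real n - 1"
proof -
  have "spell (concat (replicate n g)) = concat (replicate n (spell g))" for n
    by (induction n) auto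
  then show ?thesis
    using chirality_chiral_power[OF assms(5), of n] assms
    by (simp add: qm_def cyclically_reduced_pow del: spell_simps(2,3))
qed

lemma admits_norm_if_qm_bounded:
  assumes "reduced_word A B g" "g \<noteq> []" "isl (last g) \<noteq> isl (hd g)"
    and "spell g = [c, d, c, c, d, d, d]" "c \<noteq> d"
    and S: "generate F S = carrier F" "S \<subseteq> carrier F"
    and bounded: "\<And>g. g \<in> S \<Longrightarrow> \<exists>C. \<forall>\<phi>\<in>auto F. \<bar>qm (\<phi> g)\<bar> \<le> C"
  shows "admits_norm F"
proof (rule FP.admits_norm_if_bounded_orbits[OF _ _ S bounded])
  show "\<exists>g\<in>carrier F. \<forall>n. qm (g [^]\<^bsub>F\<^esub> (n::nat)) \<ge> real n - 1"
    using qm_power[OF assms(1-5)] assms(1) by (intro bexI[of _ g]) simp_all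
qed (use qm_mult qm_inv in auto)

end

section \<open>Generation by a factor and one further element\<close>

lemma (in group) conj_nat_pow:
  assumes "g \<in> carrier G" "v \<in> carrier G"
  shows "(g \<otimes> v \<otimes> inv g) [^] (n::nat) = g \<otimes> v [^] n \<otimes> inv g"
proof (induction n)
  case (Suc n)
  have "inv g \<otimes> (g \<otimes> (v \<otimes> inv g)) = v \<otimes> inv g"
    using assms m_assoc[of "inv g" g "v \<otimes> inv g"] by simp
  then show ?case
    using Suc assms by (simp add: m_assoc)
qed (use assms in simp)

context group_pair begin

lemma split_same_ends:
  assumes "reduced_word A B u" "isl (last u) = isl (hd u)" "tl u \<noteq> []"
  obtains y w z where "u = y # w @ [z]" "w \<noteq> []" "isl z = isl y" "isl (hd w) \<noteq> isl y" "isl (last w) \<noteq> isl y"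
    "letter A B y" "letter A B z" "reduced_word A B w"
proof -
  obtain y w z where u: "u = y # w @ [z]"
    using assms(3) by (metis append_butlast_last_id list.collapse tl_Nil)
  then have "isl z = isl y" using assms by simp
  then have "w \<noteq> []" using assms(1) u by (auto simp: reduced_word_Cons)
  then show ?thesis
    using that[OF u] assms(1) u \<open>isl z = isl y\<close> by (simp add: reduced_word_Cons reduced_append)
qed

text \<open>Write \<open>u\<close> as \<open>y w z\<close>, the conjugate by \<open>y\<close> of
  \<open>v = w (z y)\<close>. If \<open>z y\<close> is trivial, then \<open>v = w\<close> is shorter
  and induction applies. Otherwise \<open>v\<close> is cyclically reduced, its powers are plain
  concatenations, and undoing the conjugation restores \<open>y\<close> in front and
  \<open>z\<close> at the end.\<close>

lemma nat_pow_same_ends: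
  assumes "reduced_word A B u" "u \<noteq> []" "isl (last u) = isl (hd u)" "u [^]\<^bsub>F\<^esub> (n::nat) \<noteq> []"
  shows "isl (hd (u [^]\<^bsub>F\<^esub> n)) = isl (hd u) \<and> isl (last (u [^]\<^bsub>F\<^esub> n)) = isl (hd u) \<and>
    (tl u \<noteq> [] \<longrightarrow> tl (u [^]\<^bsub>F\<^esub> n) \<noteq> [])"
  using assms
proof (induction "length u" arbitrary: u rule: less_induct)
  case less
  note u = less.prems
  show ?case
  proof (cases "tl u = []")
    case True
    then have "u \<in> factor (isl (hd u))"
      using u by (cases u) (auto simp: factor_def reduced_word_Cons)
    then have "u [^]\<^bsub>F\<^esub> n \<in> factor (isl (hd u))"
    proof (induction n)
      case (Suc n)
      then show ?case using factor_mult by simp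
    qed (simp add: factor_def)
    then show ?thesis
      using u True by (auto simp: factor_def)
  next
    case False
    then obtain y w z where yz: "u = y # w @ [z]" "w \<noteq> []" "isl z = isl y" "isl (hd w) \<noteq> isl y"
      "isl (last w) \<noteq> isl y" "letter A B y" "letter A B z" "reduced_word A B w"
      using split_same_ends u by blast
    have red: "reduced_word A B [y]" "reduced_word A B [z]" "reduced_word A B (w @ [z])" "reduced_word A B (y # w)"
      using yz by (auto simp: reduced_append reduced_word_Cons)
    have u_eq: "u = [y] \<otimes>\<^bsub>F\<^esub> (w \<otimes>\<^bsub>F\<^esub> [z])"
      using mult_append[of "[y]" "w @ [z]"] mult_append[of w "[z]"] u(1) red yz by simp
    define v where "v = w \<otimes>\<^bsub>F\<^esub> ([z] \<otimes>\<^bsub>F\<^esub> [y])"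
    have v: "reduced_word A B v" using red yz by (simp add: v_def)
    have "u = [y] \<otimes>\<^bsub>F\<^esub> v \<otimes>\<^bsub>F\<^esub> inv\<^bsub>F\<^esub> [y]"
      using u_eq red yz by (simp add: v_def FP.m_assoc)
    then have pow: "u [^]\<^bsub>F\<^esub> n = [y] \<otimes>\<^bsub>F\<^esub> (v [^]\<^bsub>F\<^esub> n \<otimes>\<^bsub>F\<^esub> inv\<^bsub>F\<^esub> [y])"
      using FP.conj_nat_pow[of "[y]" v n] red v FP.nat_pow_closed[of v n] by (simp add: FP.m_assoc)
    have "\<exists>w'. w' \<noteq> [] \<and> reduced_word A B w' \<and> isl (hd w') \<noteq> isl y \<and> isl (last w') \<noteq> isl y \<and>
      v [^]\<^bsub>F\<^esub> n \<otimes>\<^bsub>F\<^esub> inv\<^bsub>F\<^esub> [y] = w' \<otimes>\<^bsub>F\<^esub> [z]"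
      using yz(7,6,3)
    proof (cases rule: mult_singletons)
      case 1
      then have "v = w" using yz by (simp add: v_def)
      moreover have "inv\<^bsub>F\<^esub> [y] = [z]"
        using 1 red FP.inv_equality[of "[z]" "[y]"] by simp
      moreover have ne: "w [^]\<^bsub>F\<^esub> n \<noteq> []"
      proof
        assume "w [^]\<^bsub>F\<^esub> n = []"
        then show False
          using u(4) pow \<open>v = w\<close> red FP.r_inv[of "[y]"] by simp
      qed
      ultimately show ?thesis
        using less.hyps[of w] yz FP.nat_pow_closed[of w n] by (intro exI[of _ "w [^]\<^bsub>F\<^esub> n"]) auto
    next
      case (2 c)
      have n: "n > 0" using u(4) by (cases n) auto
      have wc: "reduced_word A B (w @ [c])"
        using yz 2 by (auto simp: reduced_append reduced_word_Cons)
      then have v_eq: "v = w @ [c]"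
        using 2 by (simp add: v_def mult_append)
      have "v [^]\<^bsub>F\<^esub> n = concat (replicate n v)"
        using v_eq yz 2 wc by (intro cyclically_reduced_pow) auto
      also have "\<dots> = concat (replicate (n - 1) v) @ v"
        using n by (metis Suc_diff_1 concat_append concat.simps replicate_append_same append_Nil2 replicate_Suc concat_replicate_trivial)
      finally have vn: "v [^]\<^bsub>F\<^esub> n = (concat (replicate (n - 1) v) @ w) @ [c]" (is "_ = ?w @ _")
        using v_eq by simp
      have wr: "reduced_word A B (?w @ [c])"
        using vn FP.nat_pow_closed[of v n] v by simp
      \<comment> \<open>\<open>c\<close> is the product of \<open>z\<close> and \<open>y\<close>, so
        the conjugation turns the last letter back into \<open>z\<close>.\<close>
      have "[c] \<otimes>\<^bsub>F\<^esub> inv\<^bsub>F\<^esub> [y] = [z]"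
        using 2(1) red FP.inv_solve_right'[of "[z]" "[c]" "[y]"] 2 by (simp add: reduced_word_Cons)
      moreover have w'_red: "?w @ [c] = ?w \<otimes>\<^bsub>F\<^esub> [c]" "reduced_word A B [c]" "reduced_word A B ?w"
        using mult_append[OF wr] wr[unfolded reduced_append[of ?w "[c]"]] by simp_all
      ultimately have "v [^]\<^bsub>F\<^esub> n \<otimes>\<^bsub>F\<^esub> inv\<^bsub>F\<^esub> [y] = ?w \<otimes>\<^bsub>F\<^esub> [z]"
        using vn FP.m_assoc[of ?w "[c]" "inv\<^bsub>F\<^esub> [y]"] red by simp
      moreover have "isl (hd ?w) = isl (hd w)"
        using yz v_eq by (cases "n - 1") (auto simp: hd_append)
      ultimately show ?thesis
        using yz w'_red(3) by (intro exI[of _ ?w]) simp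
    qed
    then obtain w' where w': "w' \<noteq> []" "reduced_word A B w'" "isl (hd w') \<noteq> isl y" "isl (last w') \<noteq> isl y"
      "v [^]\<^bsub>F\<^esub> n \<otimes>\<^bsub>F\<^esub> inv\<^bsub>F\<^esub> [y] = w' \<otimes>\<^bsub>F\<^esub> [z]"
      by blast
    then have "reduced_word A B ([y] @ (w' @ [z]))"
      using yz by (auto simp: reduced_append reduced_word_Cons)
    then have "u [^]\<^bsub>F\<^esub> n = y # w' @ [z]"
      using pow w'(5) mult_append[of "[y]" "w' @ [z]"] mult_append[of w' "[z]"] by (simp add: reduced_word_Cons)
    then show ?thesis
      using yz w'(1) by simp
  qed
qed

lemma int_pow_same_ends:
  assumes "reduced_word A B u" "u \<noteq> []" "isl (last u) = isl (hd u)" "tl u \<noteq> []" "u [^]\<^bsub>F\<^esub> (n::int) \<noteq> []"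
  shows "isl (hd (u [^]\<^bsub>F\<^esub> n)) = isl (hd u)" "isl (last (u [^]\<^bsub>F\<^esub> n)) = isl (hd u)" "tl (u [^]\<^bsub>F\<^esub> n) \<noteq> []"
proof -
  have "isl (hd (u [^]\<^bsub>F\<^esub> n)) = isl (hd u) \<and> isl (last (u [^]\<^bsub>F\<^esub> n)) = isl (hd u) \<and> tl (u [^]\<^bsub>F\<^esub> n) \<noteq> []"
  proof (cases n rule: int_cases2)
    case (nonneg k)
    then show ?thesis
      using nat_pow_same_ends[OF assms(1-3), of k] assms(4,5) by (simp add: int_pow_int)
  next
    case (nonpos k)
    then have inv: "u [^]\<^bsub>F\<^esub> n = inv\<^bsub>F\<^esub> (u [^]\<^bsub>F\<^esub> k)"
      using FP.int_pow_neg_int[of u k] assms(1) by simp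
    have red: "reduced_word A B (u [^]\<^bsub>F\<^esub> k)"
      using FP.nat_pow_closed[of u k] assms(1) by simp
    then have ne: "u [^]\<^bsub>F\<^esub> k \<noteq> []"
      using inv assms(5) by auto
    have "length (inv\<^bsub>F\<^esub> (u [^]\<^bsub>F\<^esub> k)) = length (u [^]\<^bsub>F\<^esub> k)"
      using red by (simp add: inv_word)
    then have "tl (inv\<^bsub>F\<^esub> (u [^]\<^bsub>F\<^esub> k)) \<noteq> [] \<longleftrightarrow> tl (u [^]\<^bsub>F\<^esub> k) \<noteq> []"
      by (metis length_tl length_0_conv)
    then show ?thesis
      using nat_pow_same_ends[OF assms(1-3) ne] assms(4) inv red ne
      by (simp add: isl_hd_inv isl_last_inv)
  qed
  then show "isl (hd (u [^]\<^bsub>F\<^esub> n)) = isl (hd u)" "isl (last (u [^]\<^bsub>F\<^esub> n)) = isl (hd u)" "tl (u [^]\<^bsub>F\<^esub> n) \<noteq> []"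
    by auto
qed

inductive_set interleaved :: "bool \<Rightarrow> ('a + 'b) list set \<Rightarrow> ('a + 'b) list set"
  for s :: bool and L :: "('a + 'b) list set" where
  Nil: "[] \<in> interleaved s L"
| letter: "g \<in> interleaved s L \<Longrightarrow> g = [] \<or> isl (hd g) \<noteq> s \<Longrightarrow> letter A B x \<Longrightarrow> isl x = s \<Longrightarrow> x # g \<in> interleaved s L"
| block: "g \<in> interleaved s L \<Longrightarrow> g = [] \<or> isl (hd g) = s \<Longrightarrow> y \<in> L \<Longrightarrow> y \<noteq> [] \<Longrightarrow> y @ g \<in> interleaved s L"

text \<open>Non-trivial blocks from \<open>L\<close> begin and end outside factor \<open>s\<close>,
  so a letter never interacts with a block. Multiplying by a generator on the left merges two
  neighbouring letters or two neighbouring blocks and keeps the alternating shape.\<close>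

lemma generate_factor_interleaved:
  assumes L: "subgroup L F"
    and ends: "\<And>y. y \<in> L \<Longrightarrow> y \<noteq> [] \<Longrightarrow> isl (hd y) \<noteq> s \<and> isl (last y) \<noteq> s"
  shows "generate F (factor s \<union> L) \<subseteq> interleaved s L"
proof -
  have L_red: "reduced_word A B y" if "y \<in> L" for y
    using subgroup.subset[OF L] that by auto
  have red: "reduced_word A B g" if "g \<in> interleaved s L" for g
    using that
  proof induction
    case (block g y)
    then show ?case using L_red ends by (auto simp: reduced_append)
  qed (auto simp: reduced_word_Cons)
  have factor: "p \<otimes>\<^bsub>F\<^esub> g \<in> interleaved s L" if p: "p \<in> factor s" and g: "g \<in> interleaved s L" for p g
  proof (cases "p = []")
    case False
    then obtain c where c: "p = [c]" "letter A B c" "isl c = s"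
      using p by (auto simp: factor_def)
    have prefix: "[c] \<otimes>\<^bsub>F\<^esub> g = c # g" if "g = [] \<or> isl (hd g) \<noteq> s"
    proof -
      have "reduced_word A B ([c] @ g)"
        using c that red[OF g] by (auto simp: reduced_word_Cons)
      then show ?thesis using mult_append[of "[c]" g] by simp
    qed
    show ?thesis
      using g
    proof cases
      case Nil
      then show ?thesis using c prefix interleaved.letter[OF interleaved.Nil, of s c] by simp
    next
      case (letter g' x)
      have red': "reduced_word A B [c]" "reduced_word A B [x]" "reduced_word A B g'" "g = [x] \<otimes>\<^bsub>F\<^esub> g'"
        using c letter red[OF letter(2)] red[OF g] mult_append[of "[x]" g'] by (auto simp: reduced_word_Cons)
      have eq: "[c] \<otimes>\<^bsub>F\<^esub> g = ([c] \<otimes>\<^bsub>F\<^esub> [x]) \<otimes>\<^bsub>F\<^esub> g'"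
        using red' by (simp add: FP.m_assoc)
      have "isl c = isl x" using c letter by simp
      with c(2) letter(4) show ?thesis
      proof (cases rule: mult_singletons)
        case 1
        then show ?thesis using eq c letter by simp
      next
        case (2 z)
        then have "[z] \<otimes>\<^bsub>F\<^esub> g' = z # g'"
          using red' letter mult_append[of "[z]" g'] by (auto simp: reduced_word_Cons)
        then show ?thesis
          using eq c 2 letter interleaved.letter[OF letter(2,3) 2(2)] by simp
      qed
    next
      case (block g' y)
      then show ?thesis
        using prefix c ends interleaved.letter[OF g _ c(2,3)] by simp
    qed
  qed (use g in simp)
  have block: "p \<otimes>\<^bsub>F\<^esub> g \<in> interleaved s L" if p: "p \<in> L" and g: "g \<in> interleaved s L" for p g
  proof (cases "p = []")
    case False
    have prefix: "q \<otimes>\<^bsub>F\<^esub> h = q @ h" if "q \<in> L" "q \<noteq> []" "h \<in> interleaved s L" "h = [] \<or> isl (hd h) = s" for q h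
      using that red ends L_red by (intro mult_append) (auto simp: reduced_append)
    show ?thesis
      using g
    proof cases
      case Nil
      then show ?thesis
        using interleaved.block[OF interleaved.Nil _ p False] L_red[OF p] by simp
    next
      case (letter g' x)
      then show ?thesis
        using prefix[OF p False g] interleaved.block[OF g _ p False] by simp
    next
      case (block g' y)
      have py: "p \<otimes>\<^bsub>F\<^esub> y \<in> L"
        using subgroup.m_closed[OF L p block(4)] .
      have "p \<otimes>\<^bsub>F\<^esub> g = (p \<otimes>\<^bsub>F\<^esub> y) \<otimes>\<^bsub>F\<^esub> g'"
        using prefix[OF block(4,5,2,3)] block L_red p red FP.m_assoc[of p y g'] by simp
      then show ?thesis
        using prefix[OF py _ block(2,3)] interleaved.block[OF block(2,3) py] block
        by (cases "p \<otimes>\<^bsub>F\<^esub> y = []") simp_all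
    qed
  qed (use g in simp)
  have S_red: "reduced_word A B p" if "p \<in> factor s \<union> L" for p
    using that factor_reduced L_red by blast
  have step: "p \<otimes>\<^bsub>F\<^esub> g \<in> interleaved s L" if "p \<in> factor s \<union> L" "g \<in> interleaved s L" for p g
    using that factor block by blast
  have "\<forall>h\<in>interleaved s L. g \<otimes>\<^bsub>F\<^esub> h \<in> interleaved s L" if "g \<in> generate F (factor s \<union> L)" for g
    using that
  proof induction
    case (inv h)
    then have "inv\<^bsub>F\<^esub> h \<in> factor s \<union> L"
      using factor_inv subgroup.m_inv_closed[OF L] by blast
    then show ?case using step by blast
  next
    case (eng g1 g2)
    have "reduced_word A B g1" "reduced_word A B g2"
      using eng.hyps FP.generate_in_carrier[of "factor s \<union> L"] S_red by (auto simp: subset_iff)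
    then show ?case
      using eng.IH red by (auto simp: FP.m_assoc)
  qed (use step in auto)
  moreover have "reduced_word A B g" if "g \<in> generate F (factor s \<union> L)" for g
    using that FP.generate_in_carrier[of "factor s \<union> L"] S_red by (auto simp: subset_iff)
  ultimately show ?thesis
    using interleaved.Nil mult_Nil_right by (metis subsetI)
qed

text \<open>Strip the letters of factor \<open>s\<close> from both ends of \<open>w\<close>. If the
  core \<open>u\<close> had two or more letters, then so would all its non-trivial powers, and the
  interleaved words that make up the generated group would miss every single letter of the other
  factor.\<close>

lemma generate_factor_double_coset:
  assumes w: "reduced_word A B w" and gen: "generate F (factor s \<union> {w}) = carrier F"
    and nontriv: "factor (\<not> s) \<noteq> {[]}"
  obtains p q r where "p \<in> factor s" "q \<in> factor (\<not> s)" "r \<in> factor s" "w = p \<otimes>\<^bsub>F\<^esub> q \<otimes>\<^bsub>F\<^esub> r"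
proof -
  obtain p v where p: "p \<in> factor s" "w = p @ v" "v = [] \<or> isl (hd v) \<noteq> s"
  proof (cases "w \<noteq> [] \<and> isl (hd w) = s")
    case True
    then show ?thesis
      using that[of "[hd w]" "tl w"] w by (cases w) (auto simp: factor_def reduced_word_Cons)
  next
    case False
    then show ?thesis using that[of "[]" w] by (auto simp: factor_def)
  qed
  have v: "reduced_word A B v" using w p by (simp add: reduced_append)
  obtain u r where r: "r \<in> factor s" "v = u @ r" "u = [] \<or> isl (last u) \<noteq> s"
  proof (cases "v \<noteq> [] \<and> isl (last v) = s")
    case True
    then obtain v' c where v': "v = v' @ [c]" using rev_exhaust by blast
    then show ?thesis
      using that[of "[c]" v'] v True by (auto simp: factor_def reduced_append reduced_word_Cons)
  next
    case False
    then show ?thesis using that[of "[]" v] by (auto simp: factor_def)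
  qed
  have red: "reduced_word A B p" "reduced_word A B u" "reduced_word A B r"
    using w p r factor_reduced by (auto simp: reduced_append)
  have w_eq: "w = p \<otimes>\<^bsub>F\<^esub> u \<otimes>\<^bsub>F\<^esub> r"
    using w p r v mult_append[of p v] mult_append[of u r] red by (simp add: FP.m_assoc)
  have hd_u: "isl (hd u) \<noteq> s" if "u \<noteq> []"
    using p(3) r(2) that by auto
  have "u \<in> factor (\<not> s)"
  proof (rule ccontr)
    assume nf: "u \<notin> factor (\<not> s)"
    then have ne: "u \<noteq> []" by (auto simp: factor_def)
    have "tl u \<noteq> []"
    proof
      assume "tl u = []"
      then have "u = [hd u]" using ne by (metis list.collapse)
      moreover have "letter A B (hd u)" using red(2) ne by (cases u) (auto simp: reduced_word_Cons)
      ultimately show False using nf hd_u[OF ne] by (auto simp: factor_def)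
    qed
    define L where "L = range (\<lambda>n::int. u [^]\<^bsub>F\<^esub> n)"
    have "L = generate F {u}"
      unfolding L_def using FP.generate_pow[of u] red(2) by auto
    then have L: "subgroup L F" "u \<in> L"
      using FP.generate_is_subgroup[of "{u}"] red(2) by (auto intro: generate.incl)
    have ends: "isl (hd y) \<noteq> s \<and> isl (last y) \<noteq> s \<and> tl y \<noteq> []" if "y \<in> L" "y \<noteq> []" for y
      using that int_pow_same_ends[OF red(2) ne _ \<open>tl u \<noteq> []\<close>] hd_u[OF ne] r(3) ne unfolding L_def by auto
    have sub: "factor s \<union> L \<subseteq> carrier F"
      using factor_reduced subgroup.subset[OF L(1)] by auto
    have "factor s \<union> {w} \<subseteq> generate F (factor s \<union> L)"
      using p(1) r(1) L(2) unfolding w_eq by (auto intro!: generate.eng intro: generate.incl)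
    then have "carrier F \<subseteq> generate F (factor s \<union> L)"
      using FP.generate_subgroup_incl[OF _ FP.generate_is_subgroup[OF sub]] gen by metis
    also have "\<dots> \<subseteq> interleaved s L"
      using generate_factor_interleaved[OF L(1)] ends by blast
    finally have all: "carrier F \<subseteq> interleaved s L" .
    obtain c where c: "letter A B c" "isl c = (\<not> s)"
      using nontriv by (auto simp: factor_def)
    then have "[c] \<in> carrier F"
      by (simp add: reduced_word_Cons)
    then have "[c] \<in> interleaved s L"
      using all by blast
    then show False
    proof cases
      case (block g y)
      then show False using ends[of y] by (cases y) auto
    qed (use c in auto)
  qed
  then show ?thesis
    using that p(1) r(1) w_eq by blast
qed

end

section \<open>At most one infinite cyclic factor\<close>

context group_pair begin

definition inl :: "'a \<Rightarrow> ('a + 'b) list" where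
  "inl a = (if a = \<one>\<^bsub>A\<^esub> then [] else [Inl a])"

definition inr :: "'b \<Rightarrow> ('a + 'b) list" where
  "inr b = (if b = \<one>\<^bsub>B\<^esub> then [] else [Inr b])"

lemma inl_mon: "inl \<in> mon A F"
  using free_product_factors_embed(1)[OF A.is_group B.is_group] unfolding inl_def[abs_def] .

lemma inr_mon: "inr \<in> mon B F"
  using free_product_factors_embed(2)[OF A.is_group B.is_group] unfolding inr_def[abs_def] .

lemma letter_cases:
  assumes "letter A B x"
  obtains a where "a \<in> carrier A" "[x] = inl a" | b where "b \<in> carrier B" "[x] = inr b"
  using assms by (cases x) (auto simp: inl_def inr_def)

end

context spelling begin

lemma qm_auto_bounded:
  assumes X: "freely_indecomposable X" "\<not> X \<cong> integer_group"
    and e: "e \<in> mon X F" and \<phi>: "\<phi> \<in> auto F" and x: "x \<in> carrier X"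
  shows "\<bar>qm (\<phi> (e x))\<bar> \<le> 48"
proof -
  have "\<phi> \<in> mon F F"
    using \<phi> by (auto simp: auto_def Bij_def mon_def bij_betw_def)
  then have f: "\<phi> \<circ> e \<in> mon X F"
    using e mon_compose by blast
  then obtain k s where ks: "reduced_word A B k"
    "\<And>x. x \<in> carrier X \<Longrightarrow> inv\<^bsub>F\<^esub> k \<otimes>\<^bsub>F\<^esub> (\<phi> \<circ> e) x \<otimes>\<^bsub>F\<^esub> k \<in> factor s"
    using indecomposable_conj_into_factor[OF X, of "\<phi> \<circ> e"] by (auto simp: mon_def)
  have "reduced_word A B (\<phi> (e x))"
    using f x by (auto simp: mon_def hom_def)
  then show ?thesis
    using qm_conj[OF ks(1), of "\<phi> (e x)"] qm_factor[OF ks(2)[OF x]] by simp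
qed

end

lemma admits_norm_neither_infinite_cyclic:
  fixes A :: "('a, 'm) monoid_scheme" and B :: "('b, 'n) monoid_scheme"
  assumes A: "freely_indecomposable A" "\<not> A \<cong> integer_group"
    and B: "freely_indecomposable B" "\<not> B \<cong> integer_group"
    and a: "a \<in> carrier A" "a \<noteq> \<one>\<^bsub>A\<^esub>" "a' \<in> carrier A" "a' \<noteq> \<one>\<^bsub>A\<^esub>" "a \<noteq> a'"
  shows "admits_norm (free_product A B)"
proof -
  interpret group_pair A B
    using A B by (simp add: group_pair_def freely_indecomposable_def)
  let ?m = "\<lambda>x::'a + 'b. if isl x then 1 else 0 :: nat"
  interpret spelling A B ?m projl "\<lambda>x. inv\<^bsub>A\<^esub> x"
  proof (unfold_locales, goal_cases)
    case (2 x)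
    then show ?case by (cases x) auto
  next
    case 3
    show ?case
    proof (rule inj_on_subset[of _ "carrier A"])
      show "inj_on (m_inv A) (carrier A)"
        by (metis A.inv_inv inj_onI)
      show "projl ` {x. letter A B x \<and> ?m x \<noteq> 0} \<subseteq> carrier A"
      proof
        fix y assume "y \<in> projl ` {x. letter A B x \<and> ?m x \<noteq> 0}"
        then obtain x where "y = projl x" "letter A B x" "isl x" by (auto split: if_splits)
        then show "y \<in> carrier A" by (cases x) auto
      qed
    qed
  qed simp
  obtain b where b: "b \<in> carrier B" "b \<noteq> \<one>\<^bsub>B\<^esub>"
    using B by (auto simp: freely_indecomposable_def trivial_group_def)
  \<comment> \<open>The letters from \<open>A\<close>, separated by \<open>b\<close>, spell the
    chiral word.\<close>
  let ?g = "[Inl a, Inr b, Inl a', Inr b, Inl a, Inr b, Inl a, Inr b, Inl a', Inr b, Inl a', Inr b, Inl a', Inr b]"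
  show ?thesis
  proof (rule admits_norm_if_qm_bounded[of ?g a a' "{[x] |x. letter A B x}"])
    show "reduced_word A B ?g" "spell ?g = [a, a', a, a, a', a', a']"
      using a b by (simp_all add: reduced_word_Cons)
    show "generate FP {[x] |x. letter A B x} = carrier FP"
      by (rule generate_letters)
    fix g assume "g \<in> {[x] |x. letter A B x}"
    then obtain x where x: "g = [x]" "letter A B x" by blast
    show "\<exists>C. \<forall>\<phi>\<in>auto FP. \<bar>qm (\<phi> g)\<bar> \<le> C"
      using x(2)
    proof (cases rule: letter_cases)
      case (1 a)
      then show ?thesis using qm_auto_bounded[OF A inl_mon] x by metis
    next
      case (2 b)
      then show ?thesis using qm_auto_bounded[OF B inr_mon] x by metis
    qed
  qed (use a in \<open>auto simp: reduced_word_Cons\<close>)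
qed

section \<open>Free products with the infinite cyclic group\<close>

definition multiplicity :: "int + 'b \<Rightarrow> nat" where
  "multiplicity x = (case x of Inl k \<Rightarrow> nat \<bar>k\<bar> | Inr _ \<Rightarrow> 0)"

definition positive :: "int + 'b \<Rightarrow> bool" where
  "positive x = (case x of Inl k \<Rightarrow> k > 0 | Inr _ \<Rightarrow> False)"

lemma sign_spelling:
  assumes B: "group B"
  shows "spelling integer_group B multiplicity positive Not"
proof -
  interpret group_pair integer_group B
    using B by (simp add: group_pair_def)
  show ?thesis
  proof (unfold_locales, goal_cases)
    case (1 x)
    then show ?case by (cases x) (auto simp: multiplicity_def)
  next
    case (2 x)
    then show ?case by (cases x) (auto simp: multiplicity_def positive_def)
  qed (auto simp: inj_on_def)
qed

text \<open>Keeps the generating set small: orbits then have to be bounded for a single power of the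
  infinite cyclic generator only.\<close>

lemma generate_integer_free_product:
  fixes B :: "('b, 'n) monoid_scheme"
  assumes B: "group B"
    and S: "S \<subseteq> carrier (free_product integer_group B)"
      "[Inl 1] \<in> S"
      "\<And>b. \<lbrakk>b \<in> carrier B; b \<noteq> \<one>\<^bsub>B\<^esub>\<rbrakk> \<Longrightarrow> [Inr b] \<in> generate (free_product integer_group B) S"
  shows "generate (free_product integer_group B) S = carrier (free_product integer_group B)"
proof -
  interpret group_pair integer_group B
    using B by (simp add: group_pair_def)
  have "[x] \<in> generate FP S" if "letter integer_group B x" for x
  proof (cases x)
    case (Inl k)
    interpret inl: group_hom integer_group FP inl
      using inl_mon by unfold_locales (simp add: mon_def)
    have "[Inl k] = inl (1 [^]\<^bsub>integer_group\<^esub> k)"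
      using Inl that by (simp add: inl_def)
    also have "\<dots> = [Inl 1] [^]\<^bsub>FP\<^esub> k"
      using inl.hom_int_pow[of 1 k] by (simp add: inl_def)
    finally show ?thesis
      using FP.subgroup_int_pow_closed[OF FP.generate_is_subgroup[OF S(1)] generate.incl[OF S(2)]] Inl by simp
  next
    case (Inr b)
    then show ?thesis using that S(3) by auto
  qed
  then have "generate FP {[x] |x. letter integer_group B x} \<subseteq> generate FP S"
    by (intro FP.generate_subgroup_incl FP.generate_is_subgroup S(1)) blast
  then show ?thesis
    using generate_letters FP.generate_incl[OF S(1)] by blast
qed

lemma admits_norm_integer_free_product_if_bounded:
  fixes B :: "('b, 'n) monoid_scheme"
  assumes B: "group B" "\<not> trivial_group B"
    and S: "generate (free_product integer_group B) S = carrier (free_product integer_group B)"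
      "S \<subseteq> carrier (free_product integer_group B)"
    and bounded: "\<And>g. g \<in> S \<Longrightarrow>
      \<exists>C. \<forall>\<phi>\<in>auto (free_product integer_group B). \<bar>spelling.qm multiplicity positive (\<phi> g)\<bar> \<le> C"
  shows "admits_norm (free_product integer_group B)"
proof -
  interpret spelling integer_group B multiplicity positive Not
    by (rule sign_spelling[OF B(1)])
  obtain b where b: "b \<in> carrier B" "b \<noteq> \<one>\<^bsub>B\<^esub>"
    using B by (auto simp: trivial_group_def)
  \<comment> \<open>The exponents -1, 1, -2, 3 spell the chiral word in the two signs.\<close>
  let ?g = "[Inl (-1), Inr b, Inl 1, Inr b, Inl (-2), Inr b, Inl 3, Inr b]"
  show ?thesis
  proof (rule admits_norm_if_qm_bounded[OF _ _ _ _ _ S bounded])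
    show "reduced_word integer_group B ?g"
      using b by (simp add: reduced_word_Cons)
    show "spell ?g = [False, True, False, False, True, True, True]"
      by (simp add: multiplicity_def positive_def numeral_eq_Suc)
  qed auto
qed

lemma admits_norm_one_infinite_cyclic:
  fixes B :: "('b, 'n) monoid_scheme"
  assumes B: "freely_indecomposable B" "\<not> B \<cong> integer_group"
  shows "admits_norm (free_product integer_group B)"
proof -
  have grpB: "group B" and B_nontriv: "\<not> trivial_group B"
    using B by (auto simp: freely_indecomposable_def)
  interpret spelling integer_group B multiplicity positive Not
    by (rule sign_spelling[OF grpB])
  let ?S = "insert [Inl 1] {[Inr b] |b. b \<in> carrier B \<and> b \<noteq> \<one>\<^bsub>B\<^esub>}"
  have S: "?S \<subseteq> carrier FP"
    by (auto simp: reduced_word_Cons)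
  have gen: "generate FP ?S = carrier FP"
    by (rule generate_integer_free_product[OF grpB S]) (auto intro: generate.incl)
  show ?thesis
  proof (rule admits_norm_integer_free_product_if_bounded[OF grpB B_nontriv gen S])
  fix g :: "(int + 'b) list" assume g: "g \<in> ?S"
  \<comment> \<open>It is not known which factor receives the image of \<open>B\<close>, so the
    double coset lemma has to be available for both values of \<open>s\<close>.\<close>
  have F_factors: "factor s \<noteq> {[]}" for s
  proof -
    obtain b where "b \<in> carrier B" "b \<noteq> \<one>\<^bsub>B\<^esub>"
      using grpB B_nontriv by (auto simp: trivial_group_def)
    then have "[if s then Inl 1 else Inr b] \<in> factor s"
      by (auto simp: factor_def)
    then show ?thesis by auto
  qed
  have "\<bar>qm (\<phi> g)\<bar> \<le> 96" if \<phi>: "\<phi> \<in> auto FP" for \<phi>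
  proof (cases "g = [Inl 1]")
    case False
    then obtain b where "b \<in> carrier B" "b \<noteq> \<one>\<^bsub>B\<^esub>" "g = [Inr b]"
      using g by blast
    then have "b \<in> carrier B" "g = inr b"
      by (simp_all add: inr_def)
    then show ?thesis using qm_auto_bounded[OF B inr_mon \<phi>] by force
  next
    case True
    interpret \<phi>: group_hom FP FP \<phi>
      by (rule FP.auto_group_hom[OF \<phi>])
    have \<phi>_img: "\<phi> ` carrier FP = carrier FP"
      using FP.auto_bij[OF \<phi>] by (simp add: bij_betw_def)
    have "\<phi> \<in> mon FP FP"
      using \<phi> by (auto simp: auto_def Bij_def mon_def bij_betw_def)
    then have "\<phi> \<circ> inr \<in> mon B FP"
      using inr_mon mon_compose by blast
    then obtain k s where k: "reduced_word integer_group B k"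
      and ks: "\<And>x. x \<in> carrier B \<Longrightarrow> inv\<^bsub>FP\<^esub> k \<otimes>\<^bsub>FP\<^esub> (\<phi> \<circ> inr) x \<otimes>\<^bsub>FP\<^esub> k \<in> factor s"
      using indecomposable_conj_into_factor[OF B, of "\<phi> \<circ> inr"] by (auto simp: mon_def)
    \<comment> \<open>After this conjugation the image of \<open>B\<close> lies in the factor
      itself. As \<open>\<theta>\<close> is still onto, that factor and the image of the infinite
      cyclic generator generate the group.\<close>
    define \<theta> where "\<theta> h = inv\<^bsub>FP\<^esub> k \<otimes>\<^bsub>FP\<^esub> \<phi> h \<otimes>\<^bsub>FP\<^esub> k" for h
    have \<phi>_red: "reduced_word integer_group B (\<phi> h)" if "reduced_word integer_group B h" for h
      using \<phi>.hom_closed[of h] that by simp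
    interpret \<theta>: group_hom FP FP \<theta>
    proof (unfold_locales, rule homI)
      fix x y assume xy: "x \<in> carrier FP" "y \<in> carrier FP"
      have "k \<otimes>\<^bsub>FP\<^esub> (inv\<^bsub>FP\<^esub> k \<otimes>\<^bsub>FP\<^esub> (\<phi> y \<otimes>\<^bsub>FP\<^esub> k)) = \<phi> y \<otimes>\<^bsub>FP\<^esub> k"
        using xy k \<phi>_red FP.m_assoc[of k "inv\<^bsub>FP\<^esub> k" "\<phi> y \<otimes>\<^bsub>FP\<^esub> k"] by simp
      then show "\<theta> (x \<otimes>\<^bsub>FP\<^esub> y) = \<theta> x \<otimes>\<^bsub>FP\<^esub> \<theta> y"
        using xy k \<phi>_red by (simp add: \<theta>_def FP.m_assoc \<phi>.hom_mult)
    qed (use k \<phi>_red in \<open>simp add: \<theta>_def\<close>)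
    have "carrier FP \<subseteq> \<theta> ` carrier FP"
    proof
      fix h assume h: "h \<in> carrier FP"
      then have "k \<otimes>\<^bsub>FP\<^esub> h \<otimes>\<^bsub>FP\<^esub> inv\<^bsub>FP\<^esub> k \<in> \<phi> ` carrier FP"
        using k \<phi>_img by simp
      then obtain x where x: "x \<in> carrier FP" "\<phi> x = k \<otimes>\<^bsub>FP\<^esub> h \<otimes>\<^bsub>FP\<^esub> inv\<^bsub>FP\<^esub> k"
        by (metis imageE)
      have "inv\<^bsub>FP\<^esub> k \<otimes>\<^bsub>FP\<^esub> (k \<otimes>\<^bsub>FP\<^esub> h) = h"
        using h k FP.m_assoc[of "inv\<^bsub>FP\<^esub> k" k h] by simp
      then have "\<theta> x = h"
        using x h k by (simp add: \<theta>_def FP.m_assoc)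
      then show "h \<in> \<theta> ` carrier FP" using x by blast
    qed
    then have \<theta>_img: "\<theta> ` carrier FP = carrier FP"
      using \<theta>.hom_closed by blast
    have "carrier FP = generate FP (\<theta> ` ?S)"
      using \<theta>.generate_img[OF S] \<theta>_img gen by simp
    have \<theta>_inr: "\<theta> [Inr b] \<in> factor s" if "b \<in> carrier B" "b \<noteq> \<one>\<^bsub>B\<^esub>" for b
      using ks[of b] that by (simp add: \<theta>_def inr_def)
    have "\<theta> [Inl 1] \<in> carrier FP"
      using S by (intro \<theta>.hom_closed) blast
    then have sub: "factor s \<union> {\<theta> [Inl 1]} \<subseteq> carrier FP"
      using factor_reduced by auto
    note \<open>carrier FP = generate FP (\<theta> ` ?S)\<close>
    also have "generate FP (\<theta> ` ?S) \<subseteq> generate FP (factor s \<union> {\<theta> [Inl 1]})"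
      using \<theta>_inr by (intro FP.mono_generate) auto
    finally have "generate FP (factor s \<union> {\<theta> [Inl 1]}) = carrier FP"
      using FP.generate_incl[OF sub] by blast
    then obtain p q r where pqr: "p \<in> factor s" "q \<in> factor (\<not> s)" "r \<in> factor s"
      "\<theta> [Inl 1] = p \<otimes>\<^bsub>FP\<^esub> q \<otimes>\<^bsub>FP\<^esub> r"
      using generate_factor_double_coset[OF _ _ F_factors] \<open>\<theta> [Inl 1] \<in> carrier FP\<close> by (metis carrier_FP)
    \<comment> \<open>A product of three elements on which \<open>qm\<close> vanishes costs twice
      24; undoing the conjugation costs another 48.\<close>
    have "\<bar>qm (\<theta> [Inl 1])\<bar> \<le> 48"
      using pqr factor_reduced[OF pqr(1)] factor_reduced[OF pqr(2)] factor_reduced[OF pqr(3)]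
        qm_mult[of "p \<otimes>\<^bsub>FP\<^esub> q" r] qm_mult[of p q] by (simp add: qm_factor)
    then show ?thesis
      using qm_conj[OF k, of "\<phi> [Inl 1]"] \<phi>_red[of "[Inl 1]"] True
      by (simp add: \<theta>_def reduced_word_Cons)
  qed
  then show "\<exists>C. \<forall>\<phi>\<in>auto FP. \<bar>qm (\<phi> g)\<bar> \<le> C"
    by blast
  qed
qed

section \<open>Nielsen reduction\<close>

text \<open>A free action of \<open>G\<close> on a tree with base vertex \<open>o\<close>, seen through the displacement
  \<open>L g = d(o, g o)\<close>: \<open>overlap g h\<close> is twice the length of the common initial segment of the geodesics
  from \<open>o\<close> to \<open>g o\<close> and \<open>h o\<close>, and \<open>G\<close> is transitive on vertices.\<close>

locale tree_length = group G for G (structure) +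
  fixes L :: "'a \<Rightarrow> nat"
  assumes L_one: "L \<one> = 0"
    and L_inv: "g \<in> carrier G \<Longrightarrow> L (inv g) = L g"
    and four_point: "\<lbrakk>g \<in> carrier G; h \<in> carrier G; k \<in> carrier G\<rbrakk> \<Longrightarrow>
      min (int (L g) + int (L k) - int (L (inv g \<otimes> k))) (int (L k) + int (L h) - int (L (inv k \<otimes> h)))
        \<le> int (L g) + int (L h) - int (L (inv g \<otimes> h))"
    and L_square: "\<lbrakk>g \<in> carrier G; g \<noteq> \<one>\<rbrakk> \<Longrightarrow> L g < L (g \<otimes> g)"
    and parity: "\<lbrakk>g \<in> carrier G; h \<in> carrier G\<rbrakk> \<Longrightarrow> even (L (g \<otimes> h)) \<longleftrightarrow> even (L g + L h)"
    and geodesic: "\<lbrakk>g \<in> carrier G; i \<le> L g\<rbrakk> \<Longrightarrow> \<exists>k\<in>carrier G. L k = i \<and> L (inv k \<otimes> g) = L g - i"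
begin

definition overlap :: "'a \<Rightarrow> 'a \<Rightarrow> int" where
  "overlap g h = int (L g) + int (L h) - int (L (inv g \<otimes> h))"

lemma overlap_min:
  "\<lbrakk>g \<in> carrier G; h \<in> carrier G; k \<in> carrier G\<rbrakk> \<Longrightarrow> min (overlap g k) (overlap k h) \<le> overlap g h"
  unfolding overlap_def by (rule four_point)

lemma overlap_commute: "g \<in> carrier G \<Longrightarrow> h \<in> carrier G \<Longrightarrow> overlap g h = overlap h g"
  using L_inv[of "inv g \<otimes> h"] by (simp add: overlap_def inv_mult_group)

lemma overlap_nonneg: "g \<in> carrier G \<Longrightarrow> h \<in> carrier G \<Longrightarrow> 0 \<le> overlap g h"
  using overlap_min[of g h \<one>] by (simp add: overlap_def L_one L_inv)

lemma overlap_inv: "g \<in> carrier G \<Longrightarrow> overlap (inv g) h = int (L g) + int (L h) - int (L (g \<otimes> h))"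
  by (simp add: overlap_def L_inv)

lemma L_pos: "g \<in> carrier G \<Longrightarrow> g \<noteq> \<one> \<Longrightarrow> 0 < L g"
  using L_square[of g] overlap_nonneg[of "inv g" g] by (simp add: overlap_inv)

text \<open>Cut \<open>y = k m\<close> into halves of length \<open>n\<close> and let
  \<open>q\<close> be the inverse of \<open>m\<close>. The two equalities say that half of
  \<open>y\<close> cancels in \<open>x y\<close> and in \<open>y x\<close>, so \<open>x\<close> ends
  in the inverse of \<open>k\<close> and begins with \<open>q\<close>. Conjugation by
  \<open>q\<close> then takes \<open>x y\<close> to \<open>x\<close> with both ends removed, and
  \<open>y\<close> to \<open>m k\<close>, which is no longer than \<open>y\<close>.\<close>

lemma conj_shorter:
  assumes x: "x \<in> carrier G" and y: "y \<in> carrier G" "y \<noteq> \<one>"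
    and xy: "L (x \<otimes> y) = L x" "L (y \<otimes> x) = L x" and le: "L y \<le> L x"
  obtains q where "q \<in> carrier G" "L (inv q \<otimes> (x \<otimes> y) \<otimes> q) + L (inv q \<otimes> y \<otimes> q) < L x + L y"
proof -
  \<comment> \<open>Only half of \<open>y\<close> cancels exactly, so its length has to be even;
    parity gives this.\<close>
  have "even (L y)"
    using parity[OF x y(1)] xy by (cases "even (L x)") simp_all
  then obtain n where n: "L y = 2 * n" by blast
  obtain k where k: "k \<in> carrier G" "L k = n" "L (inv k \<otimes> y) = n"
    using geodesic[OF y(1), of n] n by auto
  define q where "q = inv y \<otimes> k"
  have q: "q \<in> carrier G" "L q = n"
    using y k L_inv[of "inv k \<otimes> y"] by (auto simp: q_def inv_mult_group)
  have yq: "y \<otimes> q = k"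
    using y k by (simp add: q_def m_assoc[symmetric])
  have "overlap (inv x) y = 2 * n" "overlap y k = 2 * n"
    using x y n xy k L_inv[of "inv k \<otimes> y"] L_inv[of x] by (simp_all add: overlap_inv overlap_def inv_mult_group)
  then have "2 * n \<le> overlap (inv x) k"
    using overlap_min[of "inv x" k y] x y k by simp
  then have xk: "L (x \<otimes> k) \<le> L x - n"
    using x k n le by (simp add: overlap_inv)
  have "overlap q (inv y) = 2 * n"
    using q y n k yq L_inv[of "y \<otimes> q"] by (simp add: overlap_def L_inv inv_mult_group[symmetric])
  moreover have "overlap (inv y) x = 2 * n"
    using x y n xy by (simp add: overlap_inv)
  ultimately have "2 * n \<le> overlap q x"
    using overlap_min[of q x "inv y"] x y q by simp
  moreover have "2 * n \<le> overlap x (x \<otimes> k)"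
  proof -
    have "int (L x) \<le> int (L (x \<otimes> k)) + int n"
      using overlap_nonneg[of "inv (x \<otimes> k)" "inv k"] overlap_inv[of "x \<otimes> k" "inv k"] x k
      by (simp add: L_inv m_assoc)
    moreover have "inv x \<otimes> (x \<otimes> k) = k"
      using x k by (simp add: m_assoc[symmetric])
    ultimately show ?thesis
      using n le k by (simp add: overlap_def)
  qed
  ultimately have "2 * n \<le> overlap q (x \<otimes> k)"
    using overlap_min[of q "x \<otimes> k" x] x q k by simp
  then have "L (inv q \<otimes> (x \<otimes> k)) \<le> L x - 2 * n"
    using xk q n le by (simp add: overlap_def)
  moreover have "inv q \<otimes> (x \<otimes> y) \<otimes> q = inv q \<otimes> (x \<otimes> k)"
    using x y q yq by (simp add: m_assoc)
  moreover have "L (inv q \<otimes> y \<otimes> q) \<le> 2 * n"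
    using overlap_nonneg[of q k] q k y yq by (simp add: overlap_def m_assoc)
  moreover have "0 < n"
    using L_pos[OF y] n by simp
  ultimately show ?thesis
    using that[OF q(1)] n le by simp
qed

section \<open>Nielsen reduction of generating pairs\<close>

definition reduced_list :: "'a set \<Rightarrow> 'a list \<Rightarrow> bool" where
  "reduced_list X xs \<longleftrightarrow> set xs \<subseteq> X \<and> successively (\<lambda>x y. x \<otimes> y \<noteq> \<one>) xs"

definition mult_list :: "'a list \<Rightarrow> 'a" where
  "mult_list xs = foldr (\<otimes>) xs \<one>"

lemma mult_list_simps [simp]: "mult_list [] = \<one>" "mult_list (x # xs) = x \<otimes> mult_list xs"
  by (simp_all add: mult_list_def)

lemma mult_list_closed: "set xs \<subseteq> carrier G \<Longrightarrow> mult_list xs \<in> carrier G"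
  by (induction xs) auto

lemma generate_reduced_list:
  assumes S: "S \<subseteq> carrier G" and g: "g \<in> generate G S"
  obtains xs where "reduced_list (S \<union> m_inv G ` S) xs" "g = mult_list xs"
proof -
  let ?X = "S \<union> m_inv G ` S"
  let ?D = "mult_list ` {xs. reduced_list ?X xs}"
  have X: "?X \<subseteq> carrier G" using S by auto
  have D: "?D \<subseteq> carrier G"
  proof (intro image_subsetI mult_list_closed)
    fix xs assume "xs \<in> {xs. reduced_list ?X xs}"
    then show "set xs \<subseteq> carrier G"
      using X unfolding reduced_list_def by blast
  qed
  have step: "x \<otimes> h \<in> ?D" if "x \<in> ?X" "h \<in> ?D" for x h
  proof -
    obtain xs where xs: "reduced_list ?X xs" "h = mult_list xs"
      using \<open>h \<in> ?D\<close> by blast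
    show ?thesis
    proof (cases "xs \<noteq> [] \<and> x \<otimes> hd xs = \<one>")
      case True
      then obtain y ys where ys: "xs = y # ys" "x \<otimes> y = \<one>"
        by (cases xs) auto
      then have "reduced_list ?X ys" "y \<in> ?X" "set ys \<subseteq> ?X"
        using xs(1) by (auto simp: reduced_list_def successively_Cons)
      moreover have cl: "x \<in> carrier G" "y \<in> carrier G" "mult_list ys \<in> carrier G"
        using X \<open>x \<in> ?X\<close> \<open>y \<in> ?X\<close> mult_list_closed[OF subset_trans[OF \<open>set ys \<subseteq> ?X\<close> X]] by blast+
      ultimately have "x \<otimes> h = mult_list ys"
        using xs(2) ys m_assoc[OF cl] by simp
      with \<open>reduced_list ?X ys\<close> show ?thesis by blast
    next
      case False
      then have "reduced_list ?X (x # xs)"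
        using xs(1) that(1) by (auto simp: reduced_list_def successively_Cons)
      moreover have "x \<otimes> h = mult_list (x # xs)"
        using xs by simp
      ultimately show ?thesis by blast
    qed
  qed
  have "\<forall>h\<in>?D. g \<otimes> h \<in> ?D"
    using g
  proof induction
    case (eng g1 g2)
    then show ?case
      using generate_in_carrier[OF S] D by (auto simp: m_assoc subset_iff)
  qed (use step D in auto)
  moreover have "\<one> \<in> ?D"
    by (rule image_eqI[of _ _ "[]"]) (auto simp: reduced_list_def)
  ultimately have "g \<otimes> \<one> \<in> ?D"
    by blast
  then have "g \<in> ?D"
    using generate_in_carrier[OF S g] by simp
  then show ?thesis using that by blast
qed

text \<open>Nielsen's cancellation argument: if in every product of two elements of \<open>X\<close> at most half of
  each factor cancels, and never both halves of a factor, then cancellation does not propagate.\<close>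

lemma nielsen_reduced:
  assumes X: "X \<subseteq> carrier G" "\<one> \<notin> X"
    and N1: "\<And>x y. \<lbrakk>x \<in> X; y \<in> X; x \<otimes> y \<noteq> \<one>\<rbrakk> \<Longrightarrow> L x \<le> L (x \<otimes> y) \<and> L y \<le> L (x \<otimes> y)"
    and N2: "\<And>x y z. \<lbrakk>x \<in> X; y \<in> X; z \<in> X; x \<otimes> y \<noteq> \<one>; y \<otimes> z \<noteq> \<one>\<rbrakk> \<Longrightarrow>
      L (x \<otimes> y) = L x \<Longrightarrow> L (y \<otimes> z) = L z \<Longrightarrow> False"
    and xs: "reduced_list X xs" "L (mult_list xs) = 1"
  shows "mult_list xs \<in> X"
proof -
  have red_Cons: "reduced_list X (x # y # ys) \<longleftrightarrow> x \<in> X \<and> x \<otimes> y \<noteq> \<one> \<and> reduced_list X (y # ys)" for x y ys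
    by (auto simp: reduced_list_def)
  have closed: "mult_list ys \<in> carrier G" if "reduced_list X ys" for ys
    using that X by (auto simp: reduced_list_def intro!: mult_list_closed)
  \<comment> \<open>In terms of overlaps: as much of \<open>x\<close> cancels against the whole tail
    as against its first entry \<open>y\<close>.\<close>
  have step: "L (mult_list (x # y # ys)) + L x + L y = L x + L (mult_list (y # ys)) + L (x \<otimes> y)"
    if "reduced_list X (x # y # ys)" for x y ys
    using that
  proof (induction ys arbitrary: x y)
    case Nil
    then show ?case using X by (auto simp: reduced_list_def)
  next
    case (Cons z zs)
    let ?g = "mult_list (y # z # zs)"
    have mem: "x \<in> X" "y \<in> X" "z \<in> X" "x \<otimes> y \<noteq> \<one>" "y \<otimes> z \<noteq> \<one>" "reduced_list X (y # z # zs)" "reduced_list X (z # zs)"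
      using Cons.prems by (auto simp: reduced_list_def)
    then have cl: "x \<in> carrier G" "y \<in> carrier G" "z \<in> carrier G" "?g \<in> carrier G" "mult_list (z # zs) \<in> carrier G"
      using X closed by (auto simp del: mult_list_simps)
    have g: "L ?g + L y + L z = L y + L (mult_list (z # zs)) + L (y \<otimes> z)"
      using Cons.IH[OF mem(6)] .
    have "inv y \<otimes> ?g = mult_list (z # zs)"
      using cl by (simp add: m_assoc[symmetric])
    then have "overlap y ?g = 2 * int (L y) - (int (L y) + int (L z) - int (L (y \<otimes> z)))"
      using g by (simp add: overlap_def)
    \<comment> \<open>At either end at most half of \<open>y\<close> cancels, and by
      \<open>N2\<close> not exactly half at both. So part of \<open>y\<close> survives, and the tail
      follows \<open>y\<close> beyond the point where the inverse of \<open>x\<close> branches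
      off.\<close>
    moreover have "L (x \<otimes> y) \<noteq> L x \<or> L (y \<otimes> z) \<noteq> L z"
      using N2[OF mem(1-5)] by blast
    then have "overlap (inv x) y < 2 * int (L y) - (int (L y) + int (L z) - int (L (y \<otimes> z)))"
      using N1[OF mem(1,2,4)] N1[OF mem(2,3,5)] cl by (auto simp: overlap_inv)
    ultimately have "overlap (inv x) y < overlap y ?g"
      by simp
    then have "overlap (inv x) ?g = overlap (inv x) y"
      using overlap_min[of "inv x" ?g y] overlap_min[of "inv x" y ?g] overlap_commute[of y ?g] cl by simp
    then show ?case
      using cl by (simp add: overlap_inv)
  qed
  have mono: "L (mult_list (y # ys)) \<le> L (mult_list (x # y # ys))" if "reduced_list X (x # y # ys)" for x y ys
    using step[OF that] N1[of x y] that by (auto simp: reduced_list_def)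
  have "length xs \<le> 1"
  proof (rule ccontr)
    assume "\<not> length xs \<le> 1"
    then obtain ys y where "xs = ys @ [y]" "ys \<noteq> []"
      by (cases xs rule: rev_cases) auto
    then obtain zs x where "xs = zs @ [x, y]"
      by (cases ys rule: rev_cases) auto
    then have "reduced_list X (zs @ [x, y])" "L (mult_list (zs @ [x, y])) \<le> 1"
      using xs by auto
    then have "L (mult_list [x, y]) \<le> 1 \<and> reduced_list X [x, y]"
    proof (induction zs)
      case (Cons z zs)
      obtain y' ys where "zs @ [x, y] = y' # ys" by (cases zs) auto
      then show ?case
        using Cons mono[of z y' ys] red_Cons[of z y' ys] by (auto simp del: mult_list_simps)
    qed simp
    then have xy: "x \<in> X" "y \<in> X" "x \<otimes> y \<noteq> \<one>" "L (x \<otimes> y) \<le> 1"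
      using X by (auto simp: reduced_list_def)
    then have "x \<in> carrier G" "y \<in> carrier G" "0 < L x" "0 < L y"
      using X L_pos[of x] L_pos[of y] by auto
    \<comment> \<open>All three lengths would equal one, against parity.\<close>
    then show False
      using N1[OF xy(1-3)] xy(4) parity[of x y] by (cases "L x = 1 \<and> L y = 1 \<and> L (x \<otimes> y) = 1") auto
  qed
  moreover have "xs \<noteq> []"
    using xs L_one by auto
  ultimately obtain x where "xs = [x]"
    by (cases xs) auto
  then show ?thesis
    using xs X by (auto simp: reduced_list_def)
qed

lemma generate_eq_carrierI:
  assumes "S \<subseteq> carrier G" "generate G T = carrier G" "T \<subseteq> generate G S"
  shows "generate G S = carrier G"
  using assms generate_incl generate_is_subgroup generate_subgroup_incl by blast

lemma generate_pair_mult: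
  assumes xy: "x \<in> carrier G" "y \<in> carrier G" and gen: "generate G {x, y} = carrier G"
  shows "generate G {x \<otimes> y, y} = carrier G"
proof -
  have sub: "{x \<otimes> y, y} \<subseteq> carrier G"
    using xy by simp
  have mem: "x \<otimes> y \<in> generate G {x \<otimes> y, y}" "y \<in> generate G {x \<otimes> y, y}"
    by (auto intro: generate.incl)
  have "(x \<otimes> y) \<otimes> inv y \<in> generate G {x \<otimes> y, y}"
    using mem generate_m_inv_closed[OF sub] by (blast intro: generate.eng)
  then have "{x, y} \<subseteq> generate G {x \<otimes> y, y}"
    using xy mem by (simp add: m_assoc)
  then show ?thesis
    using generate_eq_carrierI[OF sub gen] by simp
qed

text \<open>Induction on \<open>L u + L v\<close>. A pair is replaced when a product shortens an
  entry, or when \<open>conj_shorter\<close> applies; otherwise it is Nielsen reduced and every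
  element of length one is an entry or the inverse of one. Allowing conjugation gives a strict
  decrease where the usual reduction breaks ties by ordering the halves of words.\<close>

theorem nielsen_induct:
  assumes noncyclic: "\<And>g. g \<in> carrier G \<Longrightarrow> generate G {g} \<noteq> carrier G"
    and uv: "u \<in> carrier G" "v \<in> carrier G" "generate G {u, v} = carrier G"
    and swap: "\<And>u v. \<lbrakk>u \<in> carrier G; v \<in> carrier G; P v u\<rbrakk> \<Longrightarrow> P u v"
    and inv: "\<And>u v. \<lbrakk>u \<in> carrier G; v \<in> carrier G; P (inv u) v\<rbrakk> \<Longrightarrow> P u v"
    and mult: "\<And>u v. \<lbrakk>u \<in> carrier G; v \<in> carrier G; P (u \<otimes> v) v\<rbrakk> \<Longrightarrow> P u v"
    and conj: "\<And>u v q. \<lbrakk>u \<in> carrier G; v \<in> carrier G; q \<in> carrier G; P (inv q \<otimes> u \<otimes> q) (inv q \<otimes> v \<otimes> q)\<rbrakk> \<Longrightarrow> P u v"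
    and base: "\<And>u v. \<lbrakk>u \<in> carrier G; v \<in> carrier G;
      {g \<in> carrier G. L g = 1} \<subseteq> {u, v, inv u, inv v}\<rbrakk> \<Longrightarrow> P u v"
  shows "P u v"
  using uv
proof (induction "L u + L v" arbitrary: u v rule: less_induct)
  case less
  note [simp] = less.prems(1,2)
  \<comment> \<open>The variants of the pair up to exchanging and inverting its entries.\<close>
  define R where "R x y \<longleftrightarrow> (x \<in> {u, inv u} \<and> y \<in> {v, inv v}) \<or> (x \<in> {v, inv v} \<and> y \<in> {u, inv u})" for x y
  have R: "x \<in> carrier G" "y \<in> carrier G" "L x + L y = L u + L v" "P x y \<Longrightarrow> P u v"
    "generate G {x, y} = carrier G" if "R x y" for x y
  proof -
    show xy: "x \<in> carrier G" "y \<in> carrier G" "L x + L y = L u + L v"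
      using that by (auto simp: R_def L_inv)
    have *: "P u v" if P: "P u' v'" and u': "u' = u \<or> u' = inv u" and v': "v' = v \<or> v' = inv v" for u' v'
    proof -
      have "v' \<in> carrier G"
        using v' by auto
      have "P u v'"
        using P u' inv[of u v'] \<open>v' \<in> carrier G\<close> by (elim disjE) simp_all
      then have "P v' u"
        using swap[of v' u] \<open>v' \<in> carrier G\<close> by simp
      then have "P v u"
        using v' inv[of v u] by (elim disjE) simp_all
      then show "P u v"
        using swap[of u v] by simp
    qed
    show "P u v" if P: "P x y"
    proof (cases "x \<in> {u, inv u} \<and> y \<in> {v, inv v}")
      case True
      then show ?thesis using *[OF P] by simp
    next
      case False
      then have "x \<in> {v, inv v}" "y \<in> {u, inv u}"
        using \<open>R x y\<close> by (auto simp: R_def)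
      moreover have "P y x" using swap[of y x] P xy by simp
      ultimately show ?thesis using *[of y x] by simp
    qed
    have sub: "{x, y} \<subseteq> carrier G"
      using xy by simp
    have "x \<in> generate G {x, y}" "y \<in> generate G {x, y}"
      by (auto intro: generate.incl)
    then have "{x, inv x, y, inv y} \<subseteq> generate G {x, y}"
      using generate_m_inv_closed[OF sub] by simp
    moreover have "{u, v} \<subseteq> {x, inv x, y, inv y}"
      using that by (auto simp: R_def)
    ultimately show "generate G {x, y} = carrier G"
      using generate_eq_carrierI[OF sub less.prems(3)] by blast
  qed
  have ne: "x \<noteq> \<one>" "y \<noteq> \<one>" if "R x y" for x y
  proof -
    have *: "\<not> {x, y} \<subseteq> {z, \<one>}" if "z \<in> carrier G" for z
    proof
      assume "{x, y} \<subseteq> {z, \<one>}"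
      then have "{x, y} \<subseteq> generate G {z}"
        using generate.incl[of z "{z}" G] generate.one[of G "{z}"] by blast
      then have "generate G {z} = carrier G"
        using generate_eq_carrierI[of "{z}" "{x, y}"] R(5)[OF \<open>R x y\<close>] that by simp
      then show False using noncyclic that by blast
    qed
    show "x \<noteq> \<one>" "y \<noteq> \<one>"
      using *[of x] *[of y] R(1,2)[OF that] by auto
  qed
  show ?case
  proof (cases "\<exists>x y. R x y \<and> L (x \<otimes> y) < L x")
    case True
    then obtain x y where xy: "R x y" "L (x \<otimes> y) < L x" by blast
    note Rxy = R[OF xy(1)]
    have "generate G {x \<otimes> y, y} = carrier G"
      using generate_pair_mult Rxy by blast
    then have "P (x \<otimes> y) y"
      using less.hyps[of "x \<otimes> y" y] Rxy xy by simp
    then show ?thesis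
      using mult[of x y] Rxy by blast
  next
    case False
    then have N1: "L x \<le> L (x \<otimes> y)" if "R x y" for x y
      using that by (meson not_le)
    have N1': "L y \<le> L (x \<otimes> y)" if "R x y" for x y
    proof -
      have "R (inv y) (inv x)"
        using that by (auto simp: R_def)
      from N1[OF this] show ?thesis
        using R(1,2)[OF that] L_inv[of "x \<otimes> y"] by (simp add: inv_mult_group L_inv)
    qed
    show ?thesis
    proof (cases "\<exists>x y. R x y \<and> L (x \<otimes> y) = L x \<and> L (y \<otimes> x) = L x")
      case True
      then obtain x y where xy: "R x y" "L (x \<otimes> y) = L x" "L (y \<otimes> x) = L x" by blast
      note Rxy = R[OF xy(1)]
      have "L y \<le> L x"
        using N1'[OF xy(1)] xy(2) by simp
      then obtain q where q: "q \<in> carrier G"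
        "L (inv q \<otimes> (x \<otimes> y) \<otimes> q) + L (inv q \<otimes> y \<otimes> q) < L x + L y"
        using conj_shorter[OF Rxy(1,2) ne(2)[OF xy(1)] xy(2,3)] by blast
      define c where "c g = inv q \<otimes> g \<otimes> q" for g
      have c: "group_hom G G c"
      proof (unfold_locales, rule homI)
        fix g h assume "g \<in> carrier G" "h \<in> carrier G"
        then show "c (g \<otimes> h) = c g \<otimes> c h"
          using q m_assoc[of q "inv q" "h \<otimes> q"] by (simp add: c_def m_assoc)
      qed (use q in \<open>simp add: c_def\<close>)
      have "c ` carrier G = carrier G"
      proof
        show "c ` carrier G \<subseteq> carrier G" using q by (auto simp: c_def)
        show "carrier G \<subseteq> c ` carrier G"
        proof
          fix g assume g: "g \<in> carrier G"
          have "inv q \<otimes> (q \<otimes> g) = g" using g q m_assoc[of "inv q" q g] by simp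
          then have "c (q \<otimes> g \<otimes> inv q) = g"
            using g q by (simp add: c_def m_assoc)
          then show "g \<in> c ` carrier G"
            using g q by (metis image_eqI inv_closed m_closed)
        qed
      qed
      then have c_gen: "generate G {c x, c y} = carrier G"
        using group_hom.generate_img[OF c, of "{x, y}"] Rxy by simp
      have c_cl: "c x \<in> carrier G" "c y \<in> carrier G" "c (x \<otimes> y) = c x \<otimes> c y"
        using group_hom.hom_closed[OF c] group_hom.hom_mult[OF c] Rxy by auto
      have "generate G {c x \<otimes> c y, c y} = carrier G"
        using generate_pair_mult c_cl c_gen by blast
      then have "P (c (x \<otimes> y)) (c y)"
        using less.hyps[of "c (x \<otimes> y)" "c y"] q(2) Rxy(3) c_cl by (simp add: c_def)
      then have "P (x \<otimes> y) y"
        using conj[of "x \<otimes> y" y q] Rxy q by (simp add: c_def)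
      then show ?thesis
        using mult[of x y] Rxy by blast
    next
      case False
      let ?X = "{u, v} \<union> m_inv G ` {u, v}"
      have X: "?X \<subseteq> carrier G" by auto
      have "R u v" by (simp add: R_def)
      then have "\<one> \<notin> ?X"
        using ne[OF \<open>R u v\<close>] inv_eq_1_iff[of u] inv_eq_1_iff[of v] by (auto simp: eq_commute[of \<one>])
      have dich: "x = y \<or> R x y" if "x \<in> ?X" "y \<in> ?X" "x \<otimes> y \<noteq> \<one>" for x y
        using that by (auto simp: R_def)
      have sq: "L x < L (x \<otimes> x)" if "x \<in> ?X" for x
        using L_square[OF subsetD[OF X that]] that \<open>\<one> \<notin> ?X\<close> by metis
      have "g \<in> ?X" if g: "g \<in> carrier G" "L g = 1" for g
      proof -
        obtain xs where xs: "reduced_list ?X xs" "g = mult_list xs"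
          using generate_reduced_list[of "{u, v}" g] less.prems g by auto
        have "mult_list xs \<in> ?X"
        proof (rule nielsen_reduced[OF X \<open>\<one> \<notin> ?X\<close> _ _ xs(1)])
          show "L x \<le> L (x \<otimes> y) \<and> L y \<le> L (x \<otimes> y)" if "x \<in> ?X" "y \<in> ?X" "x \<otimes> y \<noteq> \<one>" for x y
            using dich[OF that] sq[OF that(1)] N1 N1' by auto
          show False if "x \<in> ?X" "y \<in> ?X" "z \<in> ?X" "x \<otimes> y \<noteq> \<one>" "y \<otimes> z \<noteq> \<one>"
            "L (x \<otimes> y) = L x" "L (y \<otimes> z) = L z" for x y z
          proof -
            have Rs: "R x y" "R y z"
              using dich[OF that(1,2,4)] dich[OF that(2,3,5)] sq[OF that(2)] that by auto
            have cl: "x \<in> carrier G" "y \<in> carrier G" "z \<in> carrier G"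
              using that X by blast+
            have "inv v = inv u \<longleftrightarrow> v = u" "inv u = inv v \<longleftrightarrow> u = v"
              using inv_inv[of u] inv_inv[of v] less.prems by metis+
            then have "z = x \<or> z = inv x"
              using Rs by (auto simp: R_def)
            then show False
            \<comment> \<open>For \<open>z = x\<close> this is the excluded configuration of
              \<open>conj_shorter\<close>. For the inverse, \<open>y\<close> and its inverse both
              share an initial half with the inverse of \<open>x\<close>, hence with each other, and
              the square of \<open>y\<close> would be no longer than \<open>y\<close>.\<close>
            proof
              assume "z = x"
              then show False using False Rs that by blast
            next
              assume "z = inv x"
              then have "overlap y (inv x) = L y" "overlap (inv x) (inv y) = L y"
                using that cl overlap_commute[of y "inv x"] overlap_commute[of "inv x" "inv y"]
                by (simp_all add: overlap_inv L_inv)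
              then have "L y \<le> overlap y (inv y)"
                using overlap_min[of y "inv y" "inv x"] cl by simp
              then have "L (y \<otimes> y) \<le> L y"
                using cl overlap_commute[of y "inv y"] by (simp add: overlap_inv L_inv)
              then show False using sq[OF that(2)] by simp
            qed
          qed
          show "L (mult_list xs) = 1" using g xs by simp
        qed
        then show ?thesis using xs by simp
      qed
      then show ?thesis
        by (intro base) auto
    qed
  qed
qed

end

section \<open>The free group of rank two\<close>

fun common_prefix :: "'c list \<Rightarrow> 'c list \<Rightarrow> nat" where
  "common_prefix (x # xs) (y # ys) = (if x = y then Suc (common_prefix xs ys) else 0)"
| "common_prefix _ _ = 0"

lemma common_prefix_ultrametric: "min (common_prefix xs ys) (common_prefix ys zs) \<le> common_prefix xs zs"
proof (induction xs ys arbitrary: zs rule: common_prefix.induct)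
  case (1 x xs y ys)
  then show ?case by (cases zs) auto
qed simp_all

lemma common_prefix_nth: "i < common_prefix xs ys \<Longrightarrow> xs ! i = ys ! i"
  by (induction xs ys arbitrary: i rule: common_prefix.induct) (auto simp: nth_Cons' split: if_splits)

lemma common_prefix_take: "common_prefix (take i xs) xs = min i (length xs)"
  by (induction xs arbitrary: i) (auto simp: take_Cons')

text \<open>If the formal inverse of a freely reduced word agreed with it up to the middle, the
  middle letter would be its own inverse or the two middle letters would cancel.\<close>

lemma common_prefix_reverse_lt:
  assumes "successively (\<lambda>c d. d \<noteq> f c) E" "E \<noteq> []" "\<And>c. f c \<noteq> c" "\<And>c. f (f c) = c"
  shows "2 * common_prefix (rev (map f E)) E < length E"
proof (rule ccontr)
  assume "\<not> ?thesis"
  then have le: "length E \<le> 2 * common_prefix (rev (map f E)) E" by simp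
  define i where "i = (length E - 1) div 2"
  have i: "i < common_prefix (rev (map f E)) E" "i < length E" "length E - Suc i < length E"
    using le assms(2) unfolding i_def by (cases E; simp; linarith)+
  then have eq: "f (E ! (length E - Suc i)) = E ! i"
    using common_prefix_nth[OF i(1)] by (simp add: rev_nth)
  show False
  proof (cases "odd (length E)")
    case True
    then have "length E - Suc i = i"
      unfolding i_def by presburger
    then show False using eq assms(3) by metis
  next
    case False
    then have "length E - Suc i = Suc i" "Suc i < length E"
      using assms(2) unfolding i_def by (cases E; simp; presburger)+
    then show False
      using eq successively_conv_nth[of "\<lambda>c d. d \<noteq> f c" E] assms(1,4) by metis
  qed
qed

definition unit_letter :: "int + int \<Rightarrow> bool \<times> bool" where
  "unit_letter x = (case x of Inl k \<Rightarrow> (True, k > 0) | Inr k \<Rightarrow> (False, k > 0))"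

definition exponent :: "int + int \<Rightarrow> nat" where
  "exponent x = (case x of Inl k \<Rightarrow> nat \<bar>k\<bar> | Inr k \<Rightarrow> nat \<bar>k\<bar>)"

definition flip :: "bool \<times> bool \<Rightarrow> bool \<times> bool" where
  "flip c = (fst c, \<not> snd c)"

lemma flip_simps [simp]: "flip (flip c) = c" "flip c \<noteq> c" "fst (flip c) = fst c" "flip c = flip d \<longleftrightarrow> c = d"
  by (cases c; cases d; simp add: flip_def)+

definition unit :: "bool \<times> bool \<Rightarrow> int + int" where
  "unit c = (let k = (if snd c then 1 else -1) in if fst c then Inl k else Inr k)"

text \<open>Here both factors are spelt out. This instance provides the word length for Nielsen
  reduction; the quasimorphism bounded on the orbits still reads only the signs of the first
  factor.\<close>

interpretation F2: spelling integer_group integer_group exponent unit_letter flip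
proof -
  interpret group_pair integer_group integer_group
    by (simp add: group_pair_def)
  show "spelling integer_group integer_group exponent unit_letter flip"
  proof (unfold_locales, goal_cases)
    case (1 x)
    then show ?case by (cases x) (auto simp: exponent_def)
  next
    case (2 x)
    then show ?case by (cases x) (auto simp: exponent_def unit_letter_def flip_def)
  qed (auto simp: inj_on_def)
qed

abbreviation F2 :: "(int + int) list monoid" where
  "F2 \<equiv> free_product integer_group integer_group"

abbreviation reduced2 :: "(int + int) list \<Rightarrow> bool" where
  "reduced2 \<equiv> reduced_word integer_group integer_group"

text \<open>Spelling a word with the letters \<open>unit_letter\<close> gives the usual reduced words of the free group
  on two generators.\<close>

abbreviation expand :: "(int + int) list \<Rightarrow> (bool \<times> bool) list" where
  "expand \<equiv> F2.spell"

lemma letter_exponent: "letter integer_group integer_group x \<Longrightarrow> exponent x \<noteq> 0"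
  by (cases x) (auto simp: exponent_def)

lemma expand_eq_Nil [simp]: "reduced2 w \<Longrightarrow> expand w = [] \<longleftrightarrow> w = []"
  by (cases w) (auto simp: reduced_word_Cons letter_exponent)

lemma fst_hd_expand: "reduced2 w \<Longrightarrow> w \<noteq> [] \<Longrightarrow> fst (hd (expand w)) = isl (hd w)"
proof (cases w)
  case (Cons x v)
  moreover assume "reduced2 w"
  ultimately have "exponent x \<noteq> 0"
    by (simp add: reduced_word_Cons letter_exponent)
  then have "hd (expand w) = unit_letter x"
    using Cons by (cases "exponent x") auto
  then show ?thesis
    using Cons by (cases x) (auto simp: unit_letter_def)
qed simp

lemma expand_successively: "reduced2 w \<Longrightarrow> successively (\<lambda>c d. d \<noteq> flip c) (expand w)"
proof (induction w)
  case (Cons x w)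
  have rep: "successively (\<lambda>c d. d \<noteq> flip c) (replicate n c)" for n and c :: "bool \<times> bool"
    using flip_simps(2)[of c] by (induction n) (auto simp: successively_Cons simp del: flip_simps(2))
  have "hd (expand w) \<noteq> flip (unit_letter x)" if "w \<noteq> []"
  proof
    assume "hd (expand w) = flip (unit_letter x)"
    then have "fst (hd (expand w)) = isl x"
      by (cases x) (auto simp: unit_letter_def)
    then show False
      using that Cons.prems fst_hd_expand by (auto simp: reduced_word_Cons)
  qed
  then show ?case
    using Cons rep by (auto simp: successively_append_iff reduced_word_Cons)
qed simp

lemma letter_unit [simp]: "letter integer_group integer_group (unit c)"
  by (cases c) (auto simp: unit_def Let_def)

text \<open>The exponent of the leading syllable changes by one, so multiplication by a unit letter
  becomes a step of free reduction.\<close>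

lemma expand_push:
  assumes "reduced2 w"
  shows "expand (push_letter integer_group integer_group (unit c) w) =
    (if w \<noteq> [] \<and> hd (expand w) = flip c then tl (expand w) else c # expand w)"
proof (cases "w = [] \<or> isl (unit c) \<noteq> isl (hd w)")
  case True
  have "exponent (unit c) = 1" "unit_letter (unit c) = c" "isl (unit c) = fst c"
    by (cases c; auto simp: exponent_def unit_letter_def unit_def Let_def)+
  moreover have "hd (expand w) \<noteq> flip c" if "w \<noteq> []"
    using fst_hd_expand[OF assms that] True that \<open>isl (unit c) = fst c\<close> flip_simps(3)[of c] by metis
  ultimately show ?thesis
    using True by (auto simp: push_letter_alternating)
next
  case False
  then obtain y v where w: "w = y # v" "isl (unit c) = isl y"
    by (cases w) auto
  obtain b e where c: "c = (b, e)" by (cases c)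
  have "isl (unit c) = b"
    by (simp add: c unit_def Let_def)
  then obtain k where y: "y = (if b then Inl k else Inr k)" "k \<noteq> 0"
    using w assms by (cases y) (auto simp: reduced_word_Cons)
  define j where "j = (if e then 1 else - 1 :: int)"
  have push: "push_letter integer_group integer_group (unit c) w =
      (if j + k = 0 then v else (if b then Inl (j + k) else Inr (j + k)) # v)"
    using y(1) w(1) c by (cases b; cases e; simp add: unit_def Let_def j_def)
  have spelt: "expand ((if b then Inl i else Inr i) # v) = replicate (nat \<bar>i\<bar>) (b, i > 0) @ expand v" for i
    by (simp add: exponent_def unit_letter_def)
  have w_eq: "expand w = replicate (nat \<bar>k\<bar>) (b, k > 0) @ expand v"
    using spelt[of k] w(1) y(1) by simp
  have w_Cons: "expand w = (b, k > 0) # replicate (nat \<bar>k\<bar> - 1) (b, k > 0) @ expand v"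
    unfolding w_eq using y(2) by (cases "nat \<bar>k\<bar>") simp_all
  show ?thesis
  proof (cases "e = (k > 0)")
    case True
    then have "j + k \<noteq> 0" "nat \<bar>j + k\<bar> = Suc (nat \<bar>k\<bar>)" "(j + k > 0) = e"
      using y(2) by (auto simp: j_def)
    then have "expand (push_letter integer_group integer_group (unit c) w) = c # expand w"
      using push spelt[of "j + k"] w_eq True c by simp
    then show ?thesis
      using w_Cons True c by (simp add: flip_def)
  next
    case False
    then have k: "nat \<bar>j + k\<bar> = nat \<bar>k\<bar> - 1" "j + k \<noteq> 0 \<Longrightarrow> (j + k > 0) = (k > 0)"
      using y(2) by (auto simp: j_def)
    have "expand (push_letter integer_group integer_group (unit c) w) = tl (expand w)"
    proof (cases "j + k = 0")
      case True
      then show ?thesis using push w_Cons k(1) by simp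
    next
      case False
      then show ?thesis using push spelt[of "j + k"] w_Cons k by simp
    qed
    then show ?thesis
      using w_Cons w(1) False c by (auto simp: flip_def)
  qed
qed

lemma reduced_unit: "reduced2 [unit c]"
  by (simp add: reduced_word_Cons)

lemma push_unit: "push_letter integer_group integer_group (unit c) w = [unit c] \<otimes>\<^bsub>F2\<^esub> w"
  by (simp add: F2.mult_Cons)

lemma inv_unit: "inv\<^bsub>F2\<^esub> [unit c] = [unit (flip c)]"
  using F2.inv_word[OF reduced_unit, of c] by (cases c) (auto simp: unit_def Let_def flip_def)

text \<open>Induction over unit letters, which list induction over the syllables of the normal form
  does not provide.\<close>

lemma expand_induct [consumes 1, case_names Nil Cons]:
  assumes "reduced2 w" "P []"
    and step: "\<And>c w. \<lbrakk>reduced2 w; P w; w = [] \<or> hd (expand w) \<noteq> flip c;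
      expand ([unit c] \<otimes>\<^bsub>F2\<^esub> w) = c # expand w\<rbrakk> \<Longrightarrow> P ([unit c] \<otimes>\<^bsub>F2\<^esub> w)"
  shows "P w"
  using assms(1)
proof (induction "length (expand w)" arbitrary: w rule: less_induct)
  case less
  show ?case
  proof (cases "w = []")
    case False
    then obtain c r where cr: "expand w = c # r"
      using less.prems by (metis expand_eq_Nil list.exhaust)
    define v where "v = [unit (flip c)] \<otimes>\<^bsub>F2\<^esub> w"
    have v: "reduced2 v"
      using less.prems reduced_unit by (simp add: v_def)
    have ev: "expand v = r"
      using expand_push[OF less.prems, of "flip c"] cr False by (simp add: v_def push_unit)
    have w: "w = [unit c] \<otimes>\<^bsub>F2\<^esub> v"
      using less.prems reduced_unit inv_unit[of c] F2.FP.m_assoc[of "[unit c]" "[unit (flip c)]" w]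
        F2.FP.r_inv[of "[unit c]"] by (simp add: v_def)
    have "P v"
      using less.hyps[OF _ v] cr ev by simp
    moreover have "v = [] \<or> hd (expand v) \<noteq> flip c"
      using expand_successively[OF less.prems] cr ev v by (auto simp: successively_Cons)
    ultimately show ?thesis
      using step[OF v, of c] w cr ev by simp
  qed (use assms in simp)
qed

text \<open>Exactly the common prefix cancels. The induction moves the first unit letter of
  \<open>g\<close> over to \<open>h\<close>.\<close>

lemma length_expand_inv_mult:
  assumes "reduced2 g" "reduced2 h"
  shows "length (expand (inv\<^bsub>F2\<^esub> g \<otimes>\<^bsub>F2\<^esub> h)) + 2 * common_prefix (expand g) (expand h) =
    length (expand g) + length (expand h)"
  using assms
proof (induction g arbitrary: h rule: expand_induct)
  case (Cons c g)
  let ?h = "[unit (flip c)] \<otimes>\<^bsub>F2\<^esub> h"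
  have eq: "inv\<^bsub>F2\<^esub> ([unit c] \<otimes>\<^bsub>F2\<^esub> g) \<otimes>\<^bsub>F2\<^esub> h = inv\<^bsub>F2\<^esub> g \<otimes>\<^bsub>F2\<^esub> ?h"
    using Cons.hyps(1) Cons.prems reduced_unit by (simp add: F2.FP.inv_mult_group inv_unit F2.FP.m_assoc)
  have IH: "length (expand (inv\<^bsub>F2\<^esub> g \<otimes>\<^bsub>F2\<^esub> ?h)) + 2 * common_prefix (expand g) (expand ?h) =
    length (expand g) + length (expand ?h)"
    using Cons.IH[of ?h] Cons.prems reduced_unit by simp
  have e: "expand ?h = (if h \<noteq> [] \<and> hd (expand h) = c then tl (expand h) else flip c # expand h)"
    using expand_push[OF Cons.prems, of "flip c"] by (simp add: push_unit)
  show ?case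
  proof (cases "h \<noteq> [] \<and> hd (expand h) = c")
    case True
    then obtain r where "expand h = c # r"
      using Cons.prems by (metis expand_eq_Nil list.collapse)
    then show ?thesis
      using True IH e eq Cons.hyps by simp
  next
    case False
    then have "expand ?h = flip c # expand h"
      using e by auto
    moreover have "common_prefix (c # expand g) (expand h) = 0"
      using False Cons.prems by (cases "expand h") auto
    moreover have "common_prefix (expand g) (flip c # expand h) = 0"
      using Cons.hyps by (cases "expand g") auto
    ultimately show ?thesis
      using IH eq Cons.hyps by simp
  qed
qed simp

lemma expand_inv: "reduced2 g \<Longrightarrow> expand (inv\<^bsub>F2\<^esub> g) = rev (map flip (expand g))"
  by (simp add: F2.inv_word F2.spell_rev F2.spell_map_letter_inv)

lemma prefix_word:
  assumes "reduced2 g"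
  shows "\<exists>k. reduced2 k \<and> expand k = take i (expand g)"
  using assms
proof (induction g arbitrary: i rule: expand_induct)
  case Nil
  show ?case by (intro exI[of _ "[]"]) simp
next
  case (Cons c g)
  show ?case
  proof (cases i)
    case 0
    then show ?thesis by (intro exI[of _ "[]"]) simp
  next
    case (Suc n)
    obtain k where k: "reduced2 k" "expand k = take n (expand g)"
      using Cons.IH by blast
    have "k = [] \<or> hd (expand k) \<noteq> flip c"
      using k Cons.hyps by (cases "expand g"; cases n) auto
    then have "expand ([unit c] \<otimes>\<^bsub>F2\<^esub> k) = c # expand k"
      using expand_push[OF k(1), of c] by (auto simp: push_unit)
    then show ?thesis
      using k Suc Cons.hyps reduced_unit by (intro exI[of _ "[unit c] \<otimes>\<^bsub>F2\<^esub> k"]) simp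
  qed
qed

text \<open>Overlaps are twice the lengths of common prefixes, so the four-point condition is their
  ultrametric inequality; prefixes provide the points on geodesics.\<close>

interpretation F2_tree: tree_length F2 "\<lambda>g. length (expand g)"
proof (unfold_locales, goal_cases)
  case (2 g)
  then show ?case by (simp add: expand_inv)
next
  case (3 g h k)
  then show ?case
    using length_expand_inv_mult[of g h] length_expand_inv_mult[of g k] length_expand_inv_mult[of k h]
      common_prefix_ultrametric[of "expand g" "expand k" "expand h"] by simp
next
  case (4 g)
  then show ?case
    using length_expand_inv_mult[of "inv\<^bsub>F2\<^esub> g" g] expand_inv[of g]
      common_prefix_reverse_lt[OF expand_successively[of g]] by simp
next
  case (5 g h)
  have "length (expand (g \<otimes>\<^bsub>F2\<^esub> h)) + 2 * common_prefix (expand (inv\<^bsub>F2\<^esub> g)) (expand h) = length (expand g) + length (expand h)"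
    using length_expand_inv_mult[of "inv\<^bsub>F2\<^esub> g" h] 5 by (simp add: expand_inv)
  from arg_cong[OF this, of even] show ?case
    by simp
next
  case (6 g i)
  then obtain k where "reduced2 k" "expand k = take i (expand g)"
    using prefix_word[of g i] by auto
  then show ?case
    using 6 length_expand_inv_mult[of k g] by (intro bexI[of _ k]) (simp_all add: common_prefix_take)
qed simp

section \<open>The involution inverting the standard basis\<close>

lemma letter_inv_integer [simp]:
  "letter_inv integer_group integer_group (Inl k) = Inl (- k)"
  "letter_inv integer_group integer_group (Inr k) = Inr (- k)"
  by simp_all

abbreviation negate :: "(int + int) list \<Rightarrow> (int + int) list" where
  "negate \<equiv> map (letter_inv integer_group integer_group)"

lemma reduced_negate: "reduced2 w \<Longrightarrow> reduced2 (negate w)"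
  by (induction w) (auto simp: reduced_word_Cons F2.letter_letter_inv hd_map)

lemma negate_push:
  "negate (push_letter integer_group integer_group x w) =
    push_letter integer_group integer_group (letter_inv integer_group integer_group x) (negate w)"
  by (cases x; cases w; cases "hd w"; auto)

lemma negate_mult: "negate (u \<otimes>\<^bsub>F2\<^esub> w) = negate u \<otimes>\<^bsub>F2\<^esub> negate w"
  by (induction u) (simp_all add: F2.mult_Cons negate_push)

interpretation negate: group_hom F2 F2 negate
  by unfold_locales (simp add: hom_def negate_mult reduced_negate)

text \<open>The same conjugator serves both entries: only then does the property pass to products of
  the entries.\<close>

definition negated_by_conj :: "(int + int) list \<Rightarrow> (int + int) list \<Rightarrow> bool" where
  "negated_by_conj u v \<longleftrightarrow> (\<exists>h. reduced2 h \<and>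
    negate u = h \<otimes>\<^bsub>F2\<^esub> inv\<^bsub>F2\<^esub> u \<otimes>\<^bsub>F2\<^esub> inv\<^bsub>F2\<^esub> h \<and>
    negate v = h \<otimes>\<^bsub>F2\<^esub> inv\<^bsub>F2\<^esub> v \<otimes>\<^bsub>F2\<^esub> inv\<^bsub>F2\<^esub> h)"

lemma (in group) inv_conj:
  "g \<in> carrier G \<Longrightarrow> h \<in> carrier G \<Longrightarrow> inv (h \<otimes> g \<otimes> inv h) = h \<otimes> inv g \<otimes> inv h"
  by (simp add: inv_mult_group m_assoc)

lemma (in group) inv_cancel_left [simp]:
  "g \<in> carrier G \<Longrightarrow> h \<in> carrier G \<Longrightarrow> inv g \<otimes> (g \<otimes> h) = h"
  "g \<in> carrier G \<Longrightarrow> h \<in> carrier G \<Longrightarrow> g \<otimes> (inv g \<otimes> h) = h"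
  by (simp_all add: m_assoc[symmetric])

lemma negated_by_conj_inv:
  assumes "reduced2 u" "reduced2 v" "negated_by_conj (inv\<^bsub>F2\<^esub> u) v"
  shows "negated_by_conj u v"
proof -
  obtain h where h: "reduced2 h" "negate (inv\<^bsub>F2\<^esub> u) = h \<otimes>\<^bsub>F2\<^esub> u \<otimes>\<^bsub>F2\<^esub> inv\<^bsub>F2\<^esub> h"
    "negate v = h \<otimes>\<^bsub>F2\<^esub> inv\<^bsub>F2\<^esub> v \<otimes>\<^bsub>F2\<^esub> inv\<^bsub>F2\<^esub> h"
    using assms by (auto simp: negated_by_conj_def)
  then have "inv\<^bsub>F2\<^esub> (negate u) = h \<otimes>\<^bsub>F2\<^esub> u \<otimes>\<^bsub>F2\<^esub> inv\<^bsub>F2\<^esub> h"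
    using assms negate.hom_inv[of u] by simp
  then have "negate u = inv\<^bsub>F2\<^esub> (h \<otimes>\<^bsub>F2\<^esub> u \<otimes>\<^bsub>F2\<^esub> inv\<^bsub>F2\<^esub> h)"
    using assms reduced_negate[of u] F2.FP.inv_inv[of "negate u"] by simp
  then show ?thesis
    using h assms F2.FP.inv_conj[of u h] by (auto simp: negated_by_conj_def)
qed

lemma negated_by_conj_mult:
  assumes "reduced2 u" "reduced2 v" "negated_by_conj (u \<otimes>\<^bsub>F2\<^esub> v) v"
  shows "negated_by_conj u v"
proof -
  obtain h where h: "reduced2 h" "negate (u \<otimes>\<^bsub>F2\<^esub> v) = h \<otimes>\<^bsub>F2\<^esub> inv\<^bsub>F2\<^esub> (u \<otimes>\<^bsub>F2\<^esub> v) \<otimes>\<^bsub>F2\<^esub> inv\<^bsub>F2\<^esub> h"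
    "negate v = h \<otimes>\<^bsub>F2\<^esub> inv\<^bsub>F2\<^esub> v \<otimes>\<^bsub>F2\<^esub> inv\<^bsub>F2\<^esub> h"
    using assms by (auto simp: negated_by_conj_def)
  \<comment> \<open>In the image of \<open>u\<close> the factors \<open>u\<close> and
    \<open>v\<close> appear inverted in the wrong order; conjugation by the inverse of
    \<open>v\<close> corrects this and fixes \<open>v\<close>.\<close>
  define k where "k = h \<otimes>\<^bsub>F2\<^esub> inv\<^bsub>F2\<^esub> v"
  have k: "reduced2 k" using h assms by (simp add: k_def)
  have "negate u = negate (u \<otimes>\<^bsub>F2\<^esub> v) \<otimes>\<^bsub>F2\<^esub> inv\<^bsub>F2\<^esub> (negate v)"
    using assms reduced_negate by (simp add: negate_mult F2.FP.m_assoc)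
  also have "\<dots> = k \<otimes>\<^bsub>F2\<^esub> inv\<^bsub>F2\<^esub> u \<otimes>\<^bsub>F2\<^esub> inv\<^bsub>F2\<^esub> k"
    unfolding h(2,3) k_def using h(1) assms by (simp add: F2.FP.inv_mult_group F2.FP.m_assoc)
  finally have "negate u = k \<otimes>\<^bsub>F2\<^esub> inv\<^bsub>F2\<^esub> u \<otimes>\<^bsub>F2\<^esub> inv\<^bsub>F2\<^esub> k" .
  moreover have "negate v = k \<otimes>\<^bsub>F2\<^esub> inv\<^bsub>F2\<^esub> v \<otimes>\<^bsub>F2\<^esub> inv\<^bsub>F2\<^esub> k"
    unfolding h(3) k_def using h(1) assms by (simp add: F2.FP.inv_mult_group F2.FP.m_assoc)
  ultimately show ?thesis
    using k by (auto simp: negated_by_conj_def)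
qed

lemma negated_by_conj_conj:
  assumes "reduced2 u" "reduced2 v" "reduced2 q"
    and "negated_by_conj (inv\<^bsub>F2\<^esub> q \<otimes>\<^bsub>F2\<^esub> u \<otimes>\<^bsub>F2\<^esub> q) (inv\<^bsub>F2\<^esub> q \<otimes>\<^bsub>F2\<^esub> v \<otimes>\<^bsub>F2\<^esub> q)"
  shows "negated_by_conj u v"
proof -
  let ?c = "\<lambda>w. inv\<^bsub>F2\<^esub> q \<otimes>\<^bsub>F2\<^esub> w \<otimes>\<^bsub>F2\<^esub> q"
  obtain h where h: "reduced2 h" "\<And>w. w \<in> {u, v} \<Longrightarrow> negate (?c w) = h \<otimes>\<^bsub>F2\<^esub> inv\<^bsub>F2\<^esub> (?c w) \<otimes>\<^bsub>F2\<^esub> inv\<^bsub>F2\<^esub> h"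
    using assms(4) by (auto simp: negated_by_conj_def)
  \<comment> \<open>The conjugator is transported along \<open>q\<close> on one side and along its
    image under \<open>negate\<close> on the other.\<close>
  define k where "k = negate q \<otimes>\<^bsub>F2\<^esub> h \<otimes>\<^bsub>F2\<^esub> inv\<^bsub>F2\<^esub> q"
  have nq: "reduced2 (negate q)" using assms(3) by (rule reduced_negate)
  have k: "reduced2 k" using h assms nq by (simp add: k_def)
  have "negate w = k \<otimes>\<^bsub>F2\<^esub> inv\<^bsub>F2\<^esub> w \<otimes>\<^bsub>F2\<^esub> inv\<^bsub>F2\<^esub> k" if "w \<in> {u, v}" for w
  proof -
    have w: "reduced2 w" using that assms by auto
    have nw: "reduced2 (negate w)" using w by (rule reduced_negate)
    have "negate (?c w) = inv\<^bsub>F2\<^esub> (negate q) \<otimes>\<^bsub>F2\<^esub> negate w \<otimes>\<^bsub>F2\<^esub> negate q"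
      using negate.hom_inv[of q] assms(3) by (simp add: negate_mult)
    then have "negate w = negate q \<otimes>\<^bsub>F2\<^esub> negate (?c w) \<otimes>\<^bsub>F2\<^esub> inv\<^bsub>F2\<^esub> (negate q)"
      using nq nw by (simp add: F2.FP.m_assoc)
    then show ?thesis
      unfolding h(2)[OF that] k_def using h(1) assms(3) nq w
      by (simp add: F2.FP.inv_mult_group F2.FP.m_assoc)
  qed
  then show ?thesis
    using k unfolding negated_by_conj_def by blast
qed

lemma generate_F2: "generate F2 {[Inl 1], [Inr 1]} = carrier F2"
proof (rule generate_integer_free_product)
  let ?S = "{[Inl 1], [Inr 1]} :: (int + int) list set"
  show S: "?S \<subseteq> carrier F2" by (simp add: reduced_word_Cons)
  fix k :: int assume "k \<noteq> \<one>\<^bsub>integer_group\<^esub>"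
  interpret inr: group_hom integer_group F2 F2.inr
    using F2.inr_mon by (simp add: mon_def group_hom_def group_hom_axioms_def F2.FP.is_group)
  have "[Inr k] = F2.inr (1 [^]\<^bsub>integer_group\<^esub> k)"
    using \<open>k \<noteq> _\<close> by (simp add: F2.inr_def)
  also have "\<dots> = [Inr 1] [^]\<^bsub>F2\<^esub> k"
    using inr.hom_int_pow[of 1 k] by (simp add: F2.inr_def)
  finally show "[Inr k] \<in> generate F2 ?S"
    using F2.FP.subgroup_int_pow_closed[OF F2.FP.generate_is_subgroup[OF S] generate.incl[of "[Inr 1]"]] by simp
qed simp_all

lemma F2_noncyclic:
  assumes "reduced2 g"
  shows "generate F2 {g} \<noteq> carrier F2"
proof
  assume "generate F2 {g} = carrier F2"
  then have "[Inl 1] \<in> generate F2 {g}" "[Inr 1] \<in> generate F2 {g}"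
    by (simp_all add: reduced_word_Cons)
  then obtain m n :: int where mn: "[Inl 1] = g [^]\<^bsub>F2\<^esub> m" "[Inr 1] = g [^]\<^bsub>F2\<^esub> n"
    using F2.FP.generate_pow[of g] assms by auto
  have "[Inl 1] \<otimes>\<^bsub>F2\<^esub> [Inr 1] = [Inr 1] \<otimes>\<^bsub>F2\<^esub> [Inl (1::int)]"
    unfolding mn using assms by (simp add: F2.FP.int_pow_mult[symmetric] add.commute)
  then show False
    by (simp add: F2.mult_Cons)
qed

lemma negated_by_conj_base:
  assumes uv: "reduced2 u" "reduced2 v"
    and "{g \<in> carrier F2. length (expand g) = 1} \<subseteq> {u, v, inv\<^bsub>F2\<^esub> u, inv\<^bsub>F2\<^esub> v}"
  shows "negated_by_conj u v"
proof -
  let ?a = "[Inl 1] :: (int + int) list" and ?b = "[Inr 1] :: (int + int) list"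
  have red: "reduced2 ?a" "reduced2 ?b"
    by (simp_all add: reduced_word_Cons)
  have inv: "inv\<^bsub>F2\<^esub> ?a = [Inl (-1)]" "inv\<^bsub>F2\<^esub> ?b = [Inr (-1)]"
    using red by (simp_all add: F2.inv_word)
  \<comment> \<open>Both have length one. They are neither equal nor inverse to each other, so they
    account for both \<open>u\<close> and \<open>v\<close>.\<close>
  have "?a \<in> {u, v, inv\<^bsub>F2\<^esub> u, inv\<^bsub>F2\<^esub> v}" "?b \<in> {u, v, inv\<^bsub>F2\<^esub> u, inv\<^bsub>F2\<^esub> v}"
    using assms(3) red by (auto simp: exponent_def)
  moreover have "x = inv\<^bsub>F2\<^esub> w" if "inv\<^bsub>F2\<^esub> x = w" "reduced2 x" for x w
    using that F2.FP.inv_inv[of x] by auto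
  ultimately have "u \<in> {?a, ?b, inv\<^bsub>F2\<^esub> ?a, inv\<^bsub>F2\<^esub> ?b} \<and> v \<in> {?a, ?b, inv\<^bsub>F2\<^esub> ?a, inv\<^bsub>F2\<^esub> ?b}"
    using uv red inv by (smt (verit) insert_iff empty_iff list.inject sum.distinct(1) sum.inject zero_neq_one)
  moreover have "negate w = inv\<^bsub>F2\<^esub> w" if "w \<in> {?a, ?b, inv\<^bsub>F2\<^esub> ?a, inv\<^bsub>F2\<^esub> ?b}" for w
    using that red inv F2.FP.inv_inv[of ?a] F2.FP.inv_inv[of ?b] by auto
  ultimately have "negate u = inv\<^bsub>F2\<^esub> u" "negate v = inv\<^bsub>F2\<^esub> v"
    by blast+
  then show ?thesis
    using uv unfolding negated_by_conj_def by (intro exI[of _ "[]"]) simp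
qed

lemma negated_by_conj_basis:
  assumes "reduced2 u" "reduced2 v" "generate F2 {u, v} = carrier F2"
  shows "negated_by_conj u v"
proof (rule F2_tree.nielsen_induct[OF _ _ _ assms(3)])
  show "negated_by_conj u v" if "negated_by_conj v u" for u v
    using that unfolding negated_by_conj_def by blast
  show "negated_by_conj u v" if "u \<in> carrier F2" "v \<in> carrier F2" "negated_by_conj (inv\<^bsub>F2\<^esub> u) v" for u v
    using that negated_by_conj_inv[of u v] by simp
  show "negated_by_conj u v" if "u \<in> carrier F2" "v \<in> carrier F2" "negated_by_conj (u \<otimes>\<^bsub>F2\<^esub> v) v" for u v
    using that negated_by_conj_mult[of u v] by simp
  show "negated_by_conj u v"
    if "u \<in> carrier F2" "v \<in> carrier F2" "q \<in> carrier F2"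
      "negated_by_conj (inv\<^bsub>F2\<^esub> q \<otimes>\<^bsub>F2\<^esub> u \<otimes>\<^bsub>F2\<^esub> q) (inv\<^bsub>F2\<^esub> q \<otimes>\<^bsub>F2\<^esub> v \<otimes>\<^bsub>F2\<^esub> q)" for u v q
    using that negated_by_conj_conj[of u v q] by simp
  show "negated_by_conj u v"
    if "u \<in> carrier F2" "v \<in> carrier F2"
      "{g \<in> carrier F2. length (expand g) = 1} \<subseteq> {u, v, inv\<^bsub>F2\<^esub> u, inv\<^bsub>F2\<^esub> v}" for u v
    using that negated_by_conj_base[of u v] by simp
qed (use assms F2_noncyclic in simp_all)

lemma admits_norm_free_group_rank_two: "admits_norm F2"
proof (rule admits_norm_integer_free_product_if_bounded[OF _ _ generate_F2])
  interpret sgn: spelling integer_group integer_group multiplicity positive Not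
    by (rule sign_spelling) simp
  let ?a = "[Inl 1] :: (int + int) list" and ?b = "[Inr 1] :: (int + int) list"
  show S: "{?a, ?b} \<subseteq> carrier F2"
    by (simp add: reduced_word_Cons)
  fix g assume g: "g \<in> {?a, ?b}"
  \<comment> \<open>The value at the image of \<open>g\<close> agrees with its own negative up to
    48, the cost of a conjugation, so it is at most 24 in absolute value.\<close>
  have "\<bar>sgn.qm (\<phi> g)\<bar> \<le> 24" if \<phi>: "\<phi> \<in> auto F2" for \<phi>
  proof -
    interpret \<phi>: group_hom F2 F2 \<phi>
      by (rule F2.FP.auto_group_hom[OF \<phi>])
    have "generate F2 (\<phi> ` {?a, ?b}) = carrier F2"
      using \<phi>.generate_img[OF S] generate_F2 F2.FP.auto_bij[OF \<phi>] by (simp add: bij_betw_def)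
    moreover have red: "reduced2 (\<phi> ?a)" "reduced2 (\<phi> ?b)"
      using \<phi>.hom_closed S by auto
    ultimately have "negated_by_conj (\<phi> ?a) (\<phi> ?b)"
      by (intro negated_by_conj_basis) simp_all
    then obtain h where h: "reduced2 h"
      "negate (\<phi> g) = h \<otimes>\<^bsub>F2\<^esub> inv\<^bsub>F2\<^esub> (\<phi> g) \<otimes>\<^bsub>F2\<^esub> inv\<^bsub>F2\<^esub> h"
      using g unfolding negated_by_conj_def by blast
    have r: "reduced2 (\<phi> g)"
      using g red by auto
    have "sgn.qm (\<phi> g) = sgn.qm (h \<otimes>\<^bsub>F2\<^esub> inv\<^bsub>F2\<^esub> (\<phi> g) \<otimes>\<^bsub>F2\<^esub> inv\<^bsub>F2\<^esub> h)"
      using sgn.qm_map_letter_inv[OF r] h(2) by simp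
    then show ?thesis
      using sgn.qm_mult[of "h \<otimes>\<^bsub>F2\<^esub> inv\<^bsub>F2\<^esub> (\<phi> g)" "inv\<^bsub>F2\<^esub> h"] sgn.qm_mult[of h "inv\<^bsub>F2\<^esub> (\<phi> g)"]
        sgn.qm_inv[OF r] sgn.qm_inv[OF h(1)] h(1) r by simp
  qed
  then show "\<exists>C. \<forall>\<phi>\<in>auto F2. \<bar>sgn.qm (\<phi> g)\<bar> \<le> C"
    by blast
qed simp_all

section \<open>Exchanging the factors and combining the cases\<close>

definition swap_sum :: "'x + 'y \<Rightarrow> 'y + 'x" where
  "swap_sum = case_sum Inr Inl"

lemma swap_sum_simps [simp]:
  "swap_sum (Inl x) = Inr x" "swap_sum (Inr y) = Inl y" "swap_sum (swap_sum z) = z"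
  "isl (swap_sum z) \<longleftrightarrow> \<not> isl z"
  by (cases z; simp add: swap_sum_def)+

lemma reduced_swap: "reduced_word A B w \<Longrightarrow> reduced_word B A (map swap_sum w)"
proof (induction w)
  case (Cons x w)
  moreover have "letter B A (swap_sum x)" if "letter A B x"
    using that by (cases x) auto
  ultimately show ?case
    by (auto simp: reduced_word_Cons hd_map)
qed simp

lemma push_swap: "map swap_sum (push_letter A B x w) = push_letter B A (swap_sum x) (map swap_sum w)"
  by (cases x; cases w; cases "hd w"; auto)

lemma free_product_swap: "free_product A B \<cong> free_product B A"
proof -
  have "map swap_sum (foldr (push_letter A B) u w) = foldr (push_letter B A) (map swap_sum u) (map swap_sum w)" for u w
    by (induction u) (simp_all add: push_swap)
  moreover have "bij_betw (map swap_sum) {w. reduced_word A B w} {w. reduced_word B A w}"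
    by (rule bij_betw_byWitness[of _ "map swap_sum"]) (auto simp: comp_def reduced_swap)
  ultimately have "map swap_sum \<in> iso (free_product A B) (free_product B A)"
    by (auto simp: iso_def hom_def free_product_def reduced_swap)
  then show ?thesis
    by (rule is_isoI)
qed

text \<open>Contrapositively, a non-trivial factor other than the group of order two has two
  distinct non-trivial letters, the two symbols of the chiral word.\<close>

lemma order_two_iso:
  assumes "group A" "\<not> trivial_group A"
    and two: "\<And>x y. \<lbrakk>x \<in> carrier A; y \<in> carrier A; x \<noteq> \<one>\<^bsub>A\<^esub>; y \<noteq> \<one>\<^bsub>A\<^esub>\<rbrakk> \<Longrightarrow> x = y"
  shows "A \<cong> integer_mod_group 2"
proof -
  interpret A: group A by fact
  obtain a where a: "a \<in> carrier A" "a \<noteq> \<one>\<^bsub>A\<^esub>"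
    using assms(2) A.is_group A.one_closed unfolding trivial_group_def by blast
  have carrier: "carrier A = {\<one>\<^bsub>A\<^esub>, a}"
    using a two[OF _ a(1) _ a(2)] A.one_closed by blast
  have aa: "a \<otimes>\<^bsub>A\<^esub> a = \<one>\<^bsub>A\<^esub>"
    using two[of "a \<otimes>\<^bsub>A\<^esub> a" a] a A.l_cancel_one[of a a] by (metis A.m_closed)
  define f where "f x = (if x = \<one>\<^bsub>A\<^esub> then 0 else 1 :: int)" for x
  have "bij_betw f (carrier A) (carrier (integer_mod_group 2))"
    unfolding bij_betw_def using a
    by (auto simp: carrier carrier_integer_mod_group f_def inj_on_def image_iff)
  moreover have "f \<in> hom A (integer_mod_group 2)"
    using a aa by (auto simp: hom_def carrier carrier_integer_mod_group f_def)
  ultimately show ?thesis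
    by (auto simp: iso_def is_iso_def)
qed

lemma admits_norm_large_factor:
  assumes "freely_indecomposable A" "\<not> A \<cong> integer_group" "freely_indecomposable B" "\<not> B \<cong> integer_group"
    and "\<not> A \<cong> integer_mod_group 2"
  shows "admits_norm (free_product A B)"
proof -
  obtain a a' where "a \<in> carrier A" "a' \<in> carrier A" "a \<noteq> \<one>\<^bsub>A\<^esub>" "a' \<noteq> \<one>\<^bsub>A\<^esub>" "a \<noteq> a'"
    using order_two_iso[of A] assms(1,5) unfolding freely_indecomposable_def by blast
  then show ?thesis
    using admits_norm_neither_infinite_cyclic[OF assms(1-4)] by blast
qed

lemma admits_norm_cyclic_factor:
  assumes A: "group A" "A \<cong> integer_group" and B: "freely_indecomposable B"
  shows "admits_norm (free_product A B)"
proof -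
  have grpB: "group B"
    using B by (simp add: freely_indecomposable_def)
  note grpAB = group_free_product[OF A(1) grpB]
  show ?thesis
  proof (cases "B \<cong> integer_group")
    case True
    have "free_product A B \<cong> F2"
      by (rule free_product_iso[OF A(1) grpB group_integer_group group_integer_group A(2) True])
    then show ?thesis
      by (rule admits_norm_iso[OF grpAB F2.FP.is_group _ admits_norm_free_group_rank_two])
  next
    case False
    have "free_product A B \<cong> free_product integer_group B"
      by (rule free_product_iso[OF A(1) grpB group_integer_group grpB A(2) iso_refl])
    then show ?thesis
      by (rule admits_norm_iso[OF grpAB group_free_product[OF group_integer_group grpB] _
          admits_norm_one_infinite_cyclic[OF B False]])
  qed
qed

theorem corollary1p1:
  fixes A :: "('a, 'm) monoid_scheme" and B :: "('b, 'n) monoid_scheme"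
    and G :: "('a + 'b) list monoid"
  assumes "freely_indecomposable A" and "freely_indecomposable B"
    and "G = free_product A B"
    and "\<not> G \<cong> infinite_dihedral_group"
  shows "\<exists>\<nu>. group_norm G \<nu> \<and> Aut_invariant G \<nu> \<and> stably_unbounded G \<nu>"
proof -
  have grp: "group A" "group B"
    using assms by (auto simp: freely_indecomposable_def)
  \<comment> \<open>The symbols are always read from the left factor, so the suitable factor is
    moved there.\<close>
  have swap: "admits_norm (free_product A B)" if "admits_norm (free_product B A)"
    using admits_norm_iso[OF group_free_product group_free_product free_product_swap that] grp by blast
  have "admits_norm (free_product A B)"
  proof (cases "A \<cong> integer_group \<or> B \<cong> integer_group")
    case True
    then show ?thesis
      using admits_norm_cyclic_factor[of A B] admits_norm_cyclic_factor[of B A] grp assms(1,2) swap by blast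
  next
    case False
    \<comment> \<open>This is where the infinite dihedral group is ruled out: some factor has at
      least two non-trivial elements.\<close>
    have "\<not> (A \<cong> integer_mod_group 2 \<and> B \<cong> integer_mod_group 2)"
      using assms(3,4) free_product_iso[OF grp group_integer_mod_group group_integer_mod_group]
      by (auto simp: infinite_dihedral_group_def)
    then show ?thesis
      using admits_norm_large_factor[of A B] admits_norm_large_factor[of B A] assms(1,2) False swap by blast
  qed
  then show ?thesis
    using assms(3) by (simp add: admits_norm_def)
qed

end
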